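(* Let $q:\mathbb Z\to\mathbb R$ and $H=-\Delta+q$. Assume $q\in\ell^{1,1}$ if $H$ is generic, and $q\in\ell^{1,2}$ if $H$ is not generic. Then there is $C>0$ such that for all $t\in\mathbb R$ $$\big\|P_c(H)e^{itH}\big\|_{B(\ell^1(\mathbb Z),\ell^\infty(\mathbb Z))}\le C\langle t\rangle^{-1/3}.$$
   Context: $(\Delta u)(n)=u(n+1)+u(n-1)-2u(n)$; $\ell^{p,\sigma}$ is the weighted $\ell^p$ space on $\mathbb Z$ with weight $\langle n\rangle^\sigma$, $\langle n\rangle=\sqrt{1+n^2}$. $P_d(H)$ is the spectral projection onto the discrete spectrum (span of eigenvectors) of the bounded self-adjoint operator $H$ on $\ell^2$, and $P_c(H)=1-P_d(H)$. Jost solutions $f_\pm(n,\theta)$, $\operatorname{Im}\theta\le0$: solutions of $Hf=2(1-\cos\theta)f$ with $f_\pm(n,\theta)-e^{\mp in\theta}\to0$ as $n\to\pm\infty$ (defined via the Volterra equations $m_\pm=e^{\pm in\theta}f_\pm$, $m_+(n)=1+\sum_{\nu\ge n}D(n-\nu,\theta)q(\nu)m_+(\nu)$, $m_-(n)=1+\sum_{\nu\le n}D(\nu-n,\theta)q(\nu)m_-(\nu)$, $D(k,\theta)=(1-e^{2ik\theta})/(2i\sin\theta)$). Wronskian $[u,v](n)=u(n+1)v(n)-u(n)v(n+1)$, $W(\theta)=[f_+(\cdot,\theta),f_-(\cdot,\theta)]$. $H$ is generic if $W(\theta_0)\neq0$ for every $\theta_0\in\{0,\pi,-\pi\}$ (equivalently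 $0$ and $4$ are not resonances). *)

theory Defs
  imports "HOL-Analysis.Analysis"
begin

definition jbr :: "real \<Rightarrow> real" where
  "jbr x = sqrt (1 + x\<^sup>2)"

definition l1w :: "real \<Rightarrow> (int \<Rightarrow> real) \<Rightarrow> bool" where
  "l1w \<sigma> q \<longleftrightarrow> (\<lambda>n. jbr (real_of_int n) powr \<sigma> * \<bar>q n\<bar>) summable_on UNIV"

definition Hop :: "(int \<Rightarrow> real) \<Rightarrow> (int \<Rightarrow> complex) \<Rightarrow> (int \<Rightarrow> complex)" where
  "Hop q u = (\<lambda>n. - (u (n + 1) + u (n - 1) - 2 * u n) + complex_of_real (q n) * u n)"

definition expH :: "(int \<Rightarrow> real) \<Rightarrow> real \<Rightarrow> (int \<Rightarrow> complex) \<Rightarrow> (int \<Rightarrow> complex)" where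
  "expH q t u = (\<lambda>n. \<Sum>k. (\<i> * complex_of_real t) ^ k / of_nat (fact k) * ((Hop q ^^ k) u) n)"

definition l2 :: "(int \<Rightarrow> complex) \<Rightarrow> bool" where
  "l2 f \<longleftrightarrow> (\<lambda>n. (cmod (f n))\<^sup>2) summable_on UNIV"

definition l2norm :: "(int \<Rightarrow> complex) \<Rightarrow> real" where
  "l2norm f = sqrt (\<Sum>\<^sub>\<infinity>n. (cmod (f n))\<^sup>2)"

definition l2inner :: "(int \<Rightarrow> complex) \<Rightarrow> (int \<Rightarrow> complex) \<Rightarrow> complex" where
  "l2inner f g = (\<Sum>\<^sub>\<infinity>n. f n * cnj (g n))"

definition l1 :: "(int \<Rightarrow> complex) \<Rightarrow> bool" where
  "l1 f \<longleftrightarrow> (\<lambda>n. cmod (f n)) summable_on UNIV"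

definition l1norm :: "(int \<Rightarrow> complex) \<Rightarrow> real" where
  "l1norm f = (\<Sum>\<^sub>\<infinity>n. cmod (f n))"

definition eigvecs :: "(int \<Rightarrow> real) \<Rightarrow> (int \<Rightarrow> complex) set" where
  "eigvecs q = {\<phi>. l2 \<phi> \<and> \<phi> \<noteq> (\<lambda>n. 0) \<and> (\<exists>E. \<forall>n. Hop q \<phi> n = E * \<phi> n)}"

definition lin_comb :: "(int \<Rightarrow> complex) set \<Rightarrow> (int \<Rightarrow> complex) set" where
  "lin_comb S = {(\<lambda>n. \<Sum>i<k. c i * v i n) | (k::nat) c v. \<forall>i<k. v i \<in> S}"

definition disc_space :: "(int \<Rightarrow> real) \<Rightarrow> (int \<Rightarrow> complex) set" where
  "disc_space q = {f. l2 f \<and> (\<forall>\<epsilon>>0. \<exists>g\<in>lin_comb (eigvecs q). l2norm (\<lambda>n. f n - g n) < \<epsilon>)}"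

definition Pd :: "(int \<Rightarrow> real) \<Rightarrow> (int \<Rightarrow> complex) \<Rightarrow> (int \<Rightarrow> complex)" where
  "Pd q u = (THE v. v \<in> disc_space q \<and> (\<forall>\<phi>\<in>disc_space q. l2inner (\<lambda>n. u n - v n) \<phi> = 0))"

definition Pc :: "(int \<Rightarrow> real) \<Rightarrow> (int \<Rightarrow> complex) \<Rightarrow> (int \<Rightarrow> complex)" where
  "Pc q u = (\<lambda>n. u n - Pd q u n)"

definition jost_plus :: "(int \<Rightarrow> real) \<Rightarrow> complex \<Rightarrow> (int \<Rightarrow> complex)" where
  "jost_plus q \<theta> = (THE f. (\<forall>n. Hop q f n = 2 * (1 - cos \<theta>) * f n) \<and>
      ((\<lambda>n. exp (\<i> * of_int n * \<theta>) * f n) \<longlongrightarrow> 1) at_top)"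

definition jost_minus :: "(int \<Rightarrow> real) \<Rightarrow> complex \<Rightarrow> (int \<Rightarrow> complex)" where
  "jost_minus q \<theta> = (THE f. (\<forall>n. Hop q f n = 2 * (1 - cos \<theta>) * f n) \<and>
      ((\<lambda>n. exp (- \<i> * of_int n * \<theta>) * f n) \<longlongrightarrow> 1) at_bot)"

definition wronskian :: "(int \<Rightarrow> complex) \<Rightarrow> (int \<Rightarrow> complex) \<Rightarrow> int \<Rightarrow> complex" where
  "wronskian u v n = u (n + 1) * v n - u n * v (n + 1)"

text \<open>W(theta) = [f_+, f_-]; the Wronskian of two solutions is independent of n,
  we evaluate at n = 0.\<close>
definition Wr :: "(int \<Rightarrow> real) \<Rightarrow> complex \<Rightarrow> complex" where
  "Wr q \<theta> = wronskian (jost_plus q \<theta>) (jost_minus q \<theta>) 0"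

definition generic :: "(int \<Rightarrow> real) \<Rightarrow> bool" where
  "generic q \<longleftrightarrow> (\<forall>\<theta>0\<in>{0, complex_of_real pi, - complex_of_real pi}. Wr q \<theta>0 \<noteq> 0)"

end

(* A Wiener-algebra proof. With z = exp(-i theta) the energy is 2 - z - 1/z, and the Jost solutions are
   z^n m_+(n,z) and z^(-n) m_-(n,z), where m_+ and m_- solve a Volterra equation whose coefficients are
   polynomials in z. For q in l^{1,1} these equations are solved in the algebra of absolutely convergent
   power series, with norms bounded uniformly on the half line.

   The Wronskian, multiplied by z, is such a series w(z). Its zeros in the open disc are real and simple,
   by self-adjointness, and are exactly the eigenvalues. On the unit circle w can vanish only at 1 and -1,
   and |w| >= |1 - z^2| there. After division by these resonant factors (this is where q in l^{1,2} is
   needed) Wiener's lemma shows that the transmission and reflection coefficients belong to the algebra.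
   Hence the kernel of P_c exp(itH) is the mean over the circle of exp(it(2 - z - 1/z)) against functions of
   uniformly bounded Wiener norm, and it is enough to estimate the Bessel integrals obtained from the
   single characters z^k, which are O(t^(-1/3)) by van der Corput.

   That this kernel belongs to P_c is seen at t = 0: the poles inside the disc give the identity (from z = 0)
   and a combination of eigenfunctions, and pairing the kernel with an eigenfunction leaves an
   integrand which is odd under z -> 1/z. *)
theory Submission
  imports Defs "HOL-Complex_Analysis.Cauchy_Integral_Formula"
begin

section \<open>Wiener algebras\<close>

text \<open>The decay has to be uniform in both sites. The Bessel bound is uniform in the frequency,
  so it suffices to bound the sum of the moduli of the Fourier coefficients of the amplitude, and
  such norms are submultiplicative. The obstacle is that m_- is controlled in the algebra only on
  half lines bounded from above, while both sites may lie far to the right. There the product of m_-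
  with the transmission coefficient is rewritten by the scattering relation in terms of m_+ alone;
  the left half line follows by reflecting the potential. Division by z - 1 or z + 1 can multiply
  the contribution of z^k by k, whence the second moment of \<open>q\<close> in the resonant case.
  The evolution is treated as an exponential series: each power of H is moved onto the kernel, where
  it acts as multiplication by 2 - z - 1/z under the mean, and the diagonal term left behind is odd
  under z -> 1/z. The kernel at t = 0 is identified by uniqueness of the orthogonal projection; this
  requires that every eigenvector, a priori also for an energy in the band or off the real axis,
  come from a zero of w in the open disc.\<close>

lemma infsum_dominated:
  fixes f :: "'a \<Rightarrow> 'b::banach"
  assumes "g summable_on A" "\<And>x. x \<in> A \<Longrightarrow> norm (f x) \<le> g x"
  shows "f summable_on A" "norm (infsum f A) \<le> infsum g A" "(\<lambda>x. norm (f x)) summable_on A"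
proof -
  show 1: "(\<lambda>x. norm (f x)) summable_on A"
    using Infinite_Sum.abs_summable_on_comparison_test'[OF assms] by simp
  then show 2: "f summable_on A" by (rule abs_summable_summable)
  show "norm (infsum f A) \<le> infsum g A"
    by (rule norm_infsum_le[where X = A and f = f and g = g]) (use assms 2 in auto)
qed

lemma has_sum_dominated_le:
  fixes f :: "'a \<Rightarrow> 'b::banach"
  assumes "g summable_on A" "infsum g A \<le> B" "(f has_sum S) A" "\<And>x. x \<in> A \<Longrightarrow> norm (f x) \<le> g x"
  shows "norm S \<le> B"
  using norm_infsum_le[where f = f and S = S and X = A and g = g and T = "infsum g A"] assms by auto

lemma summable_on_product_dominated:
  fixes f :: "'a \<Rightarrow> 'b \<Rightarrow> 'c::banach"
  assumes "b summable_on UNIV" "\<And>i. (g i) summable_on UNIV" "\<And>i. infsum (g i) UNIV \<le> b i"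
    "\<And>i j. norm (f i j) \<le> g i j"
  shows "(\<lambda>(i,j). g i j) summable_on UNIV" "infsum (\<lambda>(i,j). g i j) UNIV \<le> infsum b UNIV"
    "(\<lambda>(i,j). f i j) summable_on UNIV"
proof -
  have g0: "0 \<le> g i j" for i j using norm_ge_zero assms(4) order_trans by blast
  have gb: "(\<lambda>i. infsum (g i) UNIV) summable_on UNIV"
    by (rule summable_on_comparison_test[OF assms(1)]) (auto simp: assms g0 infsum_nonneg)
  have "(\<lambda>(i,j). g i j) summable_on (UNIV \<times> UNIV)"
    by (rule summable_on_SigmaI[OF _ gb]) (use assms(2) g0 in auto)
  then show 1: "(\<lambda>(i,j). g i j) summable_on UNIV" by simp
  have "infsum (\<lambda>(i,j). g i j) (UNIV \<times> UNIV) = infsum (\<lambda>i. infsum (g i) UNIV) UNIV"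
    using infsum_Sigma'_banach[of g UNIV "\<lambda>_. UNIV"] 1 by simp
  also have "\<dots> \<le> infsum b UNIV" by (rule infsum_mono[OF gb assms(1)]) (use assms in auto)
  finally show "infsum (\<lambda>(i,j). g i j) UNIV \<le> infsum b UNIV" by simp
  show "(\<lambda>(i,j). f i j) summable_on UNIV"
    by (rule infsum_dominated[OF 1]) (use assms in auto)
qed

text \<open>Fubini with a majorant \<open>g\<close> whose row sums are merely estimated by a
  summable \<open>b\<close>; the exchanges of summation over iterates, sites and powers of H below
  all have this shape.\<close>

lemma infsum_swap_dominated:
  fixes f :: "'a \<Rightarrow> 'b \<Rightarrow> 'c::banach"
  assumes "b summable_on UNIV" "\<And>i. (g i) summable_on UNIV" "\<And>i. infsum (g i) UNIV \<le> b i"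
    "\<And>i j. norm (f i j) \<le> g i j"
  shows "(\<Sum>\<^sub>\<infinity>i. \<Sum>\<^sub>\<infinity>j. f i j) = (\<Sum>\<^sub>\<infinity>j. \<Sum>\<^sub>\<infinity>i. f i j)"
  by (rule infsum_swap_banach) (use summable_on_product_dominated(3)[OF assms] in simp)

text \<open>The representation by characters need not be unique and frequencies may repeat: the predicate
  \<open>wa F B\<close> below only records that some absolutely convergent expansion of \<open>F\<close> has weighted norm at
  most \<open>B\<close>.\<close>
locale wiener =
  fixes e :: "'k::comm_monoid_add \<Rightarrow> complex \<Rightarrow> complex" and wt :: "'k \<Rightarrow> real" and D :: "complex set"
  assumes e_0: "z \<in> D \<Longrightarrow> e 0 z = 1"
    and e_add: "z \<in> D \<Longrightarrow> e (j + k) z = e j z * e k z"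
    and e_le: "z \<in> D \<Longrightarrow> norm (e k z) \<le> 1"
    and e_cont: "continuous_on D (e k)"
    and wt_0: "wt 0 = 1" and wt_mult: "wt (j + k) \<le> wt j * wt k" and wt_ge: "1 \<le> wt k"
begin

definition wa :: "(complex \<Rightarrow> complex) \<Rightarrow> real \<Rightarrow> bool" where
  "wa F B \<longleftrightarrow> (\<exists>(a::nat \<Rightarrow> complex) k. (\<lambda>i. wt (k i) * norm (a i)) summable_on UNIV \<and>
     (\<Sum>\<^sub>\<infinity>i. wt (k i) * norm (a i)) \<le> B \<and> (\<forall>z\<in>D. ((\<lambda>i. a i * e (k i) z) has_sum F z) UNIV))"

lemma wt_pos: "0 < wt k"
  using wt_ge[of k] by linarith

lemma term_le: "z \<in> D \<Longrightarrow> norm (a * e k z) \<le> wt k * norm a"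
  using mult_mono[of "norm (e k z)" "wt k" "norm a" "norm a"] e_le[of z k] wt_ge[of k]
  by (auto simp: norm_mult mult.commute)

lemma wa_ge_0: "wa F B \<Longrightarrow> 0 \<le> B"
  unfolding wa_def using wt_pos infsum_nonneg[of UNIV]
  by (smt (verit, best) mult_nonneg_nonneg norm_ge_zero)

lemma wa_mono: "wa F B \<Longrightarrow> B \<le> B' \<Longrightarrow> wa F B'"
  unfolding wa_def by (meson order_trans)

lemma wa_cong: "wa F B \<Longrightarrow> (\<And>z. z \<in> D \<Longrightarrow> F z = G z) \<Longrightarrow> wa G B"
  unfolding wa_def by simp

lemma wa_norm: assumes "wa F B" "z \<in> D" shows "norm (F z) \<le> B"
proof -
  obtain a k where *: "(\<lambda>i. wt (k i) * norm (a i)) summable_on (UNIV::nat set)"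
    "(\<Sum>\<^sub>\<infinity>i. wt (k i) * norm (a i)) \<le> B" "\<forall>z\<in>D. ((\<lambda>i. a i * e (k i) z) has_sum F z) UNIV"
    using assms(1) unfolding wa_def by blast
  show ?thesis
    by (rule has_sum_dominated_le[OF *(1,2)]) (use * assms(2) term_le in auto)
qed

lemma wa_continuous: assumes "wa F B" shows "continuous_on D F"
proof -
  obtain a k where *: "(\<lambda>i. wt (k i) * norm (a i)) summable_on (UNIV::nat set)"
    "\<forall>z\<in>D. ((\<lambda>i. a i * e (k i) z) has_sum F z) UNIV"
    using assms(1) unfolding wa_def by blast
  have "uniform_limit D (\<lambda>X z. \<Sum>i\<in>X. a i * e (k i) z) F (finite_subsets_at_top UNIV)"
    by (rule Weierstrass_m_test_general'[OF _ _ *(1)]) (use * term_le in auto)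
  then show ?thesis
    by (rule uniform_limit_theorem[rotated]) (auto intro!: always_eventually continuous_intros e_cont)
qed

lemma wa_family:
  fixes F :: "'i::countable \<Rightarrow> complex \<Rightarrow> complex"
  assumes F: "\<And>i. wa (F i) (B i)" and B: "B summable_on UNIV" and B': "infsum B UNIV \<le> B'"
  shows "wa (\<lambda>z. \<Sum>\<^sub>\<infinity>i. F i z) B'"
proof -
  define P where "P i a k \<longleftrightarrow> (\<lambda>j. wt (k j) * norm (a j)) summable_on (UNIV::nat set) \<and>
     (\<Sum>\<^sub>\<infinity>j. wt (k j) * norm (a j)) \<le> B i \<and> (\<forall>z\<in>D. ((\<lambda>j. a j * e (k j) z) has_sum F i z) UNIV)"
    for i a k
  have "\<forall>i. \<exists>a k. P i a k"
    using F unfolding wa_def P_def by blast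
  then obtain a k where P: "\<And>i. P i (a i) (k i)" by metis
  have s: "\<And>i. (\<lambda>j. wt (k i j) * norm (a i j)) summable_on (UNIV::nat set)"
    and b: "\<And>i. (\<Sum>\<^sub>\<infinity>j. wt (k i j) * norm (a i j)) \<le> B i"
    and h: "\<And>i z. z \<in> D \<Longrightarrow> ((\<lambda>j. a i j * e (k i j) z) has_sum F i z) UNIV"
    using P unfolding P_def by blast+
  have inf: "infinite (UNIV :: ('i \<times> nat) set)"
    by (simp add: finite_prod)
  \<comment> \<open>The double family of coefficients is enumerated along one sequence. Coinciding
    frequencies are left apart, so the norm bound is just the iterated sum.\<close>
  define \<phi> :: "nat \<Rightarrow> 'i \<times> nat" where "\<phi> = from_nat_into UNIV"
  have bij: "bij_betw \<phi> UNIV UNIV"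
    unfolding \<phi>_def by (rule bij_betw_from_nat_into) (use inf in auto)
  let ?g = "\<lambda>(i,j). wt (k i j) * norm (a i j)"
  have "norm (wt (k i j) * norm (a i j)) \<le> wt (k i j) * norm (a i j)" for i j
    using wt_pos[of "k i j"] by (simp add: abs_mult)
  note g = summable_on_product_dominated[OF B s b this]
  show ?thesis unfolding wa_def
  proof (intro exI[of _ "\<lambda>n. case_prod a (\<phi> n)"] exI[of _ "\<lambda>n. case_prod k (\<phi> n)"] conjI ballI)
    have eq: "(\<lambda>n. wt (case_prod k (\<phi> n)) * norm (case_prod a (\<phi> n))) = (\<lambda>n. ?g (\<phi> n))"
      by (auto simp: case_prod_unfold)
    show "(\<lambda>n. wt (case_prod k (\<phi> n)) * norm (case_prod a (\<phi> n))) summable_on UNIV"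
      unfolding eq using summable_on_reindex_bij_betw[OF bij, of ?g] g(1) by blast
    show "(\<Sum>\<^sub>\<infinity>n. wt (case_prod k (\<phi> n)) * norm (case_prod a (\<phi> n))) \<le> B'"
      unfolding eq infsum_reindex_bij_betw[OF bij] using g(2) B' by linarith
  next
    fix z assume z: "z \<in> D"
    let ?f = "\<lambda>i j. a i j * e (k i j) z"
    have fs: "(case_prod ?f) summable_on UNIV"
      by (rule infsum_dominated[OF g(1)]) (use term_le[OF z] in auto)
    have "infsum (case_prod ?f) UNIV = (\<Sum>\<^sub>\<infinity>i. \<Sum>\<^sub>\<infinity>j. ?f i j)"
      using infsum_Sigma'_banach[of ?f UNIV "\<lambda>_. UNIV"] fs by simp
    also have "\<dots> = (\<Sum>\<^sub>\<infinity>i. F i z)" using h[OF z] by (simp add: has_sum_iff)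
    finally have "((case_prod ?f) has_sum (\<Sum>\<^sub>\<infinity>i. F i z)) UNIV" using fs by (simp add: has_sum_iff)
    then have "((\<lambda>n. (case_prod ?f) (\<phi> n)) has_sum (\<Sum>\<^sub>\<infinity>i. F i z)) UNIV"
      using has_sum_reindex_bij_betw[OF bij] by blast
    then show "((\<lambda>n. case_prod a (\<phi> n) * e (case_prod k (\<phi> n)) z) has_sum (\<Sum>\<^sub>\<infinity>i. F i z)) UNIV"
      by (simp add: case_prod_unfold)
  qed
qed

lemma wa_zero: "wa (\<lambda>z. 0) 0"
  unfolding wa_def by (intro exI[of _ "\<lambda>_. 0"]) auto

lemma wa_char: "wa (\<lambda>z. c * e k z) (wt k * norm c)"
  unfolding wa_def
proof (intro exI[of _ "\<lambda>i. if i = 0 then c else 0"] exI[of _ "\<lambda>_. k"] conjI ballI)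
  have eq: "(\<lambda>i::nat. wt k * norm (if i = 0 then c else 0)) = (\<lambda>i. if i = 0 then wt k * norm c else 0)"
    by auto
  have s: "((\<lambda>i::nat. if i = 0 then wt k * norm c else 0) has_sum (wt k * norm c)) UNIV"
    by (rule has_sum_finite_neutralI[of "{0}"]) auto
  show "(\<lambda>i::nat. wt k * norm (if i = 0 then c else 0)) summable_on UNIV"
    "(\<Sum>\<^sub>\<infinity>i::nat. wt k * norm (if i = 0 then c else 0)) \<le> wt k * norm c"
    unfolding eq using s by (auto simp: has_sum_iff)
  show "((\<lambda>i::nat. (if i = 0 then c else 0) * e k z) has_sum c * e k z) UNIV" for z
    by (rule has_sum_finite_neutralI[of "{0}"]) auto
qed

lemma wa_const: "wa (\<lambda>z. c) (norm c)"
  by (rule wa_cong[OF wa_mono[OF wa_char[of c 0]]]) (auto simp: wt_0 e_0)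

lemma wa_char_mult: assumes "wa F B" shows "wa (\<lambda>z. c * e k z * F z) (wt k * norm c * B)"
proof -
  obtain a l where s: "(\<lambda>i. wt (l i) * norm (a i)) summable_on (UNIV::nat set)"
    and b: "(\<Sum>\<^sub>\<infinity>i. wt (l i) * norm (a i)) \<le> B"
    and h: "\<And>z. z\<in>D \<Longrightarrow> ((\<lambda>i. a i * e (l i) z) has_sum F z) UNIV"
    using assms(1) unfolding wa_def by blast
  have s': "(\<lambda>i. wt k * norm c * (wt (l i) * norm (a i))) summable_on (UNIV::nat set)"
    by (rule summable_on_cmult_right[OF s])
  have le: "norm (wt (k + l i) * norm (c * a i)) \<le> wt k * norm c * (wt (l i) * norm (a i))" for i
  proof -
    have "wt (k + l i) * (norm c * norm (a i)) \<le> wt k * wt (l i) * (norm c * norm (a i))"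
      by (intro mult_right_mono wt_mult) auto
    then show ?thesis using wt_pos[of "k + l i"] by (simp add: abs_mult norm_mult mult_ac)
  qed
  note d = infsum_dominated[OF s' le]
  show ?thesis unfolding wa_def
  proof (intro exI[of _ "\<lambda>i. c * a i"] exI[of _ "\<lambda>i. k + l i"] conjI ballI)
    show "(\<lambda>i. wt (k + l i) * norm (c * a i)) summable_on UNIV" by (rule d(1))
    have "(\<Sum>\<^sub>\<infinity>i. wt (k + l i) * norm (c * a i)) \<le> (\<Sum>\<^sub>\<infinity>i. wt k * norm c * (wt (l i) * norm (a i)))"
      using d(2) by simp
    also have "\<dots> = wt k * norm c * (\<Sum>\<^sub>\<infinity>i. wt (l i) * norm (a i))"
      using s by (simp add: infsum_cmult_right)
    also have "\<dots> \<le> wt k * norm c * B"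
      by (intro mult_left_mono b mult_nonneg_nonneg) (use wt_pos[of k] in auto)
    finally show "(\<Sum>\<^sub>\<infinity>i. wt (k + l i) * norm (c * a i)) \<le> wt k * norm c * B" .
    fix z assume z: "z \<in> D"
    have "((\<lambda>i. c * e k z * (a i * e (l i) z)) has_sum c * e k z * F z) UNIV"
      by (rule has_sum_cmult_right[OF h[OF z]])
    then show "((\<lambda>i. c * a i * e (k + l i) z) has_sum c * e k z * F z) UNIV"
      by (simp add: e_add[OF z] mult_ac)
  qed
qed

lemma wa_cmult: "wa F B \<Longrightarrow> wa (\<lambda>z. c * F z) (norm c * B)"
  by (rule wa_cong[OF wa_mono[OF wa_char_mult[of F B c 0]]]) (auto simp: wt_0 e_0)

text \<open>Only the first factor is expanded: each of its characters shifts the frequencies of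
  \<open>G\<close> at the cost of a submultiplicative weight, and the shifted copies are summed by
  \<open>wa_family\<close>.\<close>

lemma wa_mult: assumes "wa F A" "wa G B" shows "wa (\<lambda>z. F z * G z) (A * B)"
proof -
  obtain a l where s: "(\<lambda>i. wt (l i) * norm (a i)) summable_on (UNIV::nat set)"
    and b: "(\<Sum>\<^sub>\<infinity>i. wt (l i) * norm (a i)) \<le> A"
    and h: "\<And>z. z\<in>D \<Longrightarrow> ((\<lambda>i. a i * e (l i) z) has_sum F z) UNIV"
    using assms(1) unfolding wa_def by blast
  have "wa (\<lambda>z. \<Sum>\<^sub>\<infinity>i. a i * e (l i) z * G z) (A * B)"
  proof (rule wa_family[OF wa_char_mult[OF assms(2)]])
    show "(\<lambda>i. wt (l i) * norm (a i) * B) summable_on UNIV" by (rule summable_on_cmult_left[OF s])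
    have "(\<Sum>\<^sub>\<infinity>i. wt (l i) * norm (a i) * B) = (\<Sum>\<^sub>\<infinity>i. wt (l i) * norm (a i)) * B"
      using s by (simp add: infsum_cmult_left)
    also have "\<dots> \<le> A * B" by (intro mult_right_mono b wa_ge_0[OF assms(2)])
    finally show "(\<Sum>\<^sub>\<infinity>i. wt (l i) * norm (a i) * B) \<le> A * B" .
  qed
  then show ?thesis
  proof (rule wa_cong)
    fix z assume "z \<in> D"
    from has_sum_cmult_left[OF h[OF this], of "G z"]
    show "(\<Sum>\<^sub>\<infinity>i. a i * e (l i) z * G z) = F z * G z" by (simp add: has_sum_iff)
  qed
qed

lemma wa_add: assumes "wa F A" "wa G B" shows "wa (\<lambda>z. F z + G z) (A + B)"
proof -
  have "wa (\<lambda>z. \<Sum>\<^sub>\<infinity>b. (if b then F else G) z) (A + B)"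
    by (rule wa_family[of "\<lambda>b::bool. if b then F else G" "\<lambda>b. if b then A else B"])
      (use assms in \<open>auto simp: UNIV_bool\<close>)
  then show ?thesis by (rule wa_cong) (simp add: UNIV_bool)
qed

lemma wa_uminus: "wa F B \<Longrightarrow> wa (\<lambda>z. - F z) B"
  using wa_cmult[of F B "-1"] by simp

lemma wa_diff: "wa F A \<Longrightarrow> wa G B \<Longrightarrow> wa (\<lambda>z. F z - G z) (A + B)"
  using wa_add[of F A "\<lambda>z. - G z" B] wa_uminus[of G B] by simp

lemma wa_sum: "finite S \<Longrightarrow> (\<And>i. i \<in> S \<Longrightarrow> wa (F i) (B i)) \<Longrightarrow> wa (\<lambda>z. \<Sum>i\<in>S. F i z) (\<Sum>i\<in>S. B i)"
  by (induction S rule: finite_induct) (auto intro: wa_add wa_zero)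

lemma wa_power: "wa F B \<Longrightarrow> wa (\<lambda>z. F z ^ n) (B ^ n)"
proof (induction n)
  case 0 then show ?case using wa_const[of 1] by simp
next
  case (Suc n) then show ?case using wa_mult[of F B "\<lambda>z. F z ^ n" "B ^ n"] by simp
qed

text \<open>Keeping finitely many terms of the expansion leaves a tail of small weighted norm, so
  finite sums of characters are dense in the norm of the algebra and not only uniformly.\<close>

lemma wa_approx:
  assumes "wa F B" "\<epsilon> > 0"
  shows "\<exists>S (a::nat \<Rightarrow> complex) k. finite S \<and> wa (\<lambda>z. F z - (\<Sum>i\<in>S. a i * e (k i) z)) \<epsilon>"
proof -
  obtain a l where s: "(\<lambda>i. wt (l i) * norm (a i)) summable_on (UNIV::nat set)"
    and h: "\<And>z. z\<in>D \<Longrightarrow> ((\<lambda>i. a i * e (l i) z) has_sum F z) UNIV"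
    using assms(1) unfolding wa_def by blast
  let ?g = "\<lambda>i. wt (l i) * norm (a i)"
  obtain S where S: "finite S" "dist (sum ?g S) (infsum ?g UNIV) \<le> \<epsilon>"
    using infsum_finite_approximation[OF s assms(2)] by auto
  have "wa (\<lambda>z. \<Sum>\<^sub>\<infinity>i. (if i \<in> S then 0 else a i) * e (l i) z) \<epsilon>"
  proof (rule wa_family[OF wa_char])
    have *: "((\<lambda>i. wt (l i) * norm (if i \<in> S then 0 else a i)) has_sum infsum ?g (-S)) UNIV"
    proof -
      have "(?g has_sum infsum ?g (-S)) (-S)"
        using summable_on_subset[OF s] by (intro has_sum_infsum) auto
      then show ?thesis by (rule has_sum_cong_neutral[THEN iffD1, rotated -1]) auto
    qed
    then show "(\<lambda>i. wt (l i) * norm (if i \<in> S then 0 else a i)) summable_on UNIV"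
      by (simp add: has_sum_iff)
    have "infsum ?g (UNIV - S) = infsum ?g UNIV - infsum ?g S"
      by (rule infsum_Diff) (use s S in auto)
    then have "infsum ?g (-S) \<le> \<epsilon>" using S by (auto simp: dist_real_def Compl_eq_Diff_UNIV)
    then show "(\<Sum>\<^sub>\<infinity>i. wt (l i) * norm (if i \<in> S then 0 else a i)) \<le> \<epsilon>"
      using * by (simp add: has_sum_iff)
  qed
  then have "wa (\<lambda>z. F z - (\<Sum>i\<in>S. a i * e (l i) z)) \<epsilon>"
  proof (rule wa_cong)
    fix z assume "z \<in> D"
    let ?f = "\<lambda>i. a i * e (l i) z"
    have f: "(?f has_sum F z) UNIV" using h \<open>z \<in> D\<close> by blast
    have "infsum ?f (UNIV - S) = infsum ?f UNIV - infsum ?f S"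
      by (rule infsum_Diff) (use f S in \<open>auto simp: has_sum_iff\<close>)
    moreover have "(\<Sum>\<^sub>\<infinity>i. (if i \<in> S then 0 else a i) * e (l i) z) = infsum ?f (UNIV - S)"
      by (rule infsum_cong_neutral) auto
    ultimately show "(\<Sum>\<^sub>\<infinity>i. (if i \<in> S then 0 else a i) * e (l i) z) = F z - (\<Sum>i\<in>S. a i * e (l i) z)"
      using f S by (simp add: has_sum_iff)
  qed
  with S(1) show ?thesis by blast
qed

end

section \<open>The algebra of power series on the disc and the algebra of Laurent series on the
  circle\<close>

definition pw_wt :: "nat \<Rightarrow> nat \<Rightarrow> real" where "pw_wt \<sigma> k = (1 + real k) ^ \<sigma>"

definition cw_wt :: "nat \<Rightarrow> int \<Rightarrow> real" where "cw_wt \<sigma> k = (1 + real_of_int \<bar>k\<bar>) ^ \<sigma>"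

text \<open>\<open>pw\<close> contains the Jost functions, analytic in the disc, and
  \<open>cw\<close> the scattering coefficients, controlled on the circle only. The weight \<sigma>
  = 1 pays for one division by a zero on the circle; \<sigma> = 0 is what the dispersive bound
  consumes.\<close>

interpretation pw: wiener "\<lambda>k z. z ^ k" "pw_wt \<sigma>" "cball 0 1" for \<sigma> :: nat
proof
  fix j k :: nat
  have "(1 + real (j + k)) \<le> (1 + real j) * (1 + real k)" by (simp add: algebra_simps)
  then show "pw_wt \<sigma> (j + k) \<le> pw_wt \<sigma> j * pw_wt \<sigma> k"
    unfolding pw_wt_def power_mult_distrib[symmetric] by (intro power_mono) auto
  show "1 \<le> pw_wt \<sigma> k" unfolding pw_wt_def by (intro one_le_power) auto
qed (auto simp: pw_wt_def power_add norm_power power_le_one intro!: continuous_intros)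

interpretation cw: wiener "\<lambda>k z. z powi k" "cw_wt \<sigma>" "sphere 0 1" for \<sigma> :: nat
proof
  fix j k :: int and z :: complex
  have "(1 + real_of_int \<bar>j + k\<bar>) \<le> (1 + real_of_int \<bar>j\<bar>) * (1 + real_of_int \<bar>k\<bar>)"
  proof -
    have "\<bar>real_of_int j + real_of_int k\<bar> \<le> \<bar>real_of_int j\<bar> + \<bar>real_of_int k\<bar>" by (rule abs_triangle_ineq)
    moreover have "0 \<le> \<bar>real_of_int j\<bar> * \<bar>real_of_int k\<bar>" by simp
    ultimately show ?thesis
      unfolding of_int_add of_int_abs distrib_left distrib_right mult_1 mult_1_right by linarith
  qed
  then show "cw_wt \<sigma> (j + k) \<le> cw_wt \<sigma> j * cw_wt \<sigma> k"
    unfolding cw_wt_def power_mult_distrib[symmetric] by (intro power_mono) auto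
  show "1 \<le> cw_wt \<sigma> k" unfolding cw_wt_def by (intro one_le_power) auto
  assume "z \<in> sphere 0 1"
  then have z: "norm z = 1" "z \<noteq> 0" by auto
  show "z powi (j + k) = z powi j * z powi k" using z by (simp add: power_int_add)
  show "norm (z powi k) \<le> 1" using z by (simp add: norm_power_int)
qed (auto simp: cw_wt_def intro!: continuous_intros)

section \<open>Means over the circle and oscillatory integrals\<close>

definition cmean :: "(complex \<Rightarrow> complex) \<Rightarrow> complex" where
  "cmean F = integral {-pi..pi} (\<lambda>\<theta>. F (cis \<theta>)) / (2 * complex_of_real pi)"

lemma continuous_cis: "continuous_on S F \<Longrightarrow> sphere 0 1 \<subseteq> S \<Longrightarrow> continuous_on A (\<lambda>\<theta>. F (cis \<theta>))"
  by (rule continuous_on_compose2[of S F _ cis]) (auto simp: cis_conv_exp intro!: continuous_intros)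

lemma cmean_cong: "(\<And>z. norm z = 1 \<Longrightarrow> F z = G z) \<Longrightarrow> cmean F = cmean G"
  unfolding cmean_def by (intro arg_cong2[where f = "(/)"] integral_cong) auto

lemma integrable_cis: "continuous_on (sphere 0 1) (F :: complex \<Rightarrow> complex) \<Longrightarrow> (\<lambda>\<theta>. F (cis \<theta>)) integrable_on {a..b}"
  by (rule Henstock_Kurzweil_Integration.integrable_continuous_interval, rule continuous_cis[where F = F]) auto

lemma norm_cmean_le:
  assumes "continuous_on (sphere 0 1) F" "\<And>z. norm z = 1 \<Longrightarrow> norm (F z) \<le> B"
  shows "norm (cmean F) \<le> B"
proof -
  have "norm (integral {-pi..pi} (\<lambda>\<theta>. F (cis \<theta>))) \<le> B * (pi - (-pi))"
    by (intro integral_bound continuous_cis[OF assms(1)] assms(2)) auto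
  then show ?thesis by (simp add: cmean_def norm_divide norm_mult field_simps)
qed

lemma cmean_cmult: "cmean (\<lambda>z. c * F z) = c * cmean F"
  by (simp add: cmean_def)

lemma cmean_add:
  assumes "continuous_on (sphere 0 1) F" "continuous_on (sphere 0 1) G"
  shows "cmean (\<lambda>z. F z + G z) = cmean F + cmean G"
  unfolding cmean_def
  by (subst integral_add) (use assms integrable_cis in \<open>auto simp: add_divide_distrib\<close>)

lemma cmean_sum:
  assumes "finite S" "\<And>i. i \<in> S \<Longrightarrow> continuous_on (sphere 0 1) (F i)"
  shows "cmean (\<lambda>z. \<Sum>i\<in>S. F i z) = (\<Sum>i\<in>S. cmean (F i))"
  unfolding cmean_def
  by (subst integral_sum) (use assms integrable_cis in \<open>auto simp: sum_divide_distrib\<close>)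

lemma cmean_has_sum:
  fixes F :: "'i \<Rightarrow> complex \<Rightarrow> complex"
  assumes c: "\<And>i. continuous_on (sphere 0 1) (F i)"
    and b: "\<And>i z. norm z = 1 \<Longrightarrow> norm (F i z) \<le> B i" and s: "B summable_on UNIV"
    and h: "\<And>z. norm z = 1 \<Longrightarrow> ((\<lambda>i. F i z) has_sum G z) UNIV"
  shows "((\<lambda>i. cmean (F i)) has_sum cmean G) UNIV" "continuous_on (sphere 0 1) G"
proof -
  have u: "uniform_limit (sphere 0 1) (\<lambda>X z. \<Sum>i\<in>X. F i z) G (finite_subsets_at_top UNIV)"
    by (rule Weierstrass_m_test_general'[OF _ _ s]) (use b h in auto)
  then show "continuous_on (sphere 0 1) G"
    by (rule uniform_limit_theorem[rotated]) (auto intro!: always_eventually continuous_intros c)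
  have "uniform_limit {-pi..pi} (\<lambda>X \<theta>. \<Sum>i\<in>X. F i (cis \<theta>)) (\<lambda>\<theta>. G (cis \<theta>)) (finite_subsets_at_top UNIV)"
    by (rule uniform_limit_compose'[OF u]) auto
  then obtain I J where IJ: "\<And>X. ((\<lambda>\<theta>. \<Sum>i\<in>X. F i (cis \<theta>)) has_integral I X) {-pi..pi}"
    "((\<lambda>\<theta>. G (cis \<theta>)) has_integral J) {-pi..pi}" "(I \<longlongrightarrow> J) (finite_subsets_at_top UNIV)"
    by (rule uniform_limit_integral) (auto intro!: continuous_intros continuous_cis[OF c])
  have I: "I X / (2 * complex_of_real pi) = (\<Sum>i\<in>X. cmean (F i))" if "finite X" for X
    using cmean_sum[OF that, of F, OF c] integral_unique[OF IJ(1)[of X]] by (simp add: cmean_def)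
  have J: "cmean G = J / (2 * complex_of_real pi)"
    using integral_unique[OF IJ(2)] by (simp add: cmean_def)
  have "((\<lambda>X. I X / (2 * complex_of_real pi)) \<longlongrightarrow> cmean G) (finite_subsets_at_top UNIV)"
    unfolding J by (intro tendsto_intros IJ) auto
  then show "((\<lambda>i. cmean (F i)) has_sum cmean G) UNIV"
    unfolding has_sum_def
    by (rule Lim_transform_eventually) (auto intro!: eventually_finite_subsets_at_top_weakI I)
qed

text \<open>On the circle z -> 1/z is the reflection \<theta> -> -\<theta>. This symmetry kills both
  the pairing with eigenfunctions and the diagonal terms produced by H.\<close>

lemma cmean_odd:
  assumes "\<And>z. norm z = 1 \<Longrightarrow> F (inverse z) = - F z"
  shows "cmean F = 0"
proof -
  have "integral {-pi..pi} (\<lambda>\<theta>. F (cis \<theta>)) = integral {-pi.. - (-pi)} (\<lambda>\<theta>. F (cis (-\<theta>)))"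
    by (rule Henstock_Kurzweil_Integration.integral_reflect_real[symmetric])
  also have "\<dots> = integral {-pi..pi} (\<lambda>\<theta>. - F (cis \<theta>))"
    unfolding minus_minus by (rule integral_cong) (auto simp: assms simp flip: cis_inverse)
  finally show ?thesis by (simp add: cmean_def)
qed

section \<open>Van der Corput bounds and Bessel integrals\<close>

lemma cis_has_vector_derivative:
  assumes "(\<phi> has_real_derivative d) (at x within S)"
  shows "((\<lambda>x. cis (\<phi> x)) has_vector_derivative (\<i> * complex_of_real d * cis (\<phi> x))) (at x within S)"
proof -
  have 1: "((\<lambda>x. complex_of_real (\<phi> x)) has_vector_derivative complex_of_real d) (at x within S)"
    using assms by (intro has_vector_derivative_of_real) 
        (auto simp: has_real_derivative_iff_has_vector_derivative)
  have 2: "((\<lambda>w. exp (\<i> * w)) has_field_derivative \<i> * exp (\<i> * complex_of_real (\<phi> x)))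
      (at (complex_of_real (\<phi> x)) within (\<lambda>x. complex_of_real (\<phi> x)) ` S)"
    by (auto intro!: derivative_eq_intros)
  from field_vector_diff_chain_within[OF 1 2] show ?thesis
    by (simp add: o_def cis_conv_exp mult_ac)
qed

lemma cis_powi: "cis a powi k = cis (of_int k * a)"
  by (cases k rule: int_cases2) (auto simp: Complex.DeMoivre power_int_minus)

lemma cmean_powi: "cmean (\<lambda>z. z powi k) = (if k = 0 then 1 else 0)"
proof (cases "k = 0")
  case True then show ?thesis by (simp add: cmean_def scaleR_conv_of_real)
next
  case False
  have "((\<lambda>\<theta>. \<i> * complex_of_real (of_int k) * cis (of_int k * \<theta>)) has_integral
     (cis (of_int k * pi) - cis (of_int k * (-pi)))) {-pi..pi}"
    by (intro fundamental_theorem_of_calculus cis_has_vector_derivative)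
      (auto intro!: derivative_eq_intros)
  moreover have "cis (of_int k * pi) = cis (of_int k * (-pi))"
    using sin_npi_int[of k] by (simp add: complex_eq_iff mult.commute)
  ultimately have "integral {-pi..pi} (\<lambda>\<theta>. \<i> * complex_of_real (of_int k) * cis (of_int k * \<theta>)) = 0"
    by (metis integral_unique diff_self)
  then have "integral {-pi..pi} (\<lambda>\<theta>. cis (of_int k * \<theta>)) = 0"
    using False unfolding integral_mult_right by simp
  then show ?thesis using False by (simp add: cmean_def cis_powi)
qed

text \<open>Integrating \<open>cis \<phi>\<close> by parts against \<open>\<phi>' / (\<phi>'\<^sup>2 + \<mu>)\<close> instead of \<open>1 / \<phi>'\<close> avoids excising
  a neighbourhood of the stationary point.\<close>
lemma van_der_Corput_pos:
  fixes \<phi> \<phi>' \<phi>'' :: "real \<Rightarrow> real"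
  assumes ab: "a \<le> b" and s: "s > 0"
    and d1: "\<And>x. (\<phi> has_real_derivative \<phi>' x) (at x)"
    and d2: "\<And>x. (\<phi>' has_real_derivative \<phi>'' x) (at x)"
    and c: "continuous_on UNIV \<phi>''" and ge: "\<And>x. x \<in> {a..b} \<Longrightarrow> s\<^sup>2 \<le> \<phi>'' x"
  shows "norm (integral {a..b} (\<lambda>x. cis (\<phi> x))) \<le> 8 / s"
proof -
  define d where "d x = (\<phi>' x)\<^sup>2 + s\<^sup>2" for x
  have d0: "d x > 0" for x using s by (simp add: d_def add_nonneg_pos)
  have c\<phi>': "continuous_on A \<phi>'" for A
    by (rule DERIV_continuous_on[where D = \<phi>'']) (rule has_field_derivative_at_within[OF d2])
  have c\<phi>: "continuous_on A \<phi>" for A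
    by (rule DERIV_continuous_on[where D = \<phi>']) (rule has_field_derivative_at_within[OF d1])
  have c\<phi>'': "continuous_on A \<phi>''" for A
    by (rule continuous_on_subset[OF c]) simp
  define r where "r x = \<phi>' x / d x" for x
  define r' where "r' x = \<phi>'' x * (s\<^sup>2 - (\<phi>' x)\<^sup>2) / (d x)\<^sup>2" for x
  have r: "(r has_real_derivative r' x) (at x)" for x
  proof -
    have "(d has_real_derivative 2 * \<phi>' x * \<phi>'' x) (at x)"
      unfolding d_def by (auto intro!: derivative_eq_intros d2)
    from DERIV_divide[OF d2 this] d0[of x]
    have "(r has_real_derivative (\<phi>'' x * d x - \<phi>' x * (2 * \<phi>' x * \<phi>'' x)) / (d x * d x)) (at x)"
      unfolding r_def by simp
    moreover have "\<phi>'' x * d x - \<phi>' x * (2 * \<phi>' x * \<phi>'' x) = \<phi>'' x * (s\<^sup>2 - (\<phi>' x)\<^sup>2)"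
      by (simp add: d_def power2_eq_square algebra_simps)
    ultimately show ?thesis by (simp add: r'_def power2_eq_square)
  qed
  define \<Psi> where "\<Psi> x = - \<i> * (cis (\<phi> x) * complex_of_real (r x))" for x
  have \<Psi>: "(\<Psi> has_vector_derivative (complex_of_real (\<phi>' x * r x) - \<i> * complex_of_real (r' x)) * cis (\<phi> x)) (at x within A)" for x A
  proof -
    have "((\<lambda>x. complex_of_real (r x)) has_vector_derivative complex_of_real (r' x)) (at x within A)"
      using r has_real_derivative_iff_has_vector_derivative has_field_derivative_at_within 
      by (intro has_vector_derivative_of_real) blast
    from has_vector_derivative_mult[OF cis_has_vector_derivative[OF has_field_derivative_at_within[OF d1]] this]
    have "((\<lambda>x. - \<i> * (cis (\<phi> x) * complex_of_real (r x))) has_vector_derivative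
      - \<i> * (cis (\<phi> x) * complex_of_real (r' x) + \<i> * complex_of_real (\<phi>' x) * cis (\<phi> x) * complex_of_real (r x))) (at x within A)"
      by (rule has_vector_derivative_mult_right)
    then show ?thesis unfolding \<Psi>_def
      by (rule has_vector_derivative_eq_rhs) (simp add: algebra_simps)
  qed
  \<comment> \<open>\<open>R\<close> is what the integration by parts leaves over: the deficit
    \<open>s\<^sup>2 / d x\<close> of \<open>\<phi>' x * r x\<close> from 1, and the derivative of
    \<open>r\<close>.\<close>
  define R where "R x = (complex_of_real (s\<^sup>2 / d x) + \<i> * complex_of_real (r' x)) * cis (\<phi> x)" for x
  have cr: "continuous_on {a..b} r" "continuous_on {a..b} r'" "continuous_on {a..b} d"
    unfolding r_def r'_def d_def
    by (intro continuous_intros c\<phi>' c\<phi>'' ballI; use d0 in \<open>auto simp: d_def less_imp_neq[symmetric]\<close>)+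
  have ccis: "continuous_on {a..b} (\<lambda>x. cis (\<phi> x))"
    unfolding cis_conv_exp by (intro continuous_intros c\<phi>)
  have Rint: "R integrable_on {a..b}"
    unfolding R_def
    by (intro Henstock_Kurzweil_Integration.integrable_continuous_interval continuous_intros cr ccis) (use d0 in \<open>auto simp: less_imp_neq[symmetric]\<close>)
  have "((\<lambda>x. (complex_of_real (\<phi>' x * r x) - \<i> * complex_of_real (r' x)) * cis (\<phi> x)) has_integral (\<Psi> b - \<Psi> a)) {a..b}"
    by (intro fundamental_theorem_of_calculus ab \<Psi>)
  from has_integral_add[OF this integrable_integral[OF Rint]]
  have "((\<lambda>x. cis (\<phi> x)) has_integral (\<Psi> b - \<Psi> a) + integral {a..b} R) {a..b}"
  proof (rule has_integral_eq[rotated])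
    fix x
    have "\<phi>' x * r x + s\<^sup>2 / d x = ((\<phi>' x)\<^sup>2 + s\<^sup>2) / d x"
      by (simp add: r_def power2_eq_square add_divide_distrib)
    also have "\<dots> = 1" using d0[of x] unfolding d_def by (metis divide_self less_irrefl)
    finally have "\<phi>' x * r x + s\<^sup>2 / d x = 1" .
    then have "complex_of_real (\<phi>' x * r x) + complex_of_real (s\<^sup>2 / d x) = 1"
      unfolding of_real_add[symmetric] by simp
    then show "(complex_of_real (\<phi>' x * r x) - \<i> * complex_of_real (r' x)) * cis (\<phi> x) + R x = cis (\<phi> x)"
      unfolding R_def distrib_right[symmetric] by (simp add: algebra_simps)
  qed
  then have eq: "integral {a..b} (\<lambda>x. cis (\<phi> x)) = (\<Psi> b - \<Psi> a) + integral {a..b} R"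
    by (rule integral_unique)
  have \<Psi>b: "norm (\<Psi> x) \<le> 1 / (2 * s)" for x
  proof -
    have "0 \<le> (\<bar>\<phi>' x\<bar> - s)\<^sup>2" by simp
    then have "\<bar>\<phi>' x\<bar> * (2 * s) \<le> d x" by (simp add: d_def power2_eq_square algebra_simps)
    then have "\<bar>\<phi>' x\<bar> / d x \<le> 1 / (2 * s)" using d0[of x] s by (simp add: field_simps)
    then show ?thesis using d0[of x] by (simp add: \<Psi>_def norm_mult norm_divide r_def)
  qed
  \<comment> \<open>This majorant of \<open>R\<close> is the exact derivative of 2/s
    arctan(\<phi>'/s), so its integral is bounded independently of the length of the
    interval.\<close>
  let ?g = "\<lambda>x. 2 * (\<phi>'' x / d x)"
  have gi: "(?g has_integral (2 / s * arctan (\<phi>' b / s) - 2 / s * arctan (\<phi>' a / s))) {a..b}"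
  proof (rule fundamental_theorem_of_calculus[OF ab])
    fix x
    have "((\<lambda>x. 2 / s * arctan (\<phi>' x / s)) has_real_derivative ?g x) (at x)"
    proof -
      have "((\<lambda>x. \<phi>' x / s) has_real_derivative \<phi>'' x / s) (at x)"
        using d2 by (rule DERIV_cdivide)
      from DERIV_cmult[OF DERIV_chain2[OF DERIV_arctan this], of "2 / s"]
      have "((\<lambda>x. 2 / s * arctan (\<phi>' x / s)) has_real_derivative
        2 / s * (inverse (1 + (\<phi>' x / s)\<^sup>2) * (\<phi>'' x / s))) (at x)" .
      moreover have "inverse (1 + (\<phi>' x / s)\<^sup>2) = s\<^sup>2 / d x"
        using s d0[of x] by (simp add: d_def field_simps)
      ultimately show ?thesis using s by (simp add: power2_eq_square)
    qed
    then show "((\<lambda>x. 2 / s * arctan (\<phi>' x / s)) has_vector_derivative ?g x) (at x within {a..b})"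
      using has_real_derivative_iff_has_vector_derivative has_field_derivative_at_within by blast
  qed
  have "norm (integral {a..b} R) \<le> integral {a..b} ?g"
  proof (rule Henstock_Kurzweil_Integration.integral_norm_bound_integral[OF Rint])
    show "?g integrable_on {a..b}" using gi by blast
    fix x assume x: "x \<in> {a..b}"
    have p: "0 \<le> \<phi>'' x" using ge[OF x] by (meson order_trans zero_le_power2)
    have "\<bar>r' x\<bar> = \<phi>'' x / d x * (\<bar>s\<^sup>2 - (\<phi>' x)\<^sup>2\<bar> / d x)"
      using p d0[of x] by (simp add: r'_def abs_mult power2_eq_square)
    also have "\<dots> \<le> \<phi>'' x / d x * 1"
      by (rule mult_left_mono) (use p d0[of x] s in \<open>auto simp: d_def field_simps abs_le_iff\<close>)
    finally have 1: "\<bar>r' x\<bar> \<le> \<phi>'' x / d x" by simp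
    have 2: "\<bar>s\<^sup>2 / d x\<bar> \<le> \<phi>'' x / d x" using ge[OF x] d0[of x] by (simp add: divide_right_mono)
    have "norm (R x) \<le> norm (complex_of_real (s\<^sup>2 / d x)) + norm (\<i> * complex_of_real (r' x))"
      unfolding R_def norm_mult[of _ "cis (\<phi> x)"] norm_cis mult_1_right by (rule norm_triangle_ineq)
    also have "\<dots> \<le> ?g x" using 1 2 by (simp add: norm_mult del: of_real_divide)
    finally show "norm (R x) \<le> ?g x" .
  qed
  also have "\<dots> = 2 / s * (arctan (\<phi>' b / s) - arctan (\<phi>' a / s))"
    using gi by (simp add: integral_unique right_diff_distrib)
  also have "\<dots> \<le> 2 / s * pi"
    by (rule mult_left_mono) (use arctan_bounded[of "\<phi>' b / s"] arctan_bounded[of "\<phi>' a / s"] s in auto)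
  \<comment> \<open>Bounding pi by 7/2 leaves 1/s for the two boundary terms, each at most 1/(2s),
    so that the total is 8/s.\<close>
  also have "\<dots> \<le> 2 / s * (7 / 2)"
    by (rule mult_left_mono) (use pi_less_4 pi_approx s in auto)
  finally have "norm (integral {a..b} R) \<le> 7 / s" by simp
  moreover have "norm (\<Psi> b - \<Psi> a) \<le> 1 / s"
    using norm_triangle_ineq4[of "\<Psi> b" "\<Psi> a"] \<Psi>b[of a] \<Psi>b[of b] s by simp
  ultimately show ?thesis
    unfolding eq using norm_triangle_ineq[of "\<Psi> b - \<Psi> a" "integral {a..b} R"]
    by (simp add: add_divide_distrib[symmetric])
qed

lemma van_der_Corput_neg:
  fixes \<phi> \<phi>' \<phi>'' :: "real \<Rightarrow> real"
  assumes ab: "a \<le> b" and s: "s > 0"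
    and d1: "\<And>x. (\<phi> has_real_derivative \<phi>' x) (at x)"
    and d2: "\<And>x. (\<phi>' has_real_derivative \<phi>'' x) (at x)"
    and c: "continuous_on UNIV \<phi>''" and ge: "\<And>x. x \<in> {a..b} \<Longrightarrow> s\<^sup>2 \<le> - \<phi>'' x"
  shows "norm (integral {a..b} (\<lambda>x. cis (\<phi> x))) \<le> 8 / s"
proof -
  have "norm (integral {a..b} (\<lambda>x. cis (- \<phi> x))) \<le> 8 / s"
    by (rule van_der_Corput_pos[OF ab s, of "\<lambda>x. - \<phi> x" "\<lambda>x. - \<phi>' x" "\<lambda>x. - \<phi>'' x"])
      (auto intro!: derivative_intros d1 d2 continuous_intros c ge)
  also have "integral {a..b} (\<lambda>x. cis (- \<phi> x)) = cnj (integral {a..b} (\<lambda>x. cis (\<phi> x)))"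
    by (simp add: integral_cnj cis_cnj)
  finally show ?thesis by simp
qed

lemma sin_ge_half: assumes "0 \<le> x" "x \<le> 1" shows "x / 2 \<le> sin (x::real)"
proof (cases "x = 0")
  case False
  then obtain z where z: "0 < z" "z < x" "sin x - sin 0 = (x - 0) * cos z"
    using MVT2[of 0 x sin cos] assms by (auto intro: DERIV_sin)
  have "cos (pi / 3) \<le> cos z"
    by (rule cos_monotone_0_pi_le) (use z assms pi_gt3 in auto)
  then have "x * (1/2) \<le> x * cos z" using assms by (intro mult_left_mono) (auto simp: cos_60)
  then show ?thesis using z by simp
qed simp

text \<open>The second derivative 2t cos x of the phase does not see \<open>k\<close>, which makes
  the bound uniform in the frequency. It degenerates at pi/2 and -pi/2; intervals of half-width
  \<delta> around these points are estimated trivially, by 2\<delta> each. On the other three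
  intervals its modulus is at least t\<delta> = 1/\<delta>^2, so van der Corput gives 8\<delta>
  each: 28\<delta> in all.\<close>

lemma Bessel_integral_bound:
  fixes t \<delta> :: real
  assumes t: "t * \<delta> ^ 3 = 1" and \<delta>: "0 < \<delta>" "\<delta> \<le> 1"
  shows "norm (integral {-pi..pi} (\<lambda>x. cis (- 2 * t * cos x + real_of_int k * x))) \<le> 28 * \<delta>"
proof -
  define \<phi> where "\<phi> x = - 2 * t * cos x + real_of_int k * x" for x
  have t0: "t > 0" using t \<delta> by (metis zero_less_mult_pos2 zero_less_one zero_less_power)
  have d1: "(\<phi> has_real_derivative 2 * t * sin x + real_of_int k) (at x)" for x
    unfolding \<phi>_def by (auto intro!: derivative_eq_intros)
  have d2: "((\<lambda>x. 2 * t * sin x + real_of_int k) has_real_derivative 2 * t * cos x) (at x)" for x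
    by (auto intro!: derivative_eq_intros)
  have c: "continuous_on UNIV (\<lambda>x. 2 * t * cos x)" by (intro continuous_intros)
  have ccis: "continuous_on A (\<lambda>x. cis (\<phi> x))" for A
    unfolding cis_conv_exp \<phi>_def by (intro continuous_intros)
  have int: "(\<lambda>x. cis (\<phi> x)) integrable_on {a..b}" for a b
    by (intro Henstock_Kurzweil_Integration.integrable_continuous_interval ccis)
  have s: "(1/\<delta>)\<^sup>2 = t * \<delta>"
    using t \<delta> by (simp add: field_simps power2_eq_square power3_eq_cube)
  have key: "(1/\<delta>)\<^sup>2 \<le> 2 * t * y" if "sin \<delta> \<le> y" for y
  proof -
    have "t * \<delta> \<le> 2 * t * y" using sin_ge_half[of \<delta>] \<delta> that t0 by simp
    then show ?thesis using s by simp
  qed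
  have p: "\<delta> < pi / 2" using \<delta> pi_gt3 by simp
  let ?I = "\<lambda>a b. integral {a..b} (\<lambda>x. cis (\<phi> x))"
  have 1: "norm (?I (-pi) (-pi/2-\<delta>)) \<le> 8 * \<delta>"
  proof -
    have "norm (?I (-pi) (-pi/2-\<delta>)) \<le> 8 / (1/\<delta>)"
    proof (rule van_der_Corput_neg[OF _ _ d1 d2 c])
      fix x assume "x \<in> {-pi..-pi/2-\<delta>}"
      then have "cos (pi/2 - \<delta>) \<le> cos (x + pi)"
        by (intro cos_monotone_0_pi_le) (use \<delta> in auto)
      then have "sin \<delta> \<le> - cos x" by (simp add: sin_cos_eq)
      from key[OF this] show "(1/\<delta>)\<^sup>2 \<le> - (2 * t * cos x)" by simp
    qed (use \<delta> p in auto)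
    then show ?thesis by simp
  qed
  have 3: "norm (?I (-pi/2+\<delta>) (pi/2-\<delta>)) \<le> 8 * \<delta>"
  proof -
    have "norm (?I (-pi/2+\<delta>) (pi/2-\<delta>)) \<le> 8 / (1/\<delta>)"
    proof (rule van_der_Corput_pos[OF _ _ d1 d2 c])
      fix x assume "x \<in> {-pi/2+\<delta>..pi/2-\<delta>}"
      then have "cos (pi/2 - \<delta>) \<le> cos \<bar>x\<bar>"
        by (intro cos_monotone_0_pi_le) (use \<delta> pi_gt3 in auto)
      then have "sin \<delta> \<le> cos x" by (simp add: sin_cos_eq)
      from key[OF this] show "(1/\<delta>)\<^sup>2 \<le> 2 * t * cos x" .
    qed (use \<delta> p in auto)
    then show ?thesis by simp
  qed
  have 5: "norm (?I (pi/2+\<delta>) pi) \<le> 8 * \<delta>"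
  proof -
    have "norm (?I (pi/2+\<delta>) pi) \<le> 8 / (1/\<delta>)"
    proof (rule van_der_Corput_neg[OF _ _ d1 d2 c])
      fix x assume "x \<in> {pi/2+\<delta>..pi}"
      then have "cos (pi/2 - \<delta>) \<le> cos (pi - x)"
        by (intro cos_monotone_0_pi_le) (use \<delta> in auto)
      then have "sin \<delta> \<le> - cos x" by (simp add: sin_cos_eq)
      from key[OF this] show "(1/\<delta>)\<^sup>2 \<le> - (2 * t * cos x)" by simp
    qed (use \<delta> p in auto)
    then show ?thesis by simp
  qed
  have 2: "norm (?I (-pi/2-\<delta>) (-pi/2+\<delta>)) \<le> 2 * \<delta>"
    using integral_bound[of "-pi/2-\<delta>" "-pi/2+\<delta>" "\<lambda>x. cis (\<phi> x)" 1] ccis \<delta> by simp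
  have 4: "norm (?I (pi/2-\<delta>) (pi/2+\<delta>)) \<le> 2 * \<delta>"
    using integral_bound[of "pi/2-\<delta>" "pi/2+\<delta>" "\<lambda>x. cis (\<phi> x)" 1] ccis \<delta> by simp
  have "?I (-pi) pi = ?I (-pi) (-pi/2-\<delta>) + ?I (-pi/2-\<delta>) pi"
    "?I (-pi/2-\<delta>) pi = ?I (-pi/2-\<delta>) (-pi/2+\<delta>) + ?I (-pi/2+\<delta>) pi"
    "?I (-pi/2+\<delta>) pi = ?I (-pi/2+\<delta>) (pi/2-\<delta>) + ?I (pi/2-\<delta>) pi"
    "?I (pi/2-\<delta>) pi = ?I (pi/2-\<delta>) (pi/2+\<delta>) + ?I (pi/2+\<delta>) pi"
    by (rule Henstock_Kurzweil_Integration.integral_combine[symmetric, OF _ _ int]; use \<delta> p in simp)+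
  then have "norm (?I (-pi) pi) \<le> norm (?I (-pi) (-pi/2-\<delta>)) + (norm (?I (-pi/2-\<delta>) (-pi/2+\<delta>)) +
    (norm (?I (-pi/2+\<delta>) (pi/2-\<delta>)) + (norm (?I (pi/2-\<delta>) (pi/2+\<delta>)) + norm (?I (pi/2+\<delta>) pi))))"
    by (simp only:) (intro norm_triangle_mono order_refl)
  then have "norm (?I (-pi) pi) \<le> 28 * \<delta>" using 1 2 3 4 5 by linarith
  then show ?thesis by (simp add: \<phi>_def)
qed

definition osc :: "real \<Rightarrow> complex \<Rightarrow> complex" where
  "osc t z = exp (\<i> * complex_of_real t * (2 - z - inverse z))"

lemma osc_cis: "osc t (cis x) = cis (2 * t) * cis (- 2 * t * cos x)"
proof -
  have "cis x + inverse (cis x) = complex_of_real (2 * cos x)"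
    by (simp add: complex_eq_iff)
  then have "2 - cis x - inverse (cis x) = complex_of_real (2 - 2 * cos x)"
    by (simp add: algebra_simps)
  then have "osc t (cis x) = exp (\<i> * complex_of_real (t * (2 - 2 * cos x)))"
    by (simp only: osc_def of_real_mult mult.assoc)
  also have "\<dots> = cis (t * (2 - 2 * cos x))" by (simp only: cis_conv_exp)
  finally have "osc t (cis x) = cis (t * (2 - 2 * cos x))" .
  then show ?thesis by (simp add: cis_mult algebra_simps)
qed

lemma norm_osc: "norm z = 1 \<Longrightarrow> norm (osc t z) = 1"
  by (metis osc_cis complex_norm_eq_1_exp cis_conv_exp norm_cis norm_mult mult_1)

lemma continuous_osc: "continuous_on (sphere 0 1) (osc t)"
  unfolding osc_def by (intro continuous_intros) auto

text \<open>For |t| \<ge> 1 the Bessel bound, divided by 2 pi > 4, gives 7 |t|^(-1/3), and <t> \<le>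
  2|t| costs at most a factor 2; for smaller t the trivial bound 1 is at most twice <t>^(-1/3). The
  constant 16 covers both.\<close>

lemma osc_cmean_char:
  "norm (cmean (\<lambda>z. osc t z * z powi k)) \<le> 16 * jbr t powr (-1/3)"
proof -
  have j1: "1 \<le> jbr t" by (simp add: jbr_def)
  have eq: "cmean (\<lambda>z. osc t z * z powi k) = cis (2 * t) *
      integral {-pi..pi} (\<lambda>x. cis (- 2 * t * cos x + real_of_int k * x)) / (2 * complex_of_real pi)"
  proof -
    have "osc t (cis x) * cis x powi k = cis (2 * t) * cis (- 2 * t * cos x + real_of_int k * x)" for x
      unfolding osc_cis cis_powi by (simp add: cis_mult algebra_simps)
    then show ?thesis unfolding cmean_def by simp
  qed
  have large: "norm (integral {-pi..pi} (\<lambda>x. cis (- 2 * s * cos x + real_of_int k * x))) \<le> 28 * s powr (-1/3)"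
    if "s \<ge> 1" for s k
  proof (rule Bessel_integral_bound)
    have "(s powr (-1/3)) ^ 3 = s powr (-1)"
      using that by (simp add: powr_realpow[symmetric] powr_powr)
    then show "s * (s powr (-1/3)) ^ 3 = 1" using that by (simp add: powr_minus)
    show "0 < s powr (-1/3)" "s powr (-1/3) \<le> 1" using that powr_mono[of "-1/3" 0 s] by auto
  qed
  show ?thesis
  proof (cases "\<bar>t\<bar> \<ge> 1")
    case False
    then have "t\<^sup>2 \<le> 1" by (simp add: abs_square_le_1)
    then have "jbr t \<le> 2" unfolding jbr_def by (intro real_le_lsqrt) auto
    then have "(2::real) powr (-1/3) \<le> jbr t powr (-1/3)"
      using j1 by (intro powr_mono2') auto
    moreover have "(2::real) powr (-1) \<le> 2 powr (-1/3)" by (intro powr_mono) auto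
    ultimately have "1/2 \<le> jbr t powr (-1/3)" by (simp add: powr_minus)
    moreover have "norm (cmean (\<lambda>z. osc t z * z powi k)) \<le> 1"
      by (intro norm_cmean_le continuous_intros continuous_osc) (auto simp: norm_mult norm_osc norm_power_int)
    ultimately show ?thesis by linarith
  next
    case True
    have "norm (integral {-pi..pi} (\<lambda>x. cis (- 2 * t * cos x + real_of_int k * x))) \<le> 28 * \<bar>t\<bar> powr (-1/3)"
    proof (cases "t \<ge> 0")
      case True with \<open>\<bar>t\<bar> \<ge> 1\<close> large show ?thesis by simp
    next
      case False
      \<comment> \<open>Conjugation reverses both \<open>t\<close> and \<open>k\<close>, so negative
        times follow from positive ones by uniformity in \<open>k\<close>.\<close>
      have "integral {-pi..pi} (\<lambda>x. cis (- 2 * t * cos x + real_of_int k * x)) =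
        cnj (integral {-pi..pi} (\<lambda>x. cis (- 2 * (-t) * cos x + real_of_int (-k) * x)))"
        by (simp add: integral_cnj cis_cnj)
      then show ?thesis using large[of "-t" "-k"] False \<open>\<bar>t\<bar> \<ge> 1\<close> by (simp del: of_int_minus)
    qed
    then have "norm (cmean (\<lambda>z. osc t z * z powi k)) \<le> 28 * \<bar>t\<bar> powr (-1/3) / (2 * pi)"
      unfolding eq norm_mult norm_divide norm_cis mult_1
      by (simp only: norm_of_real norm_numeral abs_of_nonneg[OF pi_ge_zero]) (rule divide_right_mono, auto)
    also have "\<dots> \<le> 28 * \<bar>t\<bar> powr (-1/3) / (2 * 2)"
      by (intro divide_left_mono) (use pi_gt3 in auto)
    finally have 1: "norm (cmean (\<lambda>z. osc t z * z powi k)) \<le> 28 * \<bar>t\<bar> powr (-1/3) / (2 * 2)" .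
    have "\<bar>t\<bar> powr (-1/3) \<le> (jbr t / 2) powr (-1/3)"
    proof (rule powr_mono2')
      have "1 \<le> t\<^sup>2" using True by (metis one_le_power power2_abs)
      then show "jbr t / 2 \<le> \<bar>t\<bar>" unfolding jbr_def
        by (simp add: real_le_lsqrt power_mult_distrib)
    qed (use j1 in auto)
    also have "(jbr t / 2) powr (-1/3) = 2 powr (1/3) * jbr t powr (-1/3)"
      using j1 by (simp add: powr_divide powr_minus field_simps)
    also have "\<dots> \<le> 2 powr 1 * jbr t powr (-1/3)" by (intro mult_right_mono powr_mono) auto
    finally show ?thesis using 1 powr_ge_zero[of "jbr t" "-1/3"] unfolding powr_one[of 2, OF zero_le_numeral] by linarith
  qed
qed

text \<open>Uniformity in the frequency turns the bound for characters into one that sees only the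
  sum of the moduli of the coefficients.\<close>

lemma osc_cmean_wa:
  assumes "cw.wa 0 F B"
  shows "norm (cmean (\<lambda>z. osc t z * F z)) \<le> 16 * B * jbr t powr (-1/3)"
proof -
  obtain a k where s: "(\<lambda>i. norm (a i)) summable_on (UNIV::nat set)"
    and b: "(\<Sum>\<^sub>\<infinity>i. norm (a i)) \<le> B"
    and h: "\<And>z. z \<in> sphere 0 1 \<Longrightarrow> ((\<lambda>i. a i * z powi (k i)) has_sum F z) UNIV"
    using assms unfolding cw.wa_def cw_wt_def by (simp only: power_0 mult_1) blast
  have 1: "((\<lambda>i. cmean (\<lambda>z. a i * (osc t z * z powi (k i)))) has_sum cmean (\<lambda>z. osc t z * F z)) UNIV"
  proof (rule cmean_has_sum[OF _ _ s])
    show "continuous_on (sphere 0 1) (\<lambda>z. a i * (osc t z * z powi k i))" for i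
      by (intro continuous_intros continuous_osc) auto
    fix z :: complex assume z: "norm z = 1"
    show "norm (a i * (osc t z * z powi k i)) \<le> norm (a i)" for i
      using z by (simp add: norm_mult norm_osc norm_power_int)
    have "((\<lambda>i. osc t z * (a i * z powi k i)) has_sum osc t z * F z) UNIV"
      by (rule has_sum_cmult_right[OF h]) (use z in auto)
    then show "((\<lambda>i. a i * (osc t z * z powi k i)) has_sum osc t z * F z) UNIV"
      by (simp add: mult_ac)
  qed
  have "norm (cmean (\<lambda>z. osc t z * F z)) \<le> (\<Sum>\<^sub>\<infinity>i. norm (a i) * (16 * jbr t powr (-1/3)))"
  proof (rule has_sum_dominated_le[OF _ order_refl 1])
    show "(\<lambda>i. norm (a i) * (16 * jbr t powr (-1/3))) summable_on UNIV"
      by (rule summable_on_cmult_left[OF s])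
    show "norm (cmean (\<lambda>z. a i * (osc t z * z powi k i))) \<le> norm (a i) * (16 * jbr t powr (-1/3))" for i
      unfolding cmean_cmult norm_mult by (intro mult_left_mono osc_cmean_char) auto
  qed
  also have "\<dots> = (\<Sum>\<^sub>\<infinity>i. norm (a i)) * (16 * jbr t powr (-1/3))"
    by (rule infsum_cmult_left') 
  also have "\<dots> \<le> B * (16 * jbr t powr (-1/3))"
    by (intro mult_right_mono b) auto
  finally show ?thesis by (simp add: mult_ac)
qed

section \<open>Division and inversion in the Wiener algebra\<close>

lemma geometric_has_sum:
  assumes "norm (x::complex) < 1" shows "((\<lambda>n. x ^ n) has_sum inverse (1 - x)) UNIV"
  using norm_summable_imp_has_sum[of "\<lambda>n. x ^ n" "inverse (1 - x)"] assms geometric_sums[OF assms]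
  by (auto simp: norm_power summable_geometric inverse_eq_divide)

lemma real_geometric_has_sum:
  assumes "0 \<le> r" "r < 1" shows "((\<lambda>n. r ^ n) has_sum inverse (1 - r :: real)) UNIV"
  using norm_summable_imp_has_sum[of "\<lambda>n. r ^ n" "inverse (1 - r)"] assms geometric_sums[of r]
  by (auto simp: norm_power summable_geometric inverse_eq_divide)

lemma sum_power_le_inverse:
  assumes "0 \<le> r" "r < (1::real)" shows "(\<Sum>j<k. r ^ (k - Suc j)) \<le> inverse (1 - r)"
proof -
  have "(\<Sum>j<k. r ^ (k - Suc j)) = (\<Sum>j<k. r ^ j)"
    by (rule sum.nat_diff_reindex)
  also have "\<dots> \<le> infsum (\<lambda>j. r ^ j) UNIV"
    by (rule finite_sum_le_infsum) (use real_geometric_has_sum[OF assms] assms in \<open>auto simp: has_sum_iff\<close>)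
  also have "\<dots> = inverse (1 - r)" using real_geometric_has_sum[OF assms] by (simp add: has_sum_iff)
  finally show ?thesis .
qed

text \<open>Since \<open>F a = 0\<close>, the series is a combination of differences z^k - a^k, and
  the quotient of such a difference by z - a has norm at most the sum of |a|^i over i < k. That sum
  is at most 1/(1 - |a|) inside the disc and equals k on the circle; \<open>C\<close> and \<sigma>
  cover both cases.\<close>

lemma pw_divide_gen:
  assumes F: "pw.wa \<sigma> F B" and a: "norm a \<le> 1" and Fa: "F a = 0" and C: "0 \<le> C"
    and le: "\<And>k. (\<Sum>j<k. norm a ^ (k - Suc j)) \<le> C * (1 + real k) ^ \<sigma>"
  shows "\<exists>G. pw.wa 0 G (C * B) \<and> (\<forall>z\<in>cball 0 1. F z = (z - a) * G z)"
proof -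
  obtain c k where s: "(\<lambda>i. (1 + real (k i)) ^ \<sigma> * norm (c i)) summable_on (UNIV::nat set)"
    and b: "(\<Sum>\<^sub>\<infinity>i. (1 + real (k i)) ^ \<sigma> * norm (c i)) \<le> B"
    and h: "\<And>z. z \<in> cball 0 1 \<Longrightarrow> ((\<lambda>i. c i * z ^ (k i)) has_sum F z) UNIV"
    using F unfolding pw.wa_def pw_wt_def by blast
  define Q where "Q k z = (\<Sum>j<k. a ^ (k - Suc j) * z ^ j)" for k z
  have Q: "pw.wa 0 (Q k) (C * (1 + real k) ^ \<sigma>)" for k
  proof -
    have "pw.wa 0 (Q k) (\<Sum>j<k. pw_wt 0 j * norm (a ^ (k - Suc j)))"
      unfolding Q_def by (rule pw.wa_sum) (auto intro: pw.wa_char)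
    then show ?thesis by (rule pw.wa_mono) (use le in \<open>simp add: norm_power pw_wt_def\<close>)
  qed
  have s': "(\<lambda>i. C * ((1 + real (k i)) ^ \<sigma> * norm (c i))) summable_on UNIV"
    by (rule summable_on_cmult_right[OF s])
  have "pw.wa 0 (\<lambda>z. \<Sum>\<^sub>\<infinity>i. c i * Q (k i) z) (C * B)"
  proof (rule pw.wa_family)
    show "pw.wa 0 (\<lambda>z. c i * Q (k i) z) (C * ((1 + real (k i)) ^ \<sigma> * norm (c i)))" for i
      using pw.wa_cmult[OF Q[of "k i"], of "c i"] by (simp add: mult_ac)
    show "(\<Sum>\<^sub>\<infinity>i. C * ((1 + real (k i)) ^ \<sigma> * norm (c i))) \<le> C * B"
      using s b C by (simp add: infsum_cmult_right mult_left_mono)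
  qed (rule s')
  moreover have "F z = (z - a) * (\<Sum>\<^sub>\<infinity>i. c i * Q (k i) z)" if z: "z \<in> cball 0 1" for z
  proof -
    have "((\<lambda>i. c i * z ^ k i - c i * a ^ k i) has_sum F z - F a) UNIV"
      using has_sum_add[OF h[OF z] has_sum_uminusI[OF h[of a]]] a by simp
    moreover have "c i * z ^ k i - c i * a ^ k i = (z - a) * (c i * Q (k i) z)" for i
      using power_diff_sumr2[of z "k i" a] by (simp add: Q_def right_diff_distrib[symmetric])
    ultimately have "(\<Sum>\<^sub>\<infinity>i. (z - a) * (c i * Q (k i) z)) = F z"
      using Fa by (simp add: has_sum_iff)
    then show ?thesis by (simp add: infsum_cmult_right')
  qed
  ultimately show ?thesis by blast
qed

lemma pw_divide_inside:
  assumes "pw.wa 0 F B" "norm a < 1" "F a = 0"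
  shows "\<exists>G. pw.wa 0 G (inverse (1 - norm a) * B) \<and> (\<forall>z\<in>cball 0 1. F z = (z - a) * G z)"
  by (rule pw_divide_gen[OF assms(1) _ assms(3)]) (use assms(2) sum_power_le_inverse in auto)

lemma pw_divide_boundary:
  assumes "pw.wa 1 F B" "norm a = 1" "F a = 0"
  shows "\<exists>G. pw.wa 0 G B \<and> (\<forall>z\<in>cball 0 1. F z = (z - a) * G z)"
  using pw_divide_gen[OF assms(1) _ assms(3), of 1] assms(2) by auto

lemma cw_divide_boundary:
  assumes F: "cw.wa 1 F B" and a: "norm a = 1" and Fa: "F a = 0"
  shows "\<exists>G. cw.wa 0 G B \<and> (\<forall>z\<in>sphere 0 1. F z = (z - a) * G z)"
proof -
  obtain c k where s: "(\<lambda>i. (1 + real_of_int \<bar>k i\<bar>) * norm (c i)) summable_on (UNIV::nat set)"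
    and b: "(\<Sum>\<^sub>\<infinity>i. (1 + real_of_int \<bar>k i\<bar>) * norm (c i)) \<le> B"
    and h: "\<And>z. z \<in> sphere 0 1 \<Longrightarrow> ((\<lambda>i. c i * z powi (k i)) has_sum F z) UNIV"
    using F unfolding cw.wa_def cw_wt_def by (simp only: power_one_right) blast
  define P where "P n z = (\<Sum>j<n. a ^ (n - Suc j) * z powi (int j))" for n z
  have P: "cw.wa 0 (P n) (real n)" for n
  proof -
    have "cw.wa 0 (P n) (\<Sum>j<n. cw_wt 0 (int j) * norm (a ^ (n - Suc j)))"
      unfolding P_def by (intro cw.wa_sum cw.wa_char finite_lessThan)
    then show ?thesis by (rule cw.wa_mono) (use a in \<open>simp add: norm_power cw_wt_def\<close>)
  qed
  have Pd: "z ^ n - a ^ n = (z - a) * P n z" for n z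
    using power_diff_sumr2[of z n a] by (simp add: P_def)
  \<comment> \<open>A negative exponent reduces to a positive one through z^k - a^k = - a^k z^k
    (z^(-k) - a^(-k)); the prefactor is a character with a coefficient of modulus 1.\<close>
  define Q where "Q k z = (if k \<ge> 0 then P (nat k) z
     else - (a powi k) * z powi k * P (nat (-k)) z)" for k z
  have Q: "cw.wa 0 (Q k) (1 + real_of_int \<bar>k\<bar>)" for k
  proof (cases "k \<ge> 0")
    case True
    then have "Q k = P (nat k)" by (auto simp: Q_def)
    then show ?thesis using cw.wa_mono[OF P[of "nat k"]] True by simp
  next
    case False
    then have "Q k = (\<lambda>z. - (a powi k) * z powi k * P (nat (-k)) z)" by (auto simp: Q_def)
    then show ?thesis using cw.wa_mono[OF cw.wa_char_mult[OF P[of "nat (-k)"], of "- (a powi k)" k]] False a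
      by (simp add: norm_power_int cw_wt_def norm_mult)
  qed
  have Qd: "z powi k - a powi k = (z - a) * Q k z" if z: "norm z = 1" for z k
  proof (cases "k \<ge> 0")
    case True then show ?thesis using Pd[of z "nat k"] by (simp add: Q_def power_int_def)
  next
    case False
    have nz: "z \<noteq> 0" "a \<noteq> 0" using z a by auto
    have "z powi k - a powi k = - (a powi k) * z powi k * (z ^ nat (-k) - a ^ nat (-k))"
      using False nz by (simp add: power_int_def field_simps)
    then show ?thesis using Pd[of z "nat (-k)"] False by (simp add: Q_def)
  qed
  have "cw.wa 0 (\<lambda>z. \<Sum>\<^sub>\<infinity>i. c i * Q (k i) z) B"
  proof (rule cw.wa_family)
    show "cw.wa 0 (\<lambda>z. c i * Q (k i) z) ((1 + real_of_int \<bar>k i\<bar>) * norm (c i))" for i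
      using cw.wa_cmult[OF Q[of "k i"], of "c i"] by (simp add: mult_ac)
  qed (fact s b)+
  moreover have "F z = (z - a) * (\<Sum>\<^sub>\<infinity>i. c i * Q (k i) z)" if z: "z \<in> sphere 0 1" for z
  proof -
    have "((\<lambda>i. c i * z powi k i - c i * a powi k i) has_sum F z - F a) UNIV"
      using has_sum_add[OF h[OF z] has_sum_uminusI[OF h[of a]]] a by simp
    moreover have "c i * z powi k i - c i * a powi k i = (z - a) * (c i * Q (k i) z)" for i
      using Qd[of z "k i"] z by (simp add: right_diff_distrib[symmetric])
    ultimately have "(\<Sum>\<^sub>\<infinity>i. (z - a) * (c i * Q (k i) z)) = F z"
      using Fa by (simp add: has_sum_iff)
    then show ?thesis by (simp add: infsum_cmult_right')
  qed
  ultimately show ?thesis by blast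
qed

lemma pw_imp_cw:
  assumes "pw.wa \<sigma> F B"
  shows "cw.wa \<sigma> F B" "cw.wa \<sigma> (\<lambda>z. F (inverse z)) B"
proof -
  obtain c k where s: "(\<lambda>i. (1 + real (k i)) ^ \<sigma> * norm (c i)) summable_on (UNIV::nat set)"
    and b: "(\<Sum>\<^sub>\<infinity>i. (1 + real (k i)) ^ \<sigma> * norm (c i)) \<le> B"
    and h: "\<And>z. z \<in> cball 0 1 \<Longrightarrow> ((\<lambda>i. c i * z ^ (k i)) has_sum F z) UNIV"
    using assms unfolding pw.wa_def pw_wt_def by blast
  show "cw.wa \<sigma> F B" unfolding cw.wa_def cw_wt_def
    by (rule exI[of _ c], rule exI[of _ "\<lambda>i. int (k i)"]) (use s b h in auto)
  show "cw.wa \<sigma> (\<lambda>z. F (inverse z)) B" unfolding cw.wa_def cw_wt_def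
  proof (rule exI[of _ c], rule exI[of _ "\<lambda>i. - int (k i)"], intro conjI ballI)
    fix z :: complex assume "z \<in> sphere 0 1"
    then show "((\<lambda>i. c i * z powi - int (k i)) has_sum F (inverse z)) UNIV"
      using h[of "inverse z"] by (simp add: norm_inverse power_int_minus power_inverse)
  qed (use s b in auto)
qed

text \<open>A pole inside the disc has a geometric expansion in negative powers of z, absolutely
  convergent on the circle; this is the point where \<open>pw\<close> has to be left for
  \<open>cw\<close>.\<close>

lemma cw_inverse_linear:
  assumes "norm a < 1" shows "cw.wa 0 (\<lambda>z. inverse (z - a)) (inverse (1 - norm a))"
proof -
  have *: "((\<lambda>n. norm a ^ n) has_sum inverse (1 - norm a)) UNIV"
    using assms by (intro real_geometric_has_sum) auto
  have "cw.wa 0 (\<lambda>z. \<Sum>\<^sub>\<infinity>n::nat. a ^ n * z powi (- int n - 1)) (inverse (1 - norm a))"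
  proof (rule cw.wa_family)
    show "cw.wa 0 (\<lambda>z. a ^ n * z powi (- int n - 1)) (norm a ^ n)" for n
      using cw.wa_char[of 0 "a ^ n" "- int n - 1"] by (simp add: norm_power cw_wt_def)
  qed (use * in \<open>auto simp: has_sum_iff\<close>)
  then show ?thesis
  proof (rule cw.wa_cong)
    fix z :: complex assume "z \<in> sphere 0 1"
    then have z: "norm z = 1" "z \<noteq> 0" by auto
    have "((\<lambda>n. (a / z) ^ n * inverse z) has_sum inverse (1 - a / z) * inverse z) UNIV"
      by (intro has_sum_cmult_left geometric_has_sum) (use z assms in \<open>auto simp: norm_divide\<close>)
    moreover have "inverse (1 - a / z) * inverse z = inverse (z - a)"
      using z by (simp add: inverse_mult_distrib[symmetric] left_diff_distrib del: inverse_mult_distrib)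
    moreover have "(a / z) ^ n * inverse z = a ^ n * z powi (- int n - 1)" for n
      using z by (simp add: power_int_diff power_int_minus power_divide field_simps)
    ultimately show "(\<Sum>\<^sub>\<infinity>n. a ^ n * z powi (- int n - 1)) = inverse (z - a)"
      by (simp add: has_sum_iff)
  qed
qed

text \<open>Cauchy's inequalities on the circle of radius R > 1 make the coefficients decay like
  R^(-n). The bound is linear in the supremum \<open>M\<close>, with a factor that depends on R
  only, so powers of a function are controlled by powers of its supremum.\<close>

lemma pw_holomorphic:
  assumes "f holomorphic_on ball 0 R" "continuous_on (cball 0 R) f" "1 < R"
    "\<And>z. norm z = R \<Longrightarrow> norm (f z) \<le> M"
  shows "pw.wa 0 f (M * inverse (1 - 1 / R))"
proof -
  define c where "c n = (deriv ^^ n) f 0 / fact n" for n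
  have M: "0 \<le> M" using assms(4)[of "complex_of_real R"] assms(3) by (auto intro: order_trans[OF norm_ge_zero])
  have c: "norm (c n) \<le> M * (1 / R) ^ n" for n
  proof -
    have "norm ((deriv ^^ n) f 0) \<le> fact n * M / R ^ n"
      by (rule Cauchy_inequality[OF assms(1,2)]) (use assms in auto)
    then show ?thesis by (simp add: c_def norm_divide field_simps)
  qed
  have g: "((\<lambda>n. M * (1 / R) ^ n) has_sum M * inverse (1 - 1 / R)) UNIV"
    by (intro has_sum_cmult_right real_geometric_has_sum) (use assms(3) in auto)
  have "pw.wa 0 (\<lambda>z. \<Sum>\<^sub>\<infinity>n. c n * z ^ n) (M * inverse (1 - 1 / R))"
  proof (rule pw.wa_family)
    show "pw.wa 0 (\<lambda>z. c n * z ^ n) (M * (1 / R) ^ n)" for n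
      by (rule pw.wa_mono[OF pw.wa_char]) (use c[of n] in \<open>simp add: pw_wt_def\<close>)
  qed (use g in \<open>auto simp: has_sum_iff\<close>)
  then show ?thesis
  proof (rule pw.wa_cong)
    fix z :: complex assume z: "z \<in> cball 0 1"
    have "(\<lambda>n. c n * z ^ n) sums f z"
      using holomorphic_power_series[OF assms(1), of z] z assms(3) by (simp add: c_def)
    moreover have "summable (\<lambda>n. norm (c n * z ^ n))"
    proof (rule summable_comparison_test')
      show "summable (\<lambda>n. M * (1 / R) ^ n)"
        by (rule summable_on_imp_summable[OF has_sum_imp_summable[OF g]])
      fix n
      show "norm (norm (c n * z ^ n)) \<le> M * (1 / R) ^ n"
        using mult_mono[OF c[of n], of "norm z ^ n" 1] z M assms(3) by (simp add: norm_mult norm_power power_le_one)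
    qed
    ultimately show "(\<Sum>\<^sub>\<infinity>n. c n * z ^ n) = f z"
      by (intro infsumI norm_summable_imp_has_sum)
  qed
qed

text \<open>Newman's proof of Wiener's lemma: with a polynomial \<open>P\<close> close to \<open>V\<close>,
  \<open>1 / V = \<Sum>n. (P - V) ^ n / P ^ (n + 1)\<close>, where the norm of \<open>1 / P ^ (n + 1)\<close> is controlled by
  its maximum on a slightly larger disc.\<close>
lemma pw_inverse:
  assumes V: "pw.wa 0 V B" and nz: "\<And>z. z \<in> cball 0 1 \<Longrightarrow> V z \<noteq> 0"
  shows "\<exists>C. pw.wa 0 (\<lambda>z. inverse (V z)) C"
proof -
  obtain z0 :: complex where z0: "z0 \<in> cball 0 1" "\<And>z. z \<in> cball 0 1 \<Longrightarrow> norm (V z0) \<le> norm (V z)"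
    using continuous_attains_inf[of "cball (0::complex) 1" "\<lambda>z. norm (V z)"] pw.wa_continuous[OF V]
    by (force intro!: continuous_on_norm)
  define c where "c = norm (V z0)"
  have c: "c > 0" and cV: "\<And>z. norm z \<le> 1 \<Longrightarrow> c \<le> norm (V z)"
    using nz[OF z0(1)] z0(2) by (auto simp: c_def)
  \<comment> \<open>With error c/4, \<open>P\<close> stays above 3c/4 on the unit disc and, for a
    radius R close to 1, above c/2 on the larger disc. The Neumann series then has ratio (c/4)(2/c)
    = 1/2.\<close>
  obtain S :: "nat set" and a k where S: "finite S"
    "pw.wa 0 (\<lambda>z. V z - (\<Sum>i\<in>S. a i * z ^ k i)) (c/4)"
    using pw.wa_approx[OF V, of "c/4"] c by auto
  define P where "P z = (\<Sum>i\<in>S. a i * z ^ k i)" for z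
  have VP: "pw.wa 0 (\<lambda>z. P z - V z) (c/4)"
    using pw.wa_uminus[OF S(2)] by (simp add: P_def)
  have VPn: "norm (P z - V z) \<le> c/4" if "norm z \<le> 1" for z
    using pw.wa_norm[OF VP, of z] that by simp
  have Pc: "continuous_on A P" for A unfolding P_def by (intro continuous_intros)
  have Ph: "P holomorphic_on A" for A unfolding P_def by (intro holomorphic_intros)
  have P1: "3 * c / 4 \<le> norm (P z)" if "norm z \<le> 1" for z
    using cV[OF that] VPn[OF that] norm_triangle_ineq2[of "V z" "P z"] by (simp add: norm_minus_commute)
  have "uniformly_continuous_on (cball 0 2) P"
    by (rule compact_uniformly_continuous[OF Pc]) auto
  then obtain d where d: "d > 0" "\<And>x y. x \<in> cball 0 2 \<Longrightarrow> y \<in> cball 0 2 \<Longrightarrow> dist y x < d \<Longrightarrow> dist (P y) (P x) < c/4"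
    using c unfolding uniformly_continuous_on_def by (metis divide_pos_pos zero_less_numeral)
  define R where "R = 1 + min 1 (d/2)"
  have R: "1 < R" "R \<le> 2" "R - 1 < d" using d(1) by (auto simp: R_def)
  have PR: "c/2 \<le> norm (P z)" if z: "norm z \<le> R" for z
  proof (cases "norm z \<le> 1")
    case True then show ?thesis using P1[of z] c by simp
  next
    case False
    then have sg: "norm (sgn z) = 1" by (auto simp: norm_sgn)
    \<comment> \<open>Beyond the unit circle \<open>z\<close> is compared with its radial projection
      \<open>sgn z\<close>, at distance |z| - 1 < d.\<close>
    have "z - sgn z = (norm z - 1) *\<^sub>R sgn z"
      using sg by (cases "z = 0") (auto simp: sgn_div_norm left_diff_distrib scaleR_diff_left)
    then have "dist z (sgn z) = \<bar>norm z - 1\<bar>" using sg by (simp add: dist_norm)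
    then have "dist z (sgn z) < d" using False z R by simp
    then have "dist (P z) (P (sgn z)) < c/4" using d(2)[of "sgn z" z] z R sg by simp
    moreover have "3 * c / 4 \<le> norm (P (sgn z))" using P1[of "sgn z"] sg by simp
    ultimately show ?thesis
      using norm_triangle_ineq2[of "P (sgn z)" "P z"] by (simp add: dist_norm norm_minus_commute)
  qed
  then have P0: "P z \<noteq> 0" if "norm z \<le> R" for z using that c by fastforce
  define K where "K = inverse (1 - 1 / R)"
  have h: "pw.wa 0 (\<lambda>z. inverse (P z) ^ Suc n) ((2/c) ^ Suc n * K)" for n
    unfolding K_def
  proof (rule pw_holomorphic)
    show "(\<lambda>z. inverse (P z) ^ Suc n) holomorphic_on ball 0 R"
      by (intro holomorphic_intros Ph) (use P0 in auto)
    show "continuous_on (cball 0 R) (\<lambda>z. inverse (P z) ^ Suc n)"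
      by (intro continuous_intros Pc) (use P0 in auto)
    fix z :: complex assume "norm z = R"
    then have "norm (inverse (P z)) \<le> 2 / c" using PR[of z] c P0[of z]
      by (simp add: norm_divide inverse_eq_divide divide_simps mult.commute)
    then show "norm (inverse (P z) ^ Suc n) \<le> (2/c) ^ Suc n"
      unfolding norm_power by (rule power_mono) simp
  qed (rule R)
  have K: "K > 0" using R by (simp add: K_def)
  have "pw.wa 0 (\<lambda>z. \<Sum>\<^sub>\<infinity>n. (P z - V z) ^ n * inverse (P z) ^ Suc n) ((2 / c * K) * inverse (1 - 1/2))"
  proof (rule pw.wa_family)
    show "pw.wa 0 (\<lambda>z. (P z - V z) ^ n * inverse (P z) ^ Suc n) (2 / c * K * (1/2) ^ n)" for n
    proof -
      have "(c/4) ^ n * ((2/c) ^ Suc n * K) = 2 / c * K * ((c/4) * (2/c)) ^ n"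
        by (simp only: power_mult_distrib power_Suc mult_ac)
      also have "(c/4) * (2/c) = 1/2" using c by simp
      finally show ?thesis using pw.wa_mult[OF pw.wa_power[OF VP, of n] h[of n]] by (simp only:)
    qed
    have g: "((\<lambda>n. 2 / c * K * (1/2) ^ n) has_sum 2 / c * K * inverse (1 - 1/2)) UNIV"
      by (intro has_sum_cmult_right real_geometric_has_sum) auto
    then show "(\<lambda>n. 2 / c * K * (1/2) ^ n) summable_on UNIV"
      "(\<Sum>\<^sub>\<infinity>n. 2 / c * K * (1/2) ^ n) \<le> 2 / c * K * inverse (1 - 1/2)"
      by (auto simp: has_sum_iff)
  qed
  then have "pw.wa 0 (\<lambda>z. inverse (V z)) ((2 / c * K) * inverse (1 - 1/2))"
  proof (rule pw.wa_cong)
    fix z :: complex assume "z \<in> cball 0 1"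
    then have z: "norm z \<le> 1" by simp
    let ?x = "(P z - V z) * inverse (P z)"
    have Pz: "P z \<noteq> 0" using P0[of z] z R by simp
    have "norm (P z - V z) < norm (P z)" using VPn[OF z] P1[OF z] c by linarith
    then have "norm ?x < 1" using Pz by (simp only: norm_mult norm_inverse) (simp add: divide_simps flip: divide_inverse)
    from has_sum_cmult_left[OF geometric_has_sum[OF this], of "inverse (P z)"]
    have "((\<lambda>n. ?x ^ n * inverse (P z)) has_sum inverse (1 - ?x) * inverse (P z)) UNIV" .
    moreover have "inverse (1 - ?x) * inverse (P z) = inverse (V z)"
    proof -
      have "(1 - ?x) * P z = V z" using Pz by (simp add: field_simps)
      then show ?thesis by (metis inverse_mult_distrib mult.commute)
    qed
    moreover have "?x ^ n * inverse (P z) = (P z - V z) ^ n * inverse (P z) ^ Suc n" for n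
      by (simp only: power_mult_distrib power_Suc mult_ac)
    ultimately show "(\<Sum>\<^sub>\<infinity>n. (P z - V z) ^ n * inverse (P z) ^ Suc n) = inverse (V z)"
      by (simp add: has_sum_iff)
  qed
  then show ?thesis by blast
qed

section \<open>Residue calculus inside the algebra\<close>

lemma cmean_pw: assumes "pw.wa 0 F B" shows "cmean F = F 0" "cmean (\<lambda>z. z * F z) = 0"
proof -
  obtain c k where s: "(\<lambda>i. norm (c i)) summable_on (UNIV::nat set)"
    and h: "\<And>z. z \<in> cball 0 1 \<Longrightarrow> ((\<lambda>i. c i * z ^ (k i)) has_sum F z) UNIV"
    using assms unfolding pw.wa_def pw_wt_def by (simp only: power_0 mult_1) blast
  have pw: "cmean (\<lambda>z. z ^ n) = 0 ^ n" for n
    using cmean_powi[of "int n"] by (cases "n = 0") (auto simp: power_0_left)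
  have "((\<lambda>i. cmean (\<lambda>z. c i * z ^ k i)) has_sum cmean F) UNIV"
    by (rule cmean_has_sum(1)[OF _ _ s]) (use h in \<open>auto simp: norm_mult norm_power intro!: continuous_intros\<close>)
  then have "((\<lambda>i. c i * 0 ^ k i) has_sum cmean F) UNIV" by (simp add: cmean_cmult pw)
  then show "cmean F = F 0" using h[of 0] has_sum_unique by auto
  have "((\<lambda>i. cmean (\<lambda>z. c i * z ^ Suc (k i))) has_sum cmean (\<lambda>z. z * F z)) UNIV"
  proof (rule cmean_has_sum(1)[OF _ _ s])
    fix z :: complex assume z: "norm z = 1"
    show "((\<lambda>i. c i * z ^ Suc (k i)) has_sum z * F z) UNIV"
      using has_sum_cmult_right[OF h[of z], of z] z by (simp add: mult_ac)
    show "norm (c i * z ^ Suc (k i)) \<le> norm (c i)" for i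
      unfolding norm_mult norm_power z by simp
  qed (intro continuous_intros)
  then have "((\<lambda>i. 0) has_sum cmean (\<lambda>z. z * F z)) (UNIV :: nat set)" by (simp only: cmean_cmult pw) simp
  then show "cmean (\<lambda>z. z * F z) = 0" using has_sum_unique has_sum_0_simp by blast
qed

text \<open>As \<open>F\<close> belongs to the algebra, F - F(a) is divisible by z - a there, and z
  times the quotient has mean zero; so only 1/(z - a) itself has to be integrated. The mean is the
  integral against dz/(2 pi i z), whence the factor z.\<close>

lemma cmean_Cauchy:
  assumes F: "pw.wa 0 F B" and a: "norm a < 1"
  shows "cmean (\<lambda>z. z * (inverse (z - a) * F z)) = F a"
proof -
  have "pw.wa 0 (\<lambda>z. F z - F a) (B + norm (F a))"
    by (rule pw.wa_diff[OF F pw.wa_const])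
  then obtain G C where G: "pw.wa 0 G C" "\<And>z. z \<in> cball 0 1 \<Longrightarrow> F z - F a = (z - a) * G z"
    using pw_divide_inside[of "\<lambda>z. F z - F a" _ a] a by fastforce
  have za: "z - a \<noteq> 0" if "norm z = 1" for z using that a by auto
  have 1: "cmean (\<lambda>z. z * inverse (z - a)) = 1"
  proof -
    have "((\<lambda>n. cmean (\<lambda>z. a ^ n * z powi (- int n))) has_sum cmean (\<lambda>z. z * inverse (z - a))) UNIV"
    proof (rule cmean_has_sum(1))
      show "continuous_on (sphere 0 1) (\<lambda>z. a ^ n * z powi - int n)" for n
        by (intro continuous_intros) auto
      show "(\<lambda>n. norm a ^ n) summable_on UNIV"
        using real_geometric_has_sum[of "norm a"] a by (auto simp: has_sum_iff)
      fix z :: complex assume z: "norm z = 1"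
      show "norm (a ^ n * z powi - int n) \<le> norm a ^ n" for n
        using z by (simp add: norm_mult norm_power norm_power_int)
      have z0: "z \<noteq> 0" using z by auto
      have "((\<lambda>n. (a / z) ^ n) has_sum inverse (1 - a / z)) UNIV"
        by (intro geometric_has_sum) (use z a in \<open>auto simp: norm_divide\<close>)
      moreover have "inverse (1 - a / z) = z * inverse (z - a)"
        using z0 za[OF z] by (simp add: field_simps)
      moreover have "(a / z) ^ n = a ^ n * z powi (- int n)" for n
        by (simp add: power_int_minus power_divide field_simps)
      ultimately show "((\<lambda>n. a ^ n * z powi - int n) has_sum z * inverse (z - a)) UNIV" by simp
    qed
    moreover have "((\<lambda>n. cmean (\<lambda>z. a ^ n * z powi (- int n))) has_sum 1) UNIV"
      unfolding cmean_cmult cmean_powi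
      by (rule has_sum_finite_neutralI[of "{0}"]) auto
    ultimately show ?thesis using has_sum_unique by blast
  qed
  have "cmean (\<lambda>z. z * (inverse (z - a) * F z)) = cmean (\<lambda>z. F a * (z * inverse (z - a)) + z * G z)"
  proof (rule cmean_cong)
    fix z :: complex assume z: "norm z = 1"
    have "F z = F a + (z - a) * G z" using G(2)[of z] z by (simp add: algebra_simps)
    then have "inverse (z - a) * F z = inverse (z - a) * F a + G z"
      using za[OF z] by (simp add: distrib_left mult.assoc[symmetric])
    then show "z * (inverse (z - a) * F z) = F a * (z * inverse (z - a)) + z * G z"
      by (simp add: distrib_left mult_ac)
  qed
  also have "\<dots> = cmean (\<lambda>z. F a * (z * inverse (z - a))) + cmean (\<lambda>z. z * G z)"
    using pw.wa_continuous[OF G(1)] za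
    by (intro cmean_add continuous_intros) (auto intro: continuous_on_subset)
  also have "\<dots> = F a" using cmean_pw(2)[OF G(1)] 1 by (simp add: cmean_cmult)
  finally show ?thesis .
qed

text \<open>The factor z is the one in the measure dz/(2 pi i z). Only the coefficient of 1/z is
  made explicit, since it becomes the identity in the kernel; the other residues may stay abstract,
  because any combination of eigenfunctions is absorbed by the projection.\<close>

lemma partial_fractions:
  assumes "finite Z" "0 \<notin> (Z :: complex set)"
  shows "\<exists>\<alpha>. \<forall>z. z \<noteq> 0 \<longrightarrow> z \<notin> Z \<longrightarrow> inverse (z * (\<Prod>a\<in>Z. z - a)) =
    inverse (\<Prod>a\<in>Z. - a) * inverse z + (\<Sum>a\<in>Z. \<alpha> a * inverse (z - a))"
  using assms
proof (induction Z rule: finite_induct)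
  case empty show ?case by simp
next
  case (insert b Z)
  then obtain \<alpha> where \<alpha>: "\<And>z. z \<noteq> 0 \<Longrightarrow> z \<notin> Z \<Longrightarrow> inverse (z * (\<Prod>a\<in>Z. z - a)) =
    inverse (\<Prod>a\<in>Z. - a) * inverse z + (\<Sum>a\<in>Z. \<alpha> a * inverse (z - a))" by auto
  have b0: "b \<noteq> 0" using insert by auto
  define c where "c = inverse (\<Prod>a\<in>Z. - a)"
  \<comment> \<open>Splitting 1/((z - a)(z - b)) divides each old coefficient by a - b and collects
    the remainders in the new coefficient at \<open>b\<close>.\<close>
  define \<beta> where "\<beta> x = (if x = b then inverse b * c - (\<Sum>a\<in>Z. \<alpha> a * inverse (a - b)) else \<alpha> x * inverse (x - b))" for x
  show ?case
  proof (intro exI[of _ \<beta>] allI impI)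
    fix z assume z: "z \<noteq> 0" "z \<notin> insert b Z"
    have "inverse (z * (\<Prod>a\<in>insert b Z. z - a)) = inverse (z - b) * inverse (z * (\<Prod>a\<in>Z. z - a))"
      using insert by (simp add: mult_ac)
    also have "\<dots> = c * (inverse z * inverse (z - b)) + (\<Sum>a\<in>Z. \<alpha> a * (inverse (z - a) * inverse (z - b)))"
      using \<alpha>[of z] z by (simp add: c_def algebra_simps sum_distrib_left)
    also have "inverse z * inverse (z - b) = inverse b * (inverse (z - b) - inverse z)"
      using z b0 by (simp add: field_simps)
    also have "(\<Sum>a\<in>Z. \<alpha> a * (inverse (z - a) * inverse (z - b))) =
        (\<Sum>a\<in>Z. \<beta> a * inverse (z - a) - \<alpha> a * inverse (a - b) * inverse (z - b))"
    proof (rule sum.cong)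
      fix a assume a: "a \<in> Z"
      then have n: "a \<noteq> b" "z \<noteq> a" "z \<noteq> b" using insert z by auto
      then have "inverse (z - a) * inverse (z - b) = inverse (a - b) * (inverse (z - a) - inverse (z - b))"
        by (simp add: field_simps)
      from arg_cong[OF this, of "\<lambda>x. \<alpha> a * x"]
      show "\<alpha> a * (inverse (z - a) * inverse (z - b)) = \<beta> a * inverse (z - a) - \<alpha> a * inverse (a - b) * inverse (z - b)"
        using n by (simp add: \<beta>_def right_diff_distrib mult.assoc)
    qed simp
    also have "c * (inverse b * (inverse (z - b) - inverse z)) + \<dots> =
      - inverse b * c * inverse z + (\<beta> b * inverse (z - b) + (\<Sum>a\<in>Z. \<beta> a * inverse (z - a)))"
      by (simp add: \<beta>_def sum_subtractf sum_distrib_right sum_distrib_left algebra_simps)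
    finally show "inverse (z * (\<Prod>a\<in>insert b Z. z - a)) = inverse (\<Prod>a\<in>insert b Z. - a) * inverse z +
        (\<Sum>a\<in>insert b Z. \<beta> a * inverse (z - a))"
      using insert b0 by (simp add: c_def field_simps)
  qed
qed

text \<open>The coefficients \<alpha> are chosen before \<open>h\<close>, hence depend on the poles
  only: one choice serves all pairs of sites.\<close>

lemma cmean_residues:
  assumes Z: "finite Z" "0 \<notin> Z" "Z \<subseteq> ball 0 1"
  shows "\<exists>\<alpha>. \<forall>h B. pw.wa 0 h B \<longrightarrow> cmean (\<lambda>z. inverse (\<Prod>a\<in>Z. z - a) * h z) =
     inverse (\<Prod>a\<in>Z. - a) * h 0 + (\<Sum>a\<in>Z. \<alpha> a * h a)"
proof -
  obtain \<alpha> where \<alpha>: "\<And>z. z \<noteq> 0 \<Longrightarrow> z \<notin> Z \<Longrightarrow> inverse (z * (\<Prod>a\<in>Z. z - a)) =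
    inverse (\<Prod>a\<in>Z. - a) * inverse z + (\<Sum>a\<in>Z. \<alpha> a * inverse (z - a))"
    using partial_fractions[OF Z(1,2)] by auto
  show ?thesis
  proof (intro exI[of _ \<alpha>] allI impI)
    fix h B assume h: "pw.wa 0 h B"
    have hc: "continuous_on (sphere 0 1) h"
      using pw.wa_continuous[OF h] by (rule continuous_on_subset) auto
    define c where "c = inverse (\<Prod>a\<in>Z. - a)"
    have nz: "z - a \<noteq> 0" if "z \<in> sphere 0 1" "a \<in> Z" for z a using that Z by auto
    have "cmean (\<lambda>z. inverse (\<Prod>a\<in>Z. z - a) * h z) =
      cmean (\<lambda>z. c * h z + (\<Sum>a\<in>Z. \<alpha> a * (z * (inverse (z - a) * h z))))"
    proof (rule cmean_cong)
      fix z :: complex assume z: "norm z = 1"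
      then have z0: "z \<noteq> 0" "z \<notin> Z" using Z by auto
      have "inverse (\<Prod>a\<in>Z. z - a) = z * inverse (z * (\<Prod>a\<in>Z. z - a))" using z0 by simp
      also have "\<dots> = c + (\<Sum>a\<in>Z. \<alpha> a * (z * inverse (z - a)))"
        unfolding \<alpha>[OF z0] using z0 by (simp add: c_def field_simps sum_distrib_left)
      finally show "inverse (\<Prod>a\<in>Z. z - a) * h z = c * h z + (\<Sum>a\<in>Z. \<alpha> a * (z * (inverse (z - a) * h z)))"
        by (simp add: distrib_right sum_distrib_right sum_distrib_left distrib_left mult_ac)
    qed
    also have "\<dots> = cmean (\<lambda>z. c * h z) + cmean (\<lambda>z. (\<Sum>a\<in>Z. \<alpha> a * (z * (inverse (z - a) * h z))))"
      by (intro cmean_add continuous_intros hc) (use nz in auto)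
    also have "cmean (\<lambda>z. (\<Sum>a\<in>Z. \<alpha> a * (z * (inverse (z - a) * h z)))) =
        (\<Sum>a\<in>Z. cmean (\<lambda>z. \<alpha> a * (z * (inverse (z - a) * h z))))"
      by (intro cmean_sum continuous_intros hc Z) (use nz in auto)
    also have "\<dots> = (\<Sum>a\<in>Z. \<alpha> a * h a)"
      unfolding cmean_cmult by (intro sum.cong refl) (use cmean_Cauchy[OF h] Z in auto)
    finally show "cmean (\<lambda>z. inverse (\<Prod>a\<in>Z. z - a) * h z) = inverse (\<Prod>a\<in>Z. - a) * h 0 + (\<Sum>a\<in>Z. \<alpha> a * h a)"
      using cmean_pw(1)[OF h] by (simp add: cmean_cmult c_def)
  qed
qed

lemma pw_factor:
  assumes "finite Z" "Z \<subseteq> ball 0 1" "pw.wa 0 F B" "\<And>a. a \<in> Z \<Longrightarrow> F a = 0"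
  shows "\<exists>v C. pw.wa 0 v C \<and> (\<forall>z\<in>cball 0 1. F z = (\<Prod>a\<in>Z. z - a) * v z)"
  using assms(1,2,4)
proof (induction Z rule: finite_induct)
  case empty then show ?case using assms(3) by auto
next
  case (insert b Z)
  then obtain v C where v: "pw.wa 0 v C" "\<And>z. z \<in> cball 0 1 \<Longrightarrow> F z = (\<Prod>a\<in>Z. z - a) * v z" by auto
  have b: "norm b < 1" using insert by auto
  have "v b = 0" using v(2)[of b] insert b by auto
  from pw_divide_inside[OF v(1) b this] obtain G C' where
    "pw.wa 0 G C'" "\<And>z. z \<in> cball 0 1 \<Longrightarrow> v z = (z - b) * G z" by auto
  with v(2) insert show ?case by (intro exI[of _ G] exI[of _ C']) (auto simp: mult_ac)
qed

section \<open>The Volterra equation\<close>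

lemma infsum_nat_Suc:
  fixes f :: "nat \<Rightarrow> 'a::banach"
  assumes "f summable_on UNIV"
  shows "infsum f UNIV = f 0 + (\<Sum>\<^sub>\<infinity>n. f (Suc n))" "(\<lambda>n. f (Suc n)) summable_on UNIV"
proof -
  have s: "f summable_on range Suc" by (rule summable_on_subset_banach[OF assms]) simp
  show "(\<lambda>n. f (Suc n)) summable_on UNIV"
    using s summable_on_reindex[of Suc UNIV f] by (simp add: o_def)
  have "infsum f UNIV = infsum f (insert 0 (range Suc))" by (rule arg_cong[OF UNIV_nat_eq])
  also have "\<dots> = f 0 + infsum f (range Suc)" by (rule infsum_insert[OF s]) auto
  also have "infsum f (range Suc) = (\<Sum>\<^sub>\<infinity>n. f (Suc n))"
    by (subst infsum_reindex) (auto simp: o_def)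
  finally show "infsum f UNIV = f 0 + (\<Sum>\<^sub>\<infinity>n. f (Suc n))" .
qed

text \<open>With \<open>z = exp (- \<i> \<theta>)\<close> the kernel \<open>D(- l, \<theta>)\<close> of the Volterra equation is the polynomial
  \<open>dker l z\<close>; \<open>mu\<close> are the iterates of that equation and \<open>mplus\<close> is its solution \<open>m\<^sub>+\<close>.\<close>
definition dker :: "nat \<Rightarrow> complex \<Rightarrow> complex" where
  "dker l z = (\<Sum>j<l. z ^ (2 * j + 1))"

lemma dker_simps: "dker 0 z = 0" "dker (Suc l) z = z + z\<^sup>2 * dker l z"
  by (simp_all add: dker_def sum.lessThan_Suc_shift sum_distrib_left power2_eq_square mult_ac del: sum.lessThan_Suc)

text \<open>The polynomial has l terms of degree below 2l, so its norm grows like l^(\<sigma> + 1):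
  this is the source of the moment of order \<sigma> + 1 of \<open>q\<close>.\<close>

lemma dker_wa: "pw.wa \<sigma> (dker l) (2 ^ \<sigma> * real l ^ (\<sigma> + 1))"
proof -
  have "pw.wa \<sigma> (\<lambda>z. \<Sum>j<l. 1 * z ^ (2 * j + 1)) (\<Sum>j<l. pw_wt \<sigma> (2 * j + 1) * norm (1::complex))"
    by (intro pw.wa_sum pw.wa_char finite_lessThan)
  moreover have "(\<Sum>j<l. pw_wt \<sigma> (2 * j + 1) * norm (1::complex)) \<le> (\<Sum>j<l. (2 * real l) ^ \<sigma>)"
    unfolding pw_wt_def by (intro sum_mono) (simp only: norm_one mult_1_right, intro power_mono, auto)
  moreover have "(\<Sum>j<l. (2 * real l) ^ \<sigma>) = 2 ^ \<sigma> * real l ^ (\<sigma> + 1)"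
    by (simp add: power_mult_distrib)
  ultimately show ?thesis by (auto simp: dker_def[abs_def] intro: pw.wa_mono)
qed

primrec mu :: "(int \<Rightarrow> real) \<Rightarrow> nat \<Rightarrow> int \<Rightarrow> complex \<Rightarrow> complex" where
  "mu q 0 n z = 1"
| "mu q (Suc k) n z = (\<Sum>\<^sub>\<infinity>l. dker l z * complex_of_real (q (n + int l)) * mu q k (n + int l) z)"

definition mplus :: "(int \<Rightarrow> real) \<Rightarrow> int \<Rightarrow> complex \<Rightarrow> complex" where
  "mplus q n z = (\<Sum>\<^sub>\<infinity>k. mu q k n z)"

lemma mu_cnj: "mu q k n (cnj z) = cnj (mu q k n z)"
proof (induction k arbitrary: n)
  case (Suc k)
  have "dker l (cnj z) = cnj (dker l z)" for l by (simp add: dker_def)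
  then show ?case by (simp add: Suc flip: infsum_cnj)
qed simp

lemma mplus_cnj: "mplus q n (cnj z) = cnj (mplus q n z)"
  by (simp add: mplus_def mu_cnj flip: infsum_cnj)

text \<open>All Volterra kernels vanish at z = 0, the point of infinite energy, so the series stops
  at its constant term.\<close>

lemma mplus_0: "mplus q n 0 = 1"
proof -
  have "dker l 0 = 0" for l by (simp add: dker_def)
  then have "mu q (Suc k) n 0 = 0" for k by simp
  then have "((\<lambda>k. mu q k n 0) has_sum 1) UNIV"
    by (intro has_sum_finite_neutralI[of "{0}"]) (auto simp: gr0_conv_Suc simp del: mu.simps(2))
  then show ?thesis by (simp add: mplus_def has_sum_iff)
qed

text \<open>\<sigma> = 0 corresponds to q in l^{1,1} and \<sigma> = 1 to l^{1,2}. Of the \<sigma> +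
  1 moments one is used up by the Volterra kernel; the rest survives as the weight of the Jost
  functions.\<close>

locale jost =
  fixes q :: "int \<Rightarrow> real" and \<sigma> :: nat
  assumes q_sum: "(\<lambda>n. (1 + real_of_int \<bar>n\<bar>) ^ (\<sigma> + 1) * \<bar>q n\<bar>) summable_on UNIV"
begin

text \<open>A bound for the norm of the Volterra coefficient that links any site between n0 and n0 +
  i to n0 + i: the distance is replaced by the one from the base point \<open>n0\<close>, so the
  nearer site drops out.\<close>

definition aw :: "int \<Rightarrow> nat \<Rightarrow> real" where
  "aw n0 i = 2 ^ \<sigma> * real i ^ (\<sigma> + 1) * \<bar>q (n0 + int i)\<bar>"

lemma aw_nonneg: "0 \<le> aw n0 i" by (simp add: aw_def)

lemma aw_summable: "summable (aw n0)"
proof -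
  have "inj (\<lambda>i. n0 + int i)" by (auto intro: injI)
  then have "(\<lambda>i. (1 + real_of_int \<bar>n0 + int i\<bar>) ^ (\<sigma> + 1) * \<bar>q (n0 + int i)\<bar>) summable_on UNIV"
    using summable_on_reindex[of "\<lambda>i. n0 + int i" UNIV "\<lambda>n. (1 + real_of_int \<bar>n\<bar>) ^ (\<sigma> + 1) * \<bar>q n\<bar>"]
      summable_on_subset[OF q_sum, of "range (\<lambda>i. n0 + int i)"] by (simp add: o_def)
  then have s: "(\<lambda>i. 2 ^ \<sigma> * (1 + real_of_int \<bar>n0\<bar>) ^ (\<sigma> + 1) * ((1 + real_of_int \<bar>n0 + int i\<bar>) ^ (\<sigma> + 1) * \<bar>q (n0 + int i)\<bar>)) summable_on UNIV"
    by (rule summable_on_cmult_right)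
  have "aw n0 summable_on UNIV"
  proof (rule summable_on_comparison_test[OF s])
    fix i
    have "real i \<le> (1 + real_of_int \<bar>n0\<bar>) * (1 + real_of_int \<bar>n0 + int i\<bar>)"
    proof -
      have "real i \<le> real_of_int \<bar>n0\<bar> + real_of_int \<bar>n0 + int i\<bar>" by linarith
      moreover have "0 \<le> real_of_int \<bar>n0\<bar> * real_of_int \<bar>n0 + int i\<bar>" by (intro mult_nonneg_nonneg) auto
      ultimately show ?thesis unfolding distrib_left distrib_right mult_1 mult_1_right by linarith
    qed
    then have "real i ^ (\<sigma> + 1) \<le> (1 + real_of_int \<bar>n0\<bar>) ^ (\<sigma> + 1) * (1 + real_of_int \<bar>n0 + int i\<bar>) ^ (\<sigma> + 1)"
      unfolding power_mult_distrib[symmetric] by (intro power_mono) auto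
    then have "real i ^ (\<sigma> + 1) * (2 ^ \<sigma> * \<bar>q (n0 + int i)\<bar>) \<le> (1 + real_of_int \<bar>n0\<bar>) ^ (\<sigma> + 1) * (1 + real_of_int \<bar>n0 + int i\<bar>) ^ (\<sigma> + 1) * (2 ^ \<sigma> * \<bar>q (n0 + int i)\<bar>)"
      by (intro mult_right_mono) auto
    then show "aw n0 i \<le> 2 ^ \<sigma> * (1 + real_of_int \<bar>n0\<bar>) ^ (\<sigma> + 1) * ((1 + real_of_int \<bar>n0 + int i\<bar>) ^ (\<sigma> + 1) * \<bar>q (n0 + int i)\<bar>)"
      unfolding aw_def by (simp only: mult_ac)
  qed (rule aw_nonneg)
  then show ?thesis by (rule summable_on_imp_summable)
qed

lemma q_shift_summable: "(\<lambda>l. \<bar>q (n + int l)\<bar>) summable_on UNIV"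
proof -
  have "summable (\<lambda>l. \<bar>q (n + int (Suc l))\<bar>)"
  proof (rule summable_comparison_test')
    show "summable (\<lambda>l. aw n (Suc l))" using aw_summable by (rule summable_Suc_iff[THEN iffD2])
    fix l
    have "1 * \<bar>q (n + int (Suc l))\<bar> \<le> (2 ^ \<sigma> * real (Suc l) ^ (\<sigma> + 1)) * \<bar>q (n + int (Suc l))\<bar>"
    proof (rule mult_right_mono)
      have "1 * 1 \<le> (2::real) ^ \<sigma> * real (Suc l) ^ (\<sigma> + 1)"
        by (intro mult_mono one_le_power) auto
      then show "1 \<le> (2::real) ^ \<sigma> * real (Suc l) ^ (\<sigma> + 1)" by simp
    qed simp
    then show "norm \<bar>q (n + int (Suc l))\<bar> \<le> aw n (Suc l)" by (simp add: aw_def)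
  qed
  then have "summable (\<lambda>l. \<bar>q (n + int l)\<bar>)"
    by (subst summable_Suc_iff[symmetric])
  then show ?thesis by (subst summable_on_UNIV_nonneg_real_iff) auto
qed

definition tail :: "int \<Rightarrow> nat \<Rightarrow> real" where "tail n0 j = (\<Sum>i. aw n0 (i + Suc j))"

text \<open>A weight for which one Volterra step is a contraction by one half.\<close>
definition gw :: "int \<Rightarrow> nat \<Rightarrow> real" where "gw n0 j = exp (2 * tail n0 j)"

lemma tail_eq: "tail n0 j = aw n0 (Suc j) + tail n0 (Suc j)"
  using suminf_split_head[of "\<lambda>i. aw n0 (i + Suc j)"] aw_summable summable_ignore_initial_segment[of "aw n0" "Suc j"]
  by (simp add: tail_def)

lemma tail_nonneg: "0 \<le> tail n0 j"
  unfolding tail_def by (intro suminf_nonneg summable_ignore_initial_segment aw_summable aw_nonneg)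

lemma tail_tendsto: "tail n0 \<longlonglongrightarrow> 0"
proof -
  have "tail n0 = (\<lambda>j. suminf (aw n0) - sum (aw n0) {..<Suc j})"
    unfolding tail_def by (rule ext) (rule suminf_minus_initial_segment[OF aw_summable])
  moreover have "(\<lambda>j. suminf (aw n0) - sum (aw n0) {..<Suc j}) \<longlonglongrightarrow> suminf (aw n0) - suminf (aw n0)"
    by (intro tendsto_diff tendsto_const LIMSEQ_Suc summable_LIMSEQ aw_summable)
  ultimately show ?thesis by (simp only: diff_self)
qed

lemma gw_ge_1: "1 \<le> gw n0 j" using tail_nonneg by (simp add: gw_def)

lemma gw_antimono: "gw n0 (j + i) \<le> gw n0 j"
proof (induction i)
  case (Suc i)
  have "gw n0 (Suc (j + i)) \<le> gw n0 (j + i)"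
    using tail_eq[of n0 "j + i"] aw_nonneg[of n0 "Suc (j+i)"] by (simp add: gw_def)
  with Suc show ?case by simp
qed simp

text \<open>A discrete Gronwall inequality, from exp x \<ge> 1 + x. Its right-hand side telescopes,
  so the sum of \<open>aw\<close> times \<open>gw\<close> over all later sites is at most half of
  \<open>gw n0 j\<close>.\<close>

lemma gw_step: "2 * (aw n0 (Suc j) * gw n0 (Suc j)) \<le> gw n0 j - gw n0 (Suc j)"
proof -
  have "gw n0 j = exp (2 * aw n0 (Suc j)) * gw n0 (Suc j)"
    by (simp add: gw_def tail_eq[of n0 j] exp_add[symmetric])
  moreover have "1 + 2 * aw n0 (Suc j) \<le> exp (2 * aw n0 (Suc j))" by (rule exp_ge_add_one_self)
  ultimately show ?thesis
    using mult_right_mono[of "1 + 2 * aw n0 (Suc j)" "exp (2 * aw n0 (Suc j))" "gw n0 (Suc j)"] gw_ge_1[of n0 "Suc j"]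
    by (simp add: algebra_simps)
qed

text \<open>The value 0 at l = 0 reflects that \<open>dker 0\<close> vanishes; it matches
  \<open>tail n0 j\<close>, which starts at index j + 1.\<close>

definition gt :: "int \<Rightarrow> nat \<Rightarrow> nat \<Rightarrow> real" where
  "gt n0 j l = (if l = 0 then 0 else aw n0 (j + l) * gw n0 (j + l))"

lemma gt_nonneg: "0 \<le> gt n0 j l"
  using aw_nonneg gw_ge_1[of n0 "j+l"] by (auto simp: gt_def)

lemma gt_summable: "gt n0 j summable_on UNIV" "infsum (gt n0 j) UNIV \<le> gw n0 j / 2"
proof -
  have p: "sum (gt n0 j) {..<l} \<le> gw n0 j / 2" for l
  proof -
    have "2 * sum (gt n0 j) {..<Suc l} \<le> gw n0 j - gw n0 (j + l)" for l
    proof (induction l)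
      case (Suc l)
      then show ?case using gw_step[of n0 "j + l"] by (simp add: gt_def)
    qed (simp add: gt_def)
    from this[of l] gw_ge_1[of n0 "j + l"] gt_nonneg[of n0 j l] show ?thesis by simp
  qed
  have s: "summable (gt n0 j)"
    by (rule summableI_nonneg_bounded[OF gt_nonneg p])
  have "((gt n0 j) has_sum suminf (gt n0 j)) UNIV"
    by (rule sums_nonneg_imp_has_sum) (use s gt_nonneg in auto)
  moreover have "suminf (gt n0 j) \<le> gw n0 j / 2" by (rule suminf_le_const[OF s p])
  ultimately show "gt n0 j summable_on UNIV" "infsum (gt n0 j) UNIV \<le> gw n0 j / 2"
    by (auto simp: has_sum_iff)
qed

lemma mu_term_wa:
  assumes "pw.wa \<sigma> (mu q k (n0 + int (j + l))) ((1/2) ^ k * gw n0 (j + l))"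
  shows "pw.wa \<sigma> (\<lambda>z. dker l z * complex_of_real (q (n0 + int j + int l)) * mu q k (n0 + int j + int l) z)
     ((1/2) ^ k * gt n0 j l)"
proof -
  have eq: "n0 + int j + int l = n0 + int (j + l)" by simp
  have "pw.wa \<sigma> (\<lambda>z. complex_of_real (q (n0 + int (j + l))) * (dker l z * mu q k (n0 + int (j + l)) z))
     (norm (complex_of_real (q (n0 + int (j + l)))) * (2 ^ \<sigma> * real l ^ (\<sigma> + 1) * ((1/2) ^ k * gw n0 (j + l))))"
    by (intro pw.wa_cmult pw.wa_mult dker_wa assms)
  then have "pw.wa \<sigma> (\<lambda>z. complex_of_real (q (n0 + int (j + l))) * (dker l z * mu q k (n0 + int (j + l)) z))
     ((1/2) ^ k * gt n0 j l)"
  proof (rule pw.wa_mono)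
    show "norm (complex_of_real (q (n0 + int (j + l)))) * (2 ^ \<sigma> * real l ^ (\<sigma> + 1) * ((1/2) ^ k * gw n0 (j + l))) \<le> (1/2) ^ k * gt n0 j l"
    proof (cases "l = 0")
      case False
      have "real l ^ (\<sigma> + 1) * (2 ^ \<sigma> * \<bar>q (n0 + int (j + l))\<bar> * ((1/2) ^ k * gw n0 (j + l)))
         \<le> real (j + l) ^ (\<sigma> + 1) * (2 ^ \<sigma> * \<bar>q (n0 + int (j + l))\<bar> * ((1/2) ^ k * gw n0 (j + l)))"
        using gw_ge_1[of n0 "j + l"] by (intro mult_right_mono power_mono mult_nonneg_nonneg) auto
      then show ?thesis using False by (simp only: gt_def aw_def if_False norm_of_real mult_ac)
    qed (simp add: gt_def)
  qed
  then show ?thesis unfolding eq by (rule pw.wa_cong) (simp only: mult_ac)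
qed

text \<open>\<open>gt\<close> bounds one Volterra step measured against the weight
  \<open>gw\<close>, and its sum is at most half that weight. Each iterate therefore gains a factor
  1/2, whatever the size of \<open>q\<close>.\<close>

lemma mu_wa: "pw.wa \<sigma> (mu q k (n0 + int j)) ((1/2) ^ k * gw n0 j)"
proof (induction k arbitrary: j)
  case 0
  show ?case
    by (rule pw.wa_mono[OF pw.wa_cong[OF pw.wa_const[of \<sigma> 1]]]) (use gw_ge_1 in auto)
next
  case (Suc k)
  show ?case unfolding mu.simps(2)
  proof (rule pw.wa_family[OF mu_term_wa[OF Suc]])
    show "(\<lambda>l. (1/2) ^ k * gt n0 j l) summable_on UNIV"
      by (rule summable_on_cmult_right[OF gt_summable(1)])
    have "(\<Sum>\<^sub>\<infinity>l. (1/2) ^ k * gt n0 j l) = (1/2) ^ k * infsum (gt n0 j) UNIV"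
      by (rule infsum_cmult_right')
    also have "\<dots> \<le> (1/2) ^ k * (gw n0 j / 2)" by (intro mult_left_mono gt_summable(2)) auto
    finally show "(\<Sum>\<^sub>\<infinity>l. (1/2) ^ k * gt n0 j l) \<le> (1/2) ^ Suc k * gw n0 j" by simp
  qed
qed

lemma half_has_sum: "((\<lambda>k. (1/2) ^ k * c) has_sum 2 * (c::real)) UNIV"
  using has_sum_cmult_left[OF real_geometric_has_sum[of "1/2"], of c] by simp

lemma mplus_wa: "pw.wa \<sigma> (mplus q (n0 + int j)) (2 * gw n0 j)"
  unfolding mplus_def[abs_def]
  by (rule pw.wa_family[OF mu_wa]) (use half_has_sum in \<open>auto simp: has_sum_iff\<close>)

text \<open>The weight decreases to the right, so its value at \<open>n0\<close> serves the whole
  half line.\<close>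

lemma mplus_wa_ge: "n \<ge> n0 \<Longrightarrow> pw.wa \<sigma> (mplus q n) (2 * gw n0 0)"
  using mplus_wa[of n0 "nat (n - n0)"] gw_antimono[of n0 0 "nat (n - n0)"] by (auto intro: pw.wa_mono)

lemma norm_mplus_le: "norm z \<le> 1 \<Longrightarrow> norm (mplus q (n + int l) z) \<le> 2 * gw n 0"
  using pw.wa_norm[OF mplus_wa_ge[of n "n + int l"], of z] by simp

lemma mplus_eq:
  assumes z: "norm z \<le> 1"
  shows "mplus q n z = 1 + (\<Sum>\<^sub>\<infinity>l. dker l z * complex_of_real (q (n + int l)) * mplus q (n + int l) z)"
proof -
  have z': "z \<in> cball 0 1" using z by simp
  have ms: "(\<lambda>k. mu q k n z) summable_on UNIV" for n
    by (rule infsum_dominated(1)[of "\<lambda>k. (1/2) ^ k * gw n 0"])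
      (use half_has_sum pw.wa_norm[OF mu_wa[of _ n 0] z'] in \<open>auto simp: has_sum_iff\<close>)
  let ?f = "\<lambda>k l. dker l z * complex_of_real (q (n + int l)) * mu q k (n + int l) z"
  have "mplus q n z = 1 + (\<Sum>\<^sub>\<infinity>k. \<Sum>\<^sub>\<infinity>l. ?f k l)"
    unfolding mplus_def using infsum_nat_Suc(1)[OF ms[of n]] by simp
  also have "(\<Sum>\<^sub>\<infinity>k. \<Sum>\<^sub>\<infinity>l. ?f k l) = (\<Sum>\<^sub>\<infinity>l. \<Sum>\<^sub>\<infinity>k. ?f k l)"
  proof (rule infsum_swap_dominated)
    show "(\<lambda>k. (1/2) ^ k * gw n 0) summable_on UNIV" using half_has_sum by (auto simp: has_sum_iff)
    fix k
    show "(\<lambda>l. (1/2) ^ k * gt n 0 l) summable_on UNIV"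
      by (rule summable_on_cmult_right[OF gt_summable(1)])
    have "(\<Sum>\<^sub>\<infinity>l. (1/2) ^ k * gt n 0 l) = (1/2) ^ k * infsum (gt n 0) UNIV"
      by (rule infsum_cmult_right')
    also have "\<dots> \<le> (1/2) ^ k * gw n 0"
      using gt_summable(2)[of n 0] gw_ge_1[of n 0] by (intro mult_left_mono) auto
    finally show "(\<Sum>\<^sub>\<infinity>l. (1/2) ^ k * gt n 0 l) \<le> (1/2) ^ k * gw n 0" .
    show "norm (?f k l) \<le> (1/2) ^ k * gt n 0 l" for l
      using pw.wa_norm[OF mu_term_wa[where k = k and ?n0.0 = n and j = 0 and l = l, OF mu_wa] z'] by simp
  qed
  also have "\<dots> = (\<Sum>\<^sub>\<infinity>l. dker l z * complex_of_real (q (n + int l)) * mplus q (n + int l) z)"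
    by (simp add: mplus_def infsum_cmult_right')
  finally show ?thesis .
qed

lemma norm_dker_le: assumes "norm z \<le> 1" shows "norm (dker l z) \<le> 2 ^ \<sigma> * real l ^ (\<sigma> + 1)"
  using pw.wa_norm[OF dker_wa[of \<sigma> l], of z] assms by simp

lemma S_summable:
  assumes z: "norm z \<le> 1"
  shows "(\<lambda>l. dker l z * complex_of_real (q (n + int l)) * mplus q (n + int l) z) summable_on UNIV"
    "(\<lambda>l. complex_of_real (q (n + int l)) * mplus q (n + int l) z) summable_on UNIV"
proof -
  have "aw n summable_on UNIV"
    using aw_summable aw_nonneg by (subst summable_on_UNIV_nonneg_real_iff) auto
  then have s: "(\<lambda>l. aw n l * (2 * gw n 0)) summable_on UNIV" by (rule summable_on_cmult_left)
  show "(\<lambda>l. dker l z * complex_of_real (q (n + int l)) * mplus q (n + int l) z) summable_on UNIV"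
  proof (rule infsum_dominated(1)[OF s])
    fix l
    show "norm (dker l z * complex_of_real (q (n + int l)) * mplus q (n + int l) z) \<le> aw n l * (2 * gw n 0)"
      unfolding norm_mult aw_def norm_of_real
      by (intro mult_mono norm_dker_le norm_mplus_le z) auto
  qed
  have s: "(\<lambda>l. \<bar>q (n + int l)\<bar> * (2 * gw n 0)) summable_on UNIV"
    by (rule summable_on_cmult_left[OF q_shift_summable])
  show "(\<lambda>l. complex_of_real (q (n + int l)) * mplus q (n + int l) z) summable_on UNIV"
  proof (rule infsum_dominated(1)[OF s])
    fix l
    show "norm (complex_of_real (q (n + int l)) * mplus q (n + int l) z) \<le> \<bar>q (n + int l)\<bar> * (2 * gw n 0)"
      unfolding norm_mult norm_of_real by (intro mult_mono norm_mplus_le z) auto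
  qed
qed

text \<open>The kernel satisfies \<open>dker (Suc l) z = z + z\<^sup>2 * dker l z\<close>, hence the
  Volterra sum \<open>S\<close> fulfils S(n) = z A(n + 1) + z^2 S(n + 1), with \<open>A\<close> the
  plain tail sum; differencing once more reduces \<open>A\<close> to a single term and leaves the
  equation of H. In this polynomial form it includes z = 0, 1 and -1.\<close>

lemma mplus_rec:
  assumes z: "norm z \<le> 1"
  shows "mplus q (n - 1) z + z\<^sup>2 * mplus q (n + 1) z = (1 + z\<^sup>2 + z * complex_of_real (q n)) * mplus q n z"
proof -
  define A where "A n = (\<Sum>\<^sub>\<infinity>l. complex_of_real (q (n + int l)) * mplus q (n + int l) z)" for n
  define S where "S n = (\<Sum>\<^sub>\<infinity>l. dker l z * complex_of_real (q (n + int l)) * mplus q (n + int l) z)" for n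
  have A: "A n = complex_of_real (q n) * mplus q n z + A (n + 1)" for n
    unfolding A_def using infsum_nat_Suc(1)[OF S_summable(2)[OF z, of n]] by (simp add: algebra_simps)
  have S: "S n = z * A (n + 1) + z\<^sup>2 * S (n + 1)" for n
  proof -
    let ?m = "\<lambda>l. complex_of_real (q (n + 1 + int l)) * mplus q (n + 1 + int l) z"
    have "S n = (\<Sum>\<^sub>\<infinity>l. dker (Suc l) z * ?m l)"
      unfolding S_def using infsum_nat_Suc(1)[OF S_summable(1)[OF z, of n]]
      by (simp add: dker_simps algebra_simps)
    also have "\<dots> = (\<Sum>\<^sub>\<infinity>l. z * ?m l + z\<^sup>2 * (dker l z * ?m l))"
      by (simp add: dker_simps algebra_simps)
    also have "\<dots> = (\<Sum>\<^sub>\<infinity>l. z * ?m l) + (\<Sum>\<^sub>\<infinity>l. z\<^sup>2 * (dker l z * ?m l))"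
      using S_summable[OF z, of "n + 1"]
      by (intro infsum_add summable_on_cmult_right) (auto simp: mult.assoc)
    also have "\<dots> = z * A (n + 1) + z\<^sup>2 * S (n + 1)"
      by (simp add: infsum_cmult_right' A_def S_def mult.assoc)
    finally show ?thesis .
  qed
  have m: "mplus q n z = 1 + S n" for n unfolding S_def by (rule mplus_eq[OF z])
  have "(S (n - 1) - z\<^sup>2 * S n) - (S n - z\<^sup>2 * S (n + 1)) = z * complex_of_real (q n) * mplus q n z"
    using S[of "n - 1"] S[of n] A[of n] by (simp add: algebra_simps)
  moreover have "S k = mplus q k z - 1" for k using m[of k] by simp
  ultimately show ?thesis by (simp add: algebra_simps)
qed

lemma norm_mplus_minus_1_le:
  assumes z: "norm z \<le> 1"
  shows "norm (mplus q (n0 + int j) z - 1) \<le> 2 * gw n0 0 * (aw n0 j + tail n0 j)"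
proof -
  have "summable (\<lambda>l. aw n0 (l + j))" by (rule summable_ignore_initial_segment[OF aw_summable])
  then have s0: "((\<lambda>l. aw n0 (l + j)) has_sum (\<Sum>l. aw n0 (l + j))) UNIV"
    by (intro sums_nonneg_imp_has_sum aw_nonneg) auto
  \<comment> \<open>The sum starts at index j itself, one before the first index of
    \<open>tail\<close>.\<close>
  have t: "(\<Sum>l. aw n0 (l + j)) = aw n0 j + tail n0 j"
    using suminf_split_head[of "\<lambda>i. aw n0 (i + j)"] \<open>summable (\<lambda>l. aw n0 (l + j))\<close> by (simp add: tail_def)
  have s: "((\<lambda>l. aw n0 (l + j) * (2 * gw n0 0)) has_sum (aw n0 j + tail n0 j) * (2 * gw n0 0)) UNIV"
    using has_sum_cmult_left[OF s0, of "2 * gw n0 0"] t by simp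
  have "norm (\<Sum>\<^sub>\<infinity>l. dker l z * complex_of_real (q (n0 + int j + int l)) * mplus q (n0 + int j + int l) z) \<le> (\<Sum>\<^sub>\<infinity>l. aw n0 (l + j) * (2 * gw n0 0))"
  proof (rule infsum_dominated(2))
    show "(\<lambda>l. aw n0 (l + j) * (2 * gw n0 0)) summable_on UNIV" using s by (simp add: has_sum_iff)
    fix l
    have "norm (dker l z) \<le> 2 ^ \<sigma> * real (l + j) ^ (\<sigma> + 1)"
      by (rule order_trans[OF norm_dker_le[OF z]]) (intro mult_left_mono power_mono; simp)
    moreover have "norm (mplus q (n0 + int j + int l) z) \<le> 2 * gw n0 0"
      using norm_mplus_le[OF z, of n0 "j + l"] by (simp add: add.assoc)
    ultimately have "norm (dker l z) * \<bar>q (n0 + int j + int l)\<bar> * norm (mplus q (n0 + int j + int l) z) \<le> 2 ^ \<sigma> * real (l + j) ^ (\<sigma> + 1) * \<bar>q (n0 + int j + int l)\<bar> * (2 * gw n0 0)"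
      by (intro mult_mono) auto
    then show "norm (dker l z * complex_of_real (q (n0 + int j + int l)) * mplus q (n0 + int j + int l) z) \<le> aw n0 (l + j) * (2 * gw n0 0)"
      by (simp add: norm_mult aw_def add_ac)
  qed
  then show ?thesis using s mplus_eq[OF z, of "n0 + int j"] by (simp add: has_sum_iff mult_ac)
qed

lemma mplus_tendsto:
  assumes "norm z \<le> 1" shows "(\<lambda>j. mplus q (int j) z) \<longlonglongrightarrow> 1"
proof -
  have lim: "(\<lambda>j. 2 * gw 0 0 * (aw 0 j + tail 0 j)) \<longlonglongrightarrow> 2 * gw 0 0 * (0 + 0)"
    by (intro tendsto_intros tail_tendsto summable_LIMSEQ_zero aw_summable)
  have "(\<lambda>j. mplus q (int j) z - 1) \<longlonglongrightarrow> 0"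
  proof (rule Lim_null_comparison)
    show "\<forall>\<^sub>F j in sequentially. norm (mplus q (int j) z - 1) \<le> 2 * gw 0 0 * (aw 0 j + tail 0 j)"
      using norm_mplus_minus_1_le[OF assms, of 0] by simp
    show "(\<lambda>j. 2 * gw 0 0 * (aw 0 j + tail 0 j)) \<longlonglongrightarrow> 0" using lim by simp
  qed
  then show ?thesis by (simp add: LIM_zero_iff)
qed

end

section \<open>Jost solutions and Wronskians\<close>

definition is_sol :: "(int \<Rightarrow> real) \<Rightarrow> complex \<Rightarrow> (int \<Rightarrow> complex) \<Rightarrow> bool" where
  "is_sol q z u \<longleftrightarrow> (\<forall>n. u (n + 1) + u (n - 1) = (z + inverse z + complex_of_real (q n)) * u n)"

lemma is_sol_Hop: "is_sol q z u \<longleftrightarrow> (\<forall>n. Hop q u n = (2 - z - inverse z) * u n)"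
  unfolding is_sol_def Hop_def
  by (intro iff_allI) (auto simp: algebra_simps)

lemma is_sol_inverse: "is_sol q (inverse z) u \<longleftrightarrow> is_sol q z u"
  by (simp add: is_sol_def add.commute)

lemma is_sol_scale: "is_sol q z u \<Longrightarrow> is_sol q z (\<lambda>n. c * u n)"
  unfolding is_sol_def by (metis distrib_left mult.left_commute)

lemma is_sol_next: "is_sol q z u \<Longrightarrow> u (n + 1 + 1) = (z + inverse z + complex_of_real (q (n + 1))) * u (n + 1) - u n"
  unfolding is_sol_def by (metis add_diff_cancel_right')

lemma is_sol_prev: "is_sol q z u \<Longrightarrow> u (n - 1) = (z + inverse z + complex_of_real (q n)) * u n - u (n + 1)"
  unfolding is_sol_def by (metis add_diff_cancel_left')

lemma Im_inverse: "Im (inverse z) = - Im z / (norm z)\<^sup>2"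
  by (simp add: cmod_power2)

lemma is_sol_reflect: "is_sol q z u \<Longrightarrow> is_sol (\<lambda>n. q (- n)) z (\<lambda>n. u (- n))"
  unfolding is_sol_def
proof
  fix n assume "\<forall>n. u (n + 1) + u (n - 1) = (z + inverse z + complex_of_real (q n)) * u n"
  from this[rule_format, of "- n"]
  have "u (- n - 1) + u (- n + 1) = (z + inverse z + complex_of_real (q (- n))) * u (- n)"
    by (simp only: add.commute)
  moreover have "- (n + 1) = - n - 1" "- (n - 1) = - n + 1" by auto
  ultimately show "u (- (n + 1)) + u (- (n - 1)) = (z + inverse z + complex_of_real (q (- n))) * u (- n)"
    by (simp only:)
qed

lemma wronskian_const:
  assumes "is_sol q z u" "is_sol q z v" shows "wronskian u v n = wronskian u v 0"
proof -
  have step: "wronskian u v n = wronskian u v (n - 1)" for n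
  proof -
    have "u (n + 1) + u (n - 1) = (z + inverse z + complex_of_real (q n)) * u n"
      "v (n + 1) + v (n - 1) = (z + inverse z + complex_of_real (q n)) * v n"
      using assms by (auto simp: is_sol_def)
    then have "(u (n + 1) + u (n - 1)) * v n = u n * (v (n + 1) + v (n - 1))" by simp
    then show ?thesis by (simp add: wronskian_def algebra_simps)
  qed
  show ?thesis
  proof (induction n rule: int_induct[of _ 0])
    case (step1 i) then show ?case using step[of "i + 1"] by simp
  next
    case (step2 i) then show ?case using step[of i] by simp
  qed simp
qed

lemma wronskian_reflect: "wronskian (\<lambda>n. u (- n)) (\<lambda>n. v (- n)) n = - wronskian u v (- n - 1)"
  by (simp add: wronskian_def)

lemma is_sol_unique:
  assumes u: "is_sol q z u" and v: "is_sol q z v" and "u 0 = v 0" "u 1 = v 1"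
  shows "u = v"
proof -
  have "u n = v n \<and> u (n + 1) = v (n + 1)" for n
  proof (induction n rule: int_induct[of _ 0])
    case (step1 i)
    then show ?case by (simp only: is_sol_next[OF u] is_sol_next[OF v])
  next
    case (step2 i)
    then show ?case by (simp add: is_sol_prev[OF u] is_sol_prev[OF v])
  qed (use assms in auto)
  then show ?thesis by auto
qed

lemma wronskian_0_multiple:
  assumes u: "is_sol q z u" and v: "is_sol q z v" and W: "wronskian u v 0 = 0" and "u n0 \<noteq> 0"
  shows "\<exists>c. v = (\<lambda>n. c * u n)"
proof -
  have 0: "is_sol q z (\<lambda>n. 0)" by (simp add: is_sol_def)
  have nz: "u 0 \<noteq> 0 \<or> u 1 \<noteq> 0"
    using is_sol_unique[OF u 0] assms(4) by metis
  have W': "u 1 * v 0 = u 0 * v 1" using W by (simp add: wronskian_def)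
  show ?thesis
  proof (cases "u 0 = 0")
    case False
    have "v = (\<lambda>n. v 0 / u 0 * u n)"
      by (rule is_sol_unique[OF v is_sol_scale[OF u]]) (use False W' in \<open>auto simp: field_simps\<close>)
    then show ?thesis by blast
  next
    case True
    have "v = (\<lambda>n. v 1 / u 1 * u n)"
      by (rule is_sol_unique[OF v is_sol_scale[OF u]]) (use True nz W' in auto)
    then show ?thesis by blast
  qed
qed

text \<open>\<open>fp\<close> and \<open>fm\<close> are the Jost solutions; the left one comes from the right one of the reflected
  potential.\<close>
definition fp :: "(int \<Rightarrow> real) \<Rightarrow> complex \<Rightarrow> int \<Rightarrow> complex" where
  "fp q z n = z powi n * mplus q n z"

definition mminus :: "(int \<Rightarrow> real) \<Rightarrow> int \<Rightarrow> complex \<Rightarrow> complex" where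
  "mminus q n z = mplus (\<lambda>n. q (- n)) (- n) z"

definition fm :: "(int \<Rightarrow> real) \<Rightarrow> complex \<Rightarrow> int \<Rightarrow> complex" where
  "fm q z n = fp (\<lambda>n. q (- n)) z (- n)"

lemma fm_eq: "fm q z n = z powi (- n) * mminus q n z"
  by (simp add: fm_def fp_def mminus_def)

lemma fp_cnj: "fp q (cnj z) n = cnj (fp q z n)"
  by (simp add: fp_def mplus_cnj)

lemma fm_cnj: "fm q (cnj z) n = cnj (fm q z n)"
  by (simp add: fm_def fp_cnj)

text \<open>Up to the factor \<open>z\<close>, which makes sense of the value at \<open>z = 0\<close> (infinite energy), \<open>ww\<close> is the
  Wronskian \<open>W(\<theta>)\<close>, and \<open>nn\<close> is the Wronskian of \<open>f\<^sub>+(-\<theta>)\<close> and \<open>f\<^sub>-(\<theta>)\<close>.\<close>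
definition ww :: "(int \<Rightarrow> real) \<Rightarrow> complex \<Rightarrow> complex" where
  "ww q z = z\<^sup>2 * mplus q 1 z * mminus q 0 z - mplus q 0 z * mminus q 1 z"

definition nn :: "(int \<Rightarrow> real) \<Rightarrow> complex \<Rightarrow> complex" where
  "nn q z = mplus q 1 (inverse z) * mminus q 0 z - mplus q 0 (inverse z) * mminus q 1 z"

text \<open>The value at infinite energy keeps the origin off the zero set and later becomes the
  identity part of the kernel.\<close>

lemma ww_0: "ww q 0 = - 1"
  by (simp add: ww_def mminus_def mplus_0)

lemma ww_wronskian: "z \<noteq> 0 \<Longrightarrow> ww q z = z * wronskian (fp q z) (fm q z) 0"
  by (simp add: ww_def wronskian_def fm_eq fp_def power_int_minus power2_eq_square field_simps)

lemma nn_wronskian: "z \<noteq> 0 \<Longrightarrow> nn q z = z * wronskian (fp q (inverse z)) (fm q z) 0"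
  by (simp add: nn_def wronskian_def fm_eq fp_def power_int_minus field_simps)

text \<open>Summation by parts with one factor in l^1 and the other merely bounded, so that the
  second factor may be a kernel on the circle, which does not decay.\<close>

lemma Hop_symmetric:
  assumes u: "(\<lambda>n. norm (u n)) summable_on (UNIV :: int set)" and v: "\<And>n. norm (v n) \<le> B"
    and q: "\<And>n. \<bar>q n\<bar> \<le> Q"
  shows "(\<Sum>\<^sub>\<infinity>n. v n * Hop q u n) = (\<Sum>\<^sub>\<infinity>n. Hop q v n * u n)"
    "(\<lambda>n. v n * Hop q u n) summable_on UNIV" "(\<lambda>n. v n * u n) summable_on UNIV"
proof -
  have B: "0 \<le> B" using v[of 0] norm_ge_zero order_trans by blast
  have Q: "0 \<le> Q" using q[of 0] by (meson abs_ge_zero order_trans)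
  have bij: "bij (\<lambda>n::int. n + k)" for k by (rule bij_betwI[of _ _ _ "\<lambda>n. n - k"]) auto
  have s: "(\<lambda>n. w n * u (n + k)) summable_on UNIV" if w: "\<And>n. norm (w n) \<le> C" for w C k
  proof -
    have "0 \<le> C" using w[of 0] norm_ge_zero order_trans by blast
    have "(\<lambda>n. norm (u (n + k))) summable_on UNIV"
      using summable_on_reindex_bij_betw[OF bij, of "\<lambda>n. norm (u n)" k] u by simp
    then have "(\<lambda>n. C * norm (u (n + k))) summable_on UNIV" by (rule summable_on_cmult_right)
    then show ?thesis
      by (rule infsum_dominated(1)) (auto simp: norm_mult w intro: mult_right_mono)
  qed
  have shift: "(\<Sum>\<^sub>\<infinity>n. v n * u (n + k)) = (\<Sum>\<^sub>\<infinity>n. v (n - k) * u n)" for k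
    using infsum_reindex_bij_betw[OF bij, of "\<lambda>n. v (n - k) * u n" k] by simp
  let ?c = "\<lambda>n. 2 + complex_of_real (q n)"
  have cb: "norm (?c n * v n) \<le> (2 + Q) * B" for n
    unfolding norm_mult
    by (intro mult_mono v order_trans[OF norm_triangle_ineq]) (use q Q in auto)
  show s0: "(\<lambda>n. v n * u n) summable_on UNIV" using s[where w = v and C = B and k = 0, OF v] by simp
  have s1: "(\<lambda>n. v n * u (n + 1)) summable_on UNIV" "(\<lambda>n. v n * u (n - 1)) summable_on UNIV"
    "(\<lambda>n. ?c n * v n * u n) summable_on UNIV"
    using s[where w = v and C = B and k = 1, OF v] s[where w = v and C = B and k = "-1", OF v]
      s[where w = "\<lambda>n. ?c n * v n" and C = "(2 + Q) * B" and k = 0, OF cb] by auto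
  have s2: "(\<lambda>n. v (n - 1) * u n) summable_on UNIV" "(\<lambda>n. v (n + 1) * u n) summable_on UNIV"
    using s[where w = "\<lambda>n. v (n - 1)" and C = B and k = 0, OF v]
      s[where w = "\<lambda>n. v (n + 1)" and C = B and k = 0, OF v] by auto
  have e1: "v n * Hop q u n = ?c n * v n * u n - (v n * u (n + 1) + v n * u (n - 1))" for n
    by (simp add: Hop_def algebra_simps)
  have e2: "Hop q v n * u n = ?c n * v n * u n - (v (n - 1) * u n + v (n + 1) * u n)" for n
    by (simp add: Hop_def algebra_simps)
  have h1: "((\<lambda>n. v n * Hop q u n) has_sum
     ((\<Sum>\<^sub>\<infinity>n. ?c n * v n * u n) - ((\<Sum>\<^sub>\<infinity>n. v n * u (n + 1)) + (\<Sum>\<^sub>\<infinity>n. v n * u (n - 1))))) UNIV"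
    unfolding e1 diff_conv_add_uminus
    by (intro has_sum_add has_sum_uminusI has_sum_infsum s1(1,3) s1(2)[unfolded diff_conv_add_uminus])
  have h2: "((\<lambda>n. Hop q v n * u n) has_sum
     ((\<Sum>\<^sub>\<infinity>n. ?c n * v n * u n) - ((\<Sum>\<^sub>\<infinity>n. v (n - 1) * u n) + (\<Sum>\<^sub>\<infinity>n. v (n + 1) * u n)))) UNIV"
    unfolding e2 diff_conv_add_uminus
    by (intro has_sum_add has_sum_uminusI has_sum_infsum s1(3) s2[unfolded diff_conv_add_uminus])
  show "(\<lambda>n. v n * Hop q u n) summable_on UNIV" using h1 by (simp add: has_sum_iff)
  show "(\<Sum>\<^sub>\<infinity>n. v n * Hop q u n) = (\<Sum>\<^sub>\<infinity>n. Hop q v n * u n)"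
    using h1 h2 shift[of 1] shift[of "-1"] by (simp add: has_sum_iff)
qed

lemma summable_on_int_geometric:
  fixes u :: "int \<Rightarrow> complex"
  assumes r: "0 \<le> r" "r < 1"
    and 1: "\<And>j. norm (u (m + int j)) \<le> A * r ^ j" and 2: "\<And>j. norm (u (m - int j)) \<le> B * r ^ j"
  shows "(\<lambda>n. norm (u n)) summable_on (UNIV :: int set)"
proof -
  have g: "(\<lambda>j. C * r ^ j) summable_on UNIV" for C
    using real_geometric_has_sum[OF r] by (intro summable_on_cmult_right) (auto simp: has_sum_iff)
  have "(\<lambda>j. norm (u (m + int j))) summable_on UNIV"
    by (rule infsum_dominated(3)[OF g[of A]]) (rule 1)
  moreover have "(\<lambda>j. norm (u (m - int j))) summable_on UNIV"
    by (rule infsum_dominated(3)[OF g[of B]]) (rule 2)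
  ultimately have s: "(\<lambda>n. norm (u n)) summable_on range (\<lambda>j. m + int j)"
    "(\<lambda>n. norm (u n)) summable_on range (\<lambda>j. m - int j)"
    using summable_on_reindex[of "\<lambda>j. m + int j" UNIV "\<lambda>n. norm (u n)"]
      summable_on_reindex[of "\<lambda>j. m - int j" UNIV "\<lambda>n. norm (u n)"]
    by (auto simp: o_def inj_def)
  have "n \<in> range (\<lambda>j. m + int j) \<union> range (\<lambda>j. m - int j)" for n
  proof (cases "n \<ge> m")
    case True
    then have "n = m + int (nat (n - m))" by simp
    then show ?thesis by blast
  next
    case False
    then have "n = m - int (nat (m - n))" by simp
    then show ?thesis by blast
  qed
  then have "UNIV = range (\<lambda>j. m + int j) \<union> range (\<lambda>j. m - int j)" by blast
  then show ?thesis using summable_on_union[OF s] by simp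
qed

section \<open>Jost solutions: Wronskians, Green function and zeros in the disc\<close>

context jost
begin

lemma jost_reflect: "jost (\<lambda>n. q (- n)) \<sigma>"
proof
  have "bij (uminus :: int \<Rightarrow> int)" by (rule bij_uminus)
  from summable_on_reindex_bij_betw[OF this, of "\<lambda>n. (1 + real_of_int \<bar>n\<bar>) ^ (\<sigma> + 1) * \<bar>q n\<bar>"]
  show "(\<lambda>n. (1 + real_of_int \<bar>n\<bar>) ^ (\<sigma> + 1) * \<bar>q (- n)\<bar>) summable_on UNIV"
    using q_sum by simp
qed

lemma jost_0: "jost q 0"
proof
  show "(\<lambda>n. (1 + real_of_int \<bar>n\<bar>) ^ (0 + 1) * \<bar>q n\<bar>) summable_on UNIV"
  proof (rule summable_on_comparison_test[OF q_sum])
    fix n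
    have "(1 + real_of_int \<bar>n\<bar>) ^ (0 + 1) \<le> (1 + real_of_int \<bar>n\<bar>) ^ (\<sigma> + 1)"
      by (rule power_increasing) auto
    then show "(1 + real_of_int \<bar>n\<bar>) ^ (0 + 1) * \<bar>q n\<bar> \<le> (1 + real_of_int \<bar>n\<bar>) ^ (\<sigma> + 1) * \<bar>q n\<bar>"
      by (rule mult_right_mono) simp
  qed simp
qed

lemma q_bounded: "\<exists>Q. \<forall>n. \<bar>q n\<bar> \<le> Q"
proof -
  have "\<bar>q n\<bar> \<le> (\<Sum>\<^sub>\<infinity>n. (1 + real_of_int \<bar>n\<bar>) ^ (\<sigma> + 1) * \<bar>q n\<bar>)" for n
  proof -
    have "\<bar>q n\<bar> \<le> (1 + real_of_int \<bar>n\<bar>) ^ (\<sigma> + 1) * \<bar>q n\<bar>"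
      using mult_right_mono[OF one_le_power[of "1 + real_of_int \<bar>n\<bar>" "\<sigma> + 1"], of "\<bar>q n\<bar>"] by simp
    also have "\<dots> \<le> (\<Sum>\<^sub>\<infinity>n. (1 + real_of_int \<bar>n\<bar>) ^ (\<sigma> + 1) * \<bar>q n\<bar>)"
      using finite_sum_le_infsum[OF q_sum, of "{n}"] by simp
    finally show ?thesis .
  qed
  then show ?thesis by blast
qed

lemma mplus_wa_ex: "\<exists>C. \<forall>n\<ge>n0. pw.wa \<sigma> (mplus q n) C"
  using mplus_wa_ge by blast

lemma mminus_wa_ex: "\<exists>C. \<forall>n\<le>n0. pw.wa \<sigma> (mminus q n) C"
proof -
  obtain C where "\<forall>n\<ge>- n0. pw.wa \<sigma> (mplus (\<lambda>n. q (- n)) n) C"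
    using jost.mplus_wa_ex[OF jost_reflect] by blast
  then show ?thesis unfolding mminus_def[abs_def] by (intro exI[of _ C]) auto
qed

lemma fp_sol: assumes "z \<noteq> 0" "norm z \<le> 1" shows "is_sol q z (fp q z)"
  unfolding is_sol_def
proof
  fix n
  have *: "z powi (n + 1) = z\<^sup>2 * z powi (n - 1)" "z powi n = z * z powi (n - 1)"
    using assms(1) by (auto simp: power_int_add power_int_diff power2_eq_square)
  have "fp q z (n + 1) + fp q z (n - 1) = z powi (n - 1) * (mplus q (n - 1) z + z\<^sup>2 * mplus q (n + 1) z)"
    unfolding fp_def *(1) by (simp add: algebra_simps)
  also have "\<dots> = z powi (n - 1) * ((1 + z\<^sup>2 + z * complex_of_real (q n)) * mplus q n z)"
    by (simp only: mplus_rec[OF assms(2)])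
  also have "1 + z\<^sup>2 + z * complex_of_real (q n) = z * (z + inverse z + complex_of_real (q n))"
    using assms(1) by (simp add: algebra_simps power2_eq_square)
  finally show "fp q z (n + 1) + fp q z (n - 1) = (z + inverse z + complex_of_real (q n)) * fp q z n"
    unfolding fp_def *(2) by (simp only: mult_ac)
qed

lemma fm_sol: assumes "z \<noteq> 0" "norm z \<le> 1" shows "is_sol q z (fm q z)"
  using is_sol_reflect[OF jost.fp_sol[OF jost_reflect assms]] by (simp add: fm_def[abs_def])

lemma mminus_tendsto: "norm z \<le> 1 \<Longrightarrow> (\<lambda>j. mminus q (- int j) z) \<longlonglongrightarrow> 1"
  using jost.mplus_tendsto[OF jost_reflect, of z] by (simp add: mminus_def)

lemma fp_nonzero: assumes "z \<noteq> 0" "norm z \<le> 1" shows "\<exists>n. fp q z n \<noteq> 0"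
proof (rule ccontr)
  assume "\<nexists>n. fp q z n \<noteq> 0"
  then have "mplus q (int j) z = 0" for j using assms(1) by (auto simp: fp_def)
  then show False using mplus_tendsto[OF assms(2)] LIMSEQ_unique[OF tendsto_const[of 0]] by force
qed

lemma fm_nonzero: assumes "z \<noteq> 0" "norm z \<le> 1" shows "\<exists>n. fm q z n \<noteq> 0"
  using jost.fp_nonzero[OF jost_reflect assms] unfolding fm_def by (metis minus_minus)

text \<open>The Wronskian of two solutions is constant in \<open>n\<close>, so this one is computed
  in the limit to the right, where both m_+ tend to 1.\<close>

lemma fp_wronskian:
  assumes z: "norm z = 1"
  shows "wronskian (fp q z) (fp q (inverse z)) n = z - inverse z"
proof -
  have z0: "z \<noteq> 0" "norm z \<le> 1" "inverse z \<noteq> 0" "norm (inverse z) \<le> 1" using z by (auto simp: norm_inverse)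
  have s: "is_sol q z (fp q z)" "is_sol q z (fp q (inverse z))"
    using fp_sol[OF z0(1,2)] fp_sol[OF z0(3,4)] by (auto simp: is_sol_inverse)
  have eq: "wronskian (fp q z) (fp q (inverse z)) (int j) =
    z * mplus q (int (Suc j)) z * mplus q (int j) (inverse z) - inverse z * mplus q (int j) z * mplus q (int (Suc j)) (inverse z)" for j
    using z0(1) by (simp add: wronskian_def fp_def power_int_add power_int_minus field_simps)
  have "(\<lambda>j. wronskian (fp q z) (fp q (inverse z)) (int j)) \<longlonglongrightarrow> z * 1 * 1 - inverse z * 1 * 1"
    unfolding eq
    by (intro tendsto_intros LIMSEQ_Suc mplus_tendsto z0 LIMSEQ_Suc[where f = "\<lambda>j. mplus q (int j) _"])
  moreover have "(\<lambda>j. wronskian (fp q z) (fp q (inverse z)) (int j)) = (\<lambda>j. wronskian (fp q z) (fp q (inverse z)) 0)"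
    using wronskian_const[OF s] by auto
  ultimately show ?thesis
    using wronskian_const[OF s, of n] by (simp add: LIMSEQ_const_iff)
qed

lemma fm_wronskian:
  assumes z: "norm z = 1"
  shows "wronskian (fm q z) (fm q (inverse z)) n = inverse z - z"
  unfolding fm_def[abs_def] wronskian_reflect jost.fp_wronskian[OF jost_reflect assms] by simp

text \<open>Divided by |ww|^2 this is the unitarity of scattering, |T|^2 + |R|^2 = 1. It confines
  the zeros of \<open>ww\<close> on the circle to 1 and -1 and makes \<open>nn\<close> vanish
  wherever \<open>ww\<close> does.\<close>

lemma ww_nn_identity:
  assumes z: "norm z = 1"
  shows "(norm (ww q z))\<^sup>2 = (norm (nn q z))\<^sup>2 + (norm (1 - z\<^sup>2))\<^sup>2"
proof -
  have z0: "z \<noteq> 0" using z by auto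
  have cz: "cnj z = inverse z" using z by (metis inverse_unique complex_norm_square mult.commute of_real_1 one_power2)
  define a b c d where "a = fp q z 1" "b = fp q z 0" "c = fm q z 1" "d = fm q z 0"
  have ca: "fp q (inverse z) 1 = cnj a" "fp q (inverse z) 0 = cnj b" "fm q (inverse z) 1 = cnj c" "fm q (inverse z) 0 = cnj d"
    unfolding cz[symmetric] fp_cnj fm_cnj by (simp_all add: a_b_c_d_def)
  define W N \<delta> where "W = a * d - b * c" "N = cnj a * d - cnj b * c" "\<delta> = z - inverse z"
  have 1: "a * cnj b - b * cnj a = \<delta>" "c * cnj d - d * cnj c = - \<delta>"
    using fp_wronskian[OF z, of 0] fm_wronskian[OF z, of 0]
    unfolding wronskian_def by (simp_all add: ca W_N_\<delta>_def flip: a_b_c_d_def)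
  \<comment> \<open>A determinant identity in dimension two. Conjugation replaces z by 1/z because
    \<open>q\<close> is real, so the right-hand side consists of the known Wronskians of each Jost
    solution with its conjugate.\<close>
  have "W * cnj W - N * cnj N = (a * cnj b - b * cnj a) * (c * cnj d - d * cnj c)"
    by (simp add: W_N_\<delta>_def algebra_simps)
  also have "\<dots> = \<delta> * (- \<delta>)" using 1 by simp
  also have "- \<delta> = cnj \<delta>" by (simp add: W_N_\<delta>_def cz)
  finally have "W * cnj W = N * cnj N + \<delta> * cnj \<delta>" by (simp add: algebra_simps)
  then have 2: "(norm W)\<^sup>2 = (norm N)\<^sup>2 + (norm \<delta>)\<^sup>2"
    unfolding complex_norm_square[symmetric] of_real_add[symmetric] of_real_eq_iff .
  have "ww q z = z * W" "nn q z = z * N"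
    using ww_wronskian[OF z0] nn_wronskian[OF z0] by (simp_all add: wronskian_def ca W_N_\<delta>_def flip: a_b_c_d_def)
  moreover have "1 - z\<^sup>2 = - z * \<delta>" using z0 by (simp add: W_N_\<delta>_def power2_eq_square algebra_simps)
  ultimately show ?thesis using 2 z by (simp add: norm_mult)
qed

text \<open>Up to sign the resolvent kernel without its Wronskian denominator, so that it still
  makes sense at the zeros of \<open>ww\<close>.\<close>

definition green :: "complex \<Rightarrow> int \<Rightarrow> int \<Rightarrow> complex" where
  "green z m n = fp q z (max n m) * fm q z (min n m)"

lemma Hop_green:
  assumes "z \<noteq> 0" "norm z \<le> 1"
  shows "Hop q (green z m) n = (2 - z - inverse z) * green z m n - (if n = m then ww q z / z else 0)"
proof -
  have p: "fp q z (n + 1) + fp q z (n - 1) = (z + inverse z + complex_of_real (q n)) * fp q z n"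
    "fm q z (n + 1) + fm q z (n - 1) = (z + inverse z + complex_of_real (q n)) * fm q z n" for n
    using fp_sol[OF assms] fm_sol[OF assms] by (auto simp: is_sol_def)
  have W: "ww q z / z = fp q z (m + 1) * fm q z m - fp q z m * fm q z (m + 1)"
    using wronskian_const[OF fp_sol[OF assms] fm_sol[OF assms], of m] ww_wronskian[OF assms(1)] assms(1)
    by (simp add: wronskian_def)
  have "green z m (n + 1) + green z m (n - 1) = (z + inverse z + complex_of_real (q n)) * green z m n + (if n = m then ww q z / z else 0)"
  proof -
    consider "n > m" | "n < m" | "n = m" by linarith
    then show ?thesis
    proof cases
      case 1
      then have "max (n+1) m = n + 1" "max (n-1) m = n - 1" "max n m = n" "min (n+1) m = m" "min (n-1) m = m" "min n m = m" by auto
      then show ?thesis using 1 p(1)[of n] by (simp add: green_def mult.assoc[symmetric] flip: distrib_right)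
    next
      case 2
      then have "max (n+1) m = m" "max (n-1) m = m" "max n m = m" "min (n+1) m = n + 1" "min (n-1) m = n - 1" "min n m = n" by auto
      then show ?thesis using 2 p(2)[of n] by (simp add: green_def mult.left_commute flip: distrib_left)
    next
      case 3
      have "green z m (n + 1) + green z m (n - 1) = fp q z (m + 1) * fm q z m + fp q z m * fm q z (m - 1)"
        using 3 by (simp add: green_def)
      also have "fm q z (m - 1) = (z + inverse z + complex_of_real (q m)) * fm q z m - fm q z (m + 1)"
        using p(2)[of m] by (simp add: algebra_simps)
      finally show ?thesis using 3 by (simp add: green_def W algebra_simps)
    qed
  qed
  then have "- (green z m (n + 1) + green z m (n - 1)) = - ((z + inverse z + complex_of_real (q n)) * green z m n + (if n = m then ww q z / z else 0))"
    by simp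
  then show ?thesis by (simp add: Hop_def algebra_simps)
qed

lemma fp_decay:
  assumes "z \<noteq> 0" "norm z \<le> 1" shows "\<exists>A. \<forall>j. norm (fp q z (m + int j)) \<le> A * norm z ^ j"
proof -
  obtain C where C: "\<forall>n\<ge>m. pw.wa \<sigma> (mplus q n) C" using mplus_wa_ex by blast
  have "norm (fp q z (m + int j)) \<le> (norm z powi m * C) * norm z ^ j" for j
  proof -
    have "norm (mplus q (m + int j) z) \<le> C" using pw.wa_norm[of \<sigma> "mplus q (m + int j)" C z] C assms by simp
    then have "norm z powi m * norm z ^ j * norm (mplus q (m + int j) z) \<le> norm z powi m * norm z ^ j * C"
      by (intro mult_left_mono) auto
    then show ?thesis using assms by (simp add: fp_def norm_mult norm_power norm_power_int power_int_add mult_ac)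
  qed
  then show ?thesis by blast
qed

lemma fm_decay:
  assumes "z \<noteq> 0" "norm z \<le> 1" shows "\<exists>A. \<forall>j. norm (fm q z (m - int j)) \<le> A * norm z ^ j"
  using jost.fp_decay[OF jost_reflect assms, of "- m"] by (simp add: fm_def)

lemma green_summable:
  assumes z: "z \<noteq> 0" "norm z < 1" shows "(\<lambda>n. norm (green z m n)) summable_on UNIV"
proof -
  have z': "norm z \<le> 1" using z by simp
  obtain A B where A: "\<And>j. norm (fp q z (m + int j)) \<le> A * norm z ^ j"
    and B: "\<And>j. norm (fm q z (m - int j)) \<le> B * norm z ^ j"
    using fp_decay[OF z(1) z'] fm_decay[OF z(1) z'] by metis
  show ?thesis
  proof (rule summable_on_int_geometric[of "norm z"])
    fix j
    have "max (m + int j) m = m + int j" "min (m + int j) m = m" "max (m - int j) m = m" "min (m - int j) m = m - int j" by auto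
    then show "norm (green z m (m + int j)) \<le> A * norm (fm q z m) * norm z ^ j"
      "norm (green z m (m - int j)) \<le> B * norm (fp q z m) * norm z ^ j"
      using mult_right_mono[OF A[of j], of "norm (fm q z m)"] mult_left_mono[OF B[of j], of "norm (fp q z m)"]
      by (auto simp: green_def norm_mult mult_ac)
  qed (use z in auto)
qed

text \<open>The norm bound \<open>1 / \<bar>Im \<lambda>\<bar>\<close> for the resolvent of a symmetric operator, read off on the diagonal.\<close>
lemma green_diag_bound:
  assumes z: "z \<noteq> 0" "norm z < 1"
  shows "\<bar>Im (z + inverse z)\<bar> * norm (fp q z m * fm q z m) \<le> norm (ww q z / z)"
proof -
  have z': "norm z \<le> 1" using z by simp
  let ?u = "green z m" and ?l = "2 - z - inverse z"
  note us = green_summable[OF z, of m]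
  obtain Q where Q: "\<And>n. \<bar>q n\<bar> \<le> Q" using q_bounded by blast
  define S where "S = (\<Sum>\<^sub>\<infinity>n. norm (?u n))"
  have ub: "norm (?u n) \<le> S" for n
    unfolding S_def using finite_sum_le_infsum[OF us, of "{n}"] by simp
  have cb: "norm (cnj (?u n)) \<le> S" for n using ub[of n] by simp
  note sy = Hop_symmetric[where u = ?u and v = "\<lambda>n. cnj (?u n)", OF us cb Q]
  \<comment> \<open>\<open>T\<close> is the quadratic form of H at \<open>?u\<close> and hence real.
    The equation for \<open>green\<close> also expresses it as the energy times the squared norm
    \<open>s\<close>, up to a contribution of the site \<open>m\<close> alone; comparing imaginary
    parts gives the bound.\<close>
  define T where "T = (\<Sum>\<^sub>\<infinity>n. cnj (?u n) * Hop q ?u n)"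
  have "cnj T = (\<Sum>\<^sub>\<infinity>n. ?u n * Hop q (\<lambda>n. cnj (?u n)) n)"
    unfolding T_def by (simp add: Hop_def flip: infsum_cnj)
  then have "cnj T = T" using sy(1) by (simp add: T_def mult.commute)
  from arg_cong[OF this, of Im] have T: "Im T = 0" by simp
  define s where "s = (\<Sum>\<^sub>\<infinity>n. (norm (?u n))\<^sup>2)"
  have ns: "cnj (?u n) * ?u n = complex_of_real ((norm (?u n))\<^sup>2)" for n
    by (metis complex_norm_square mult.commute)
  have s2: "(\<lambda>n. (norm (?u n))\<^sup>2) summable_on UNIV"
    using summable_on_Re[OF sy(3)] by (simp only: ns Re_complex_of_real)
  have sm: "(norm (?u m))\<^sup>2 \<le> s"
    unfolding s_def using finite_sum_le_infsum[OF s2, of "{m}"] by simp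
  have "T = (\<Sum>\<^sub>\<infinity>n. ?l * (cnj (?u n) * ?u n) - (if n = m then cnj (?u m) * (ww q z / z) else 0))"
    unfolding T_def by (intro infsum_cong) (auto simp: Hop_green[OF z(1) z'] algebra_simps)
  also have "\<dots> = ?l * complex_of_real s - cnj (?u m) * (ww q z / z)"
  proof (rule infsumI, unfold diff_conv_add_uminus, intro has_sum_add has_sum_uminusI)
    show "((\<lambda>n. (2 + - z + - inverse z) * (cnj (?u n) * ?u n)) has_sum (2 + - z + - inverse z) * complex_of_real s) UNIV"
      unfolding ns s_def by (intro has_sum_cmult_right has_sum_of_real has_sum_infsum s2)
    show "((\<lambda>n. if n = m then cnj (?u m) * (ww q z / z) else 0) has_sum cnj (?u m) * (ww q z / z)) UNIV"
      by (rule has_sum_finite_neutralI[of "{m}"]) auto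
  qed
  finally have "Im ?l * s = Im (cnj (?u m) * (ww q z / z))" using T by simp
  moreover have "Im ?l = - Im (z + inverse z)" by simp
  ultimately have "\<bar>Im (z + inverse z)\<bar> * \<bar>s\<bar> = \<bar>Im (cnj (?u m) * (ww q z / z))\<bar>"
    by (metis abs_mult abs_minus_cancel)
  also have "\<dots> \<le> norm (?u m) * norm (ww q z / z)"
    using abs_Im_le_cmod[of "cnj (?u m) * (ww q z / z)"] unfolding norm_mult complex_mod_cnj .
  finally have F: "\<bar>Im (z + inverse z)\<bar> * \<bar>s\<bar> \<le> norm (?u m) * norm (ww q z / z)" .
  have s0: "\<bar>s\<bar> = s" using order_trans[OF zero_le_power2 sm] by (rule abs_of_nonneg)
  have "\<bar>Im (z + inverse z)\<bar> * (norm (?u m))\<^sup>2 \<le> norm (?u m) * norm (ww q z / z)"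
    by (rule order_trans[OF mult_left_mono[OF sm abs_ge_zero] F[unfolded s0]])
  then have "norm (?u m) * (\<bar>Im (z + inverse z)\<bar> * norm (?u m)) \<le> norm (?u m) * norm (ww q z / z)"
    by (simp add: power2_eq_square mult_ac)
  then have "\<bar>Im (z + inverse z)\<bar> * norm (?u m) \<le> norm (ww q z / z)"
    by (cases "?u m = 0") auto
  then show ?thesis by (simp add: green_def)
qed

lemma ww_zero_multiple:
  assumes z: "z \<noteq> 0" "norm z \<le> 1" and w: "ww q z = 0"
  shows "\<exists>c. c \<noteq> 0 \<and> fm q z = (\<lambda>n. c * fp q z n)"
proof -
  obtain n0 where "fp q z n0 \<noteq> 0" using fp_nonzero[OF z] by blast
  then obtain c where c: "fm q z = (\<lambda>n. c * fp q z n)"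
    using wronskian_0_multiple[OF fp_sol[OF z] fm_sol[OF z]] w ww_wronskian[OF z(1)] z by force
  moreover have "c \<noteq> 0" using c fm_nonzero[OF z] by auto
  ultimately show ?thesis by blast
qed

lemma fp_summable:
  assumes z: "z \<noteq> 0" "norm z < 1" and w: "ww q z = 0"
  shows "(\<lambda>n. norm (fp q z n)) summable_on UNIV"
proof -
  have z': "norm z \<le> 1" using z by simp
  obtain c where c: "c \<noteq> 0" "fm q z = (\<lambda>n. c * fp q z n)" using ww_zero_multiple[OF z(1) z' w] by blast
  obtain A B where A: "\<And>j. norm (fp q z (0 + int j)) \<le> A * norm z ^ j"
    and B: "\<And>j. norm (fm q z (0 - int j)) \<le> B * norm z ^ j"
    using fp_decay[OF z(1) z'] fm_decay[OF z(1) z'] by metis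
  show ?thesis
  proof (rule summable_on_int_geometric[of "norm z", OF _ _ A])
    fix j show "norm (fp q z (0 - int j)) \<le> B / norm c * norm z ^ j"
      using B[of j] c by (simp add: norm_mult field_simps)
  qed (use z in auto)
qed

text \<open>At a zero of \<open>ww\<close> the two Jost solutions are proportional, hence nonzero at
  a common site. There the diagonal bound forces Im (z + 1/z) = Im z (1 - 1/|z|^2) to
  vanish.\<close>

lemma ww_zero_real:
  assumes z: "norm z < 1" and w: "ww q z = 0"
  shows "Im z = 0" "z \<noteq> 0"
proof -
  show z0: "z \<noteq> 0" using w ww_0[of q] by auto
  obtain c where c: "c \<noteq> 0" "fm q z = (\<lambda>n. c * fp q z n)" using ww_zero_multiple[OF z0 _ w] z by auto
  obtain n where "fp q z n \<noteq> 0" using fp_nonzero[OF z0] z by auto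
  then have "fp q z n * fm q z n \<noteq> 0" using c by simp
  then have p: "0 < norm (fp q z n * fm q z n)" by (rule zero_less_norm_iff[THEN iffD2])
  have "\<bar>Im (z + inverse z)\<bar> * norm (fp q z n * fm q z n) \<le> 0"
    using green_diag_bound[OF z0 z, of n] unfolding w by (simp only: div_0 norm_zero)
  then have "\<bar>Im (z + inverse z)\<bar> \<le> 0" using p by (meson mult_pos_pos not_le)
  then have "Im z + Im (inverse z) = 0" by simp
  then have "Im z * (1 - 1 / (norm z)\<^sup>2) = 0" unfolding Im_inverse by (simp add: right_diff_distrib)
  moreover have "1 - 1 / (norm z)\<^sup>2 \<noteq> 0"
  proof -
    have "(norm z)\<^sup>2 < 1" "0 < (norm z)\<^sup>2" using z z0 by (auto simp: abs_square_less_1)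
    then show ?thesis by simp
  qed
  ultimately show "Im z = 0" by (metis mult_eq_0_iff)
qed

lemma isCont_mplus: "norm a < 1 \<Longrightarrow> isCont (mplus q n) a"
  using pw.wa_continuous[OF mplus_wa_ge[of n n]] continuous_on_interior[of "cball 0 1" "mplus q n" a]
  by simp

text \<open>Approaching the real zero vertically, z = a + iy, the diagonal bound at a site where the
  eigenfunction is nonzero gives |ww| \<ge> c y with some c > 0; after division by |z - a| = y the
  cofactor stays away from 0.\<close>

lemma ww_zero_simple:
  assumes a: "norm a < 1" and w: "ww q a = 0" and v: "isCont v a"
    and eq: "\<And>z. norm z < 1 \<Longrightarrow> ww q z = (z - a) * v z"
  shows "v a \<noteq> 0"
proof
  assume va: "v a = 0"
  have a0: "a \<noteq> 0" and Ia: "Im a = 0" using ww_zero_real[OF a w] by auto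
  obtain c where c: "c \<noteq> 0" "fm q a = (\<lambda>n. c * fp q a n)" using ww_zero_multiple[OF a0 _ w] a by auto
  obtain m where m: "fp q a m \<noteq> 0" using fp_nonzero[OF a0] a by auto
  have fc: "isCont (\<lambda>z. fp q z m) a" unfolding fp_def
    by (intro continuous_intros isCont_mplus a) (use a0 in auto)
  have fmc: "isCont (\<lambda>z. fm q z m) a" unfolding fm_def fp_def
    by (intro continuous_intros jost.isCont_mplus[OF jost_reflect] a) (use a0 in auto)
  define g where "g y = a + \<i> * complex_of_real y" for y
  have g: "(g \<longlongrightarrow> a) (at_right 0)" unfolding g_def
    by (rule tendsto_eq_intros refl | simp)+
  have L: "((\<lambda>y. \<bar>1 - 1 / (norm (g y))\<^sup>2\<bar> * norm (fp q (g y) m * fm q (g y) m) * norm (g y)) \<longlongrightarrow>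
     \<bar>1 - 1 / (norm a)\<^sup>2\<bar> * norm (fp q a m * fm q a m) * norm a) (at_right 0)"
    by (intro tendsto_intros g isCont_tendsto_compose[OF fc] isCont_tendsto_compose[OF fmc]) (use a0 in auto)
  have R: "((\<lambda>y. norm (v (g y))) \<longlongrightarrow> norm (v a)) (at_right 0)"
    by (intro tendsto_intros isCont_tendsto_compose[OF v] g)
  have "\<forall>\<^sub>F y in at_right 0. norm (g y) < 1"
    using order_tendstoD(2)[OF tendsto_norm[OF g] a] .
  then have "\<forall>\<^sub>F y in at_right 0. \<bar>1 - 1 / (norm (g y))\<^sup>2\<bar> * norm (fp q (g y) m * fm q (g y) m) * norm (g y) \<le> norm (v (g y))"
  proof (rule eventually_elim2[OF _ eventually_at_right_less])
    fix y :: real assume y: "norm (g y) < 1" "0 < y"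
    have Ig: "Im (g y) = y" by (simp add: g_def Ia)
    then have g0: "g y \<noteq> 0" using y by auto
    have I: "Im (g y + inverse (g y)) = y * (1 - 1 / (norm (g y))\<^sup>2)"
      unfolding plus_complex.sel Im_inverse Ig by (simp add: right_diff_distrib)
    have "norm (ww q (g y)) = y * norm (v (g y))"
      using eq[OF y(1)] y(2) by (simp add: g_def norm_mult)
    then have "y * \<bar>1 - 1 / (norm (g y))\<^sup>2\<bar> * norm (fp q (g y) m * fm q (g y) m) \<le> y * norm (v (g y)) / norm (g y)"
      using green_diag_bound[OF g0 y(1), of m] y(2) unfolding I by (simp add: norm_divide abs_mult)
    then have "y * (\<bar>1 - 1 / (norm (g y))\<^sup>2\<bar> * norm (fp q (g y) m * fm q (g y) m) * norm (g y)) \<le> y * norm (v (g y))"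
      using g0 by (simp add: field_simps)
    then show "\<bar>1 - 1 / (norm (g y))\<^sup>2\<bar> * norm (fp q (g y) m * fm q (g y) m) * norm (g y) \<le> norm (v (g y))"
      using y(2) by simp
  qed
  from tendsto_le[OF _ R L this] va
  have "\<bar>1 - 1 / (norm a)\<^sup>2\<bar> * norm (fp q a m * fm q a m) * norm a \<le> 0" by simp
  moreover have "(norm a)\<^sup>2 < 1" "0 < (norm a)\<^sup>2" using a a0 by (auto simp: abs_square_less_1)
  then have "\<bar>1 - 1 / (norm a)\<^sup>2\<bar> > 0" by simp
  moreover have "norm (fp q a m * fm q a m) > 0" using m c by simp
  ultimately show False using a0 by (simp add: mult_le_0_iff)
qed

end

section \<open>The spectral kernel\<close>

text \<open>The exceptional points 1 and -1 are limits of other points of the circle, reached by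
  small rotations. This restores what is lost when resonant factors are divided out.\<close>

lemma sphere_le_by_density:
  fixes f g :: "complex \<Rightarrow> real"
  assumes f: "continuous_on (sphere 0 1) f" and g: "continuous_on (sphere 0 1) g"
    and le: "\<And>z. norm z = 1 \<Longrightarrow> z\<^sup>2 \<noteq> 1 \<Longrightarrow> f z \<le> g z" and z: "norm z = 1"
  shows "f z \<le> g z"
proof (cases "z\<^sup>2 = 1")
  case False then show ?thesis using le z by blast
next
  case True
  define h where "h y = z * cis y" for y
  have hs: "h y \<in> sphere 0 1" for y using z by (simp add: h_def norm_mult)
  have h0: "(h \<longlongrightarrow> z) (at_right 0)"
  proof -
    have "isCont h 0" unfolding h_def cis_conv_exp by (intro continuous_intros)
    then have "(h \<longlongrightarrow> h 0) (at 0)" by (simp add: isCont_def)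
    then show ?thesis by (auto simp: h_def intro: tendsto_within_subset)
  qed
  have lim: "((\<lambda>y. k (h y)) \<longlongrightarrow> k z) (at_right 0)" if "continuous_on (sphere 0 1) k" for k :: "complex \<Rightarrow> real"
  proof -
    have "(k \<longlongrightarrow> k z) (at z within sphere 0 1)"
      using that z unfolding continuous_on_def by auto
    moreover have "filterlim h (at z within sphere 0 1) (at_right 0)"
      unfolding filterlim_at
    proof
      have "\<forall>\<^sub>F y in at_right 0. y < (1::real)"
        by (rule eventually_at_rightI[of 0 1]) auto
      then show "\<forall>\<^sub>F y in at_right 0. h y \<in> sphere 0 1 \<and> h y \<noteq> z"
      proof (rule eventually_elim2[OF eventually_at_right_less])
        fix y :: real assume y: "0 < y" "y < 1"
        then have "sin y > 0" using pi_gt3 by (intro sin_gt_zero) auto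
        then have "cis y \<noteq> 1" by (auto simp: complex_eq_iff)
        then show "h y \<in> sphere 0 1 \<and> h y \<noteq> z" using hs z by (auto simp: h_def)
      qed
    qed (rule h0)
    ultimately show ?thesis by (rule filterlim_compose)
  qed
  have "\<forall>\<^sub>F y in at_right 0. y < (1::real)"
    by (rule eventually_at_rightI[of 0 1]) auto
  then have "\<forall>\<^sub>F y in at_right 0. f (h y) \<le> g (h y)"
  proof (rule eventually_elim2[OF eventually_at_right_less])
    fix y :: real assume y: "0 < y" "y < 1"
    then have "sin (2 * y) > 0" using pi_gt3 by (intro sin_gt_zero) auto
    moreover have "(h y)\<^sup>2 = cis (2 * y)"
      using True by (simp add: h_def power_mult_distrib Complex.DeMoivre)
    ultimately have "(h y)\<^sup>2 \<noteq> 1" by (auto simp: complex_eq_iff)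
    then show "f (h y) \<le> g (h y)" using hs[of y] by (intro le) auto
  qed
  from tendsto_le[OF _ lim[OF g] lim[OF f] this] show ?thesis by simp
qed

lemma sphere_eq_by_density:
  fixes f g :: "complex \<Rightarrow> complex"
  assumes "continuous_on (sphere 0 1) f" "continuous_on (sphere 0 1) g"
    and "\<And>z. norm z = 1 \<Longrightarrow> z\<^sup>2 \<noteq> 1 \<Longrightarrow> f z = g z" and "norm z = 1"
  shows "f z = g z"
proof -
  have "norm (f z - g z) \<le> 0"
    by (rule sphere_le_by_density[where f = "\<lambda>z. norm (f z - g z)" and g = "\<lambda>z. 0"])
      (intro continuous_on_norm continuous_on_diff assms continuous_on_const, use assms in auto)
  then show ?thesis by simp
qed

lemma ww_reflect: "ww (\<lambda>n. q (- n)) z = ww q z" if "jost q \<sigma>" "norm z \<le> 1"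
proof (cases "z = 0")
  case True then show ?thesis by (simp add: ww_0)
next
  case False
  interpret jost q \<sigma> by fact
  have fp': "fp (\<lambda>n. q (- n)) z = (\<lambda>n. fm q z (- n))" "fm (\<lambda>n. q (- n)) z = (\<lambda>n. fp q z (- n))"
    by (auto simp: fm_def)
  have "wronskian (fm q z) (fp q z) (- 1) = - wronskian (fp q z) (fm q z) (- 1)"
    by (simp add: wronskian_def)
  then show ?thesis
    using wronskian_const[OF fp_sol[OF False that(2)] fm_sol[OF False that(2)], of "-1"]
    by (simp add: ww_wronskian[OF False] fp' wronskian_reflect)
qed

text \<open>The factor \<open>s\<close> collects the resonances, so that \<open>v0 = ww / s\<close> has no zeros on the circle.\<close>
locale jost_fac = jost q 0 for q +
  fixes s s' v0 N N' :: "complex \<Rightarrow> complex"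
  assumes ss': "\<And>z. s z * s' z = 1 - z\<^sup>2"
    and s_nonzero: "\<And>z. norm z < 1 \<Longrightarrow> s z \<noteq> 0"
    and s_wa: "\<exists>B. pw.wa 0 s B" and s'_wa: "\<exists>B. pw.wa 0 s' B"
    and v0_wa: "\<exists>B. pw.wa 0 v0 B"
    and ww_eq: "\<And>z. norm z \<le> 1 \<Longrightarrow> ww q z = s z * v0 z"
    and N_wa: "\<exists>B. cw.wa 0 N B" and N'_wa: "\<exists>B. cw.wa 0 N' B"
    and nn_eq: "\<And>z. norm z = 1 \<Longrightarrow> nn q z = s z * N z"
    and nn'_eq: "\<And>z. norm z = 1 \<Longrightarrow> nn (\<lambda>n. q (- n)) z = s z * N' z"
    and v0_nonzero: "\<And>z. norm z = 1 \<Longrightarrow> v0 z \<noteq> 0"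
begin

text \<open>Reflection exchanges the two reflection data \<open>N\<close> and \<open>N'\<close> and
  keeps the rest, which is why the locale carries both; the left half line thereby reduces to the
  right one.\<close>

lemma jost_fac_reflect: "jost_fac (\<lambda>n. q (- n)) s s' v0 N' N"
proof -
  interpret r: jost "\<lambda>n. q (- n)" 0 by (rule jost_reflect)
  show ?thesis
    by unfold_locales
      (use ss' s_nonzero s_wa s'_wa v0_wa ww_eq N_wa N'_wa nn_eq nn'_eq v0_nonzero in
        \<open>auto simp: ww_reflect[OF jost_axioms]\<close>)
qed

section \<open>Zeros in the disc, transmission coefficient and kernel\<close>

definition Z :: "complex set" where "Z = {z. norm z < 1 \<and> ww q z = 0}"

lemma Z_props: "a \<in> Z \<Longrightarrow> norm a < 1" "a \<in> Z \<Longrightarrow> a \<noteq> 0" "a \<in> Z \<Longrightarrow> Im a = 0" "a \<in> Z \<Longrightarrow> ww q a = 0"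
  using ww_zero_real by (auto simp: Z_def)

lemma ww_wa: "\<exists>B. pw.wa 0 (ww q) B"
proof -
  obtain B1 B2 where B: "pw.wa 0 s B1" "pw.wa 0 v0 B2" using s_wa v0_wa by blast
  show ?thesis by (rule exI, rule pw.wa_cong[OF pw.wa_mult[OF B]]) (auto simp: ww_eq)
qed

lemma pw_isCont: "pw.wa \<sigma> F B \<Longrightarrow> norm a < 1 \<Longrightarrow> isCont F a"
  using pw.wa_continuous[of \<sigma> F B] continuous_on_interior[of "cball 0 1" F a] by simp

text \<open>Absence of zeros of \<open>v0\<close> on the circle makes \<open>Z\<close> compact, so
  an infinite \<open>Z\<close> would contain one of its limit points; but simple zeros are
  isolated.\<close>

lemma finite_Z: "finite Z"
proof (rule ccontr)
  assume inf: "infinite Z"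
  obtain B where B: "pw.wa 0 v0 B" using v0_wa by blast
  have Z: "Z = {z \<in> cball 0 1. v0 z = 0}"
    using ww_eq s_nonzero v0_nonzero by (auto simp: Z_def le_less)
  have "compact Z"
  proof -
    have "closed {z \<in> cball 0 1. v0 z = 0}"
      using continuous_closed_preimage_constant[OF pw.wa_continuous[OF B], of 0] by simp
    then have "closed Z" by (simp add: Z)
    moreover have "bounded Z" by (rule bounded_subset[of "cball 0 1"]) (auto simp: Z)
    ultimately show ?thesis by (simp add: compact_eq_bounded_closed)
  qed
  then obtain l where l: "l \<in> Z" "l islimpt Z"
    using inf unfolding compact_eq_Bolzano_Weierstrass by blast
  obtain C where C: "pw.wa 0 (ww q) C" using ww_wa by blast
  obtain G D where G: "pw.wa 0 G D" "\<And>z. z \<in> cball 0 1 \<Longrightarrow> ww q z = (z - l) * G z"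
    using pw_divide_inside[OF C Z_props(1)[OF l(1)] Z_props(4)[OF l(1)]] by blast
  have Gc: "isCont G l" by (rule pw_isCont[OF G(1) Z_props(1)[OF l(1)]])
  have "G l \<noteq> 0"
    by (rule ww_zero_simple[OF Z_props(1)[OF l(1)] Z_props(4)[OF l(1)] Gc]) (use G in auto)
  then obtain e where e: "e > 0" "\<And>z. dist l z < e \<Longrightarrow> G z \<noteq> 0"
    using continuous_at_avoid[OF Gc, of 0] by auto
  obtain z where "z \<in> Z" "z \<noteq> l" "dist z l < e"
    using l(2) e(1) unfolding islimpt_approachable by blast
  then show False using G(2)[of z] e(2)[of z] Z_props by (auto simp: dist_commute less_imp_le)
qed

text \<open>As the zeros in the disc are simple, dividing each out once leaves a function without
  zeros in the closed disc, to which Wiener's lemma applies.\<close>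

lemma v_ex: "\<exists>v B C. pw.wa 0 v B \<and> pw.wa 0 (\<lambda>z. inverse (v z)) C \<and> (\<forall>z\<in>cball 0 1. v z \<noteq> 0) \<and>
   (\<forall>z\<in>cball 0 1. v0 z = (\<Prod>a\<in>Z. z - a) * v z)"
proof -
  obtain B0 where B0: "pw.wa 0 v0 B0" using v0_wa by blast
  obtain Bs where Bs: "pw.wa 0 s Bs" using s_wa by blast
  have v0Z: "v0 a = 0" if "a \<in> Z" for a
    using Z_props[OF that] ww_eq[of a] s_nonzero[of a] by auto
  have "Z \<subseteq> ball 0 1" using Z_props by auto
  from pw_factor[OF finite_Z this B0 v0Z]
  obtain v B where v: "pw.wa 0 v B" "\<And>z. z \<in> cball 0 1 \<Longrightarrow> v0 z = (\<Prod>a\<in>Z. z - a) * v z" by blast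
  have nz: "v z \<noteq> 0" if z: "z \<in> cball 0 1" for z
  proof (cases "z \<in> Z")
    case False
    then have "v0 z \<noteq> 0" using ww_eq[of z] v0_nonzero z by (cases "norm z = 1") (auto simp: Z_def)
    then show ?thesis using v(2)[OF z] by auto
  next
    case True
    \<comment> \<open>This is the cofactor of w - z in \<open>ww q w\<close>, evaluated at the zero
      \<open>z\<close>; simplicity of the zero makes it nonzero, and with it
      \<open>v z\<close>.\<close>
    have "s z * ((\<Prod>a\<in>Z - {z}. z - a) * v z) \<noteq> 0"
    proof (rule ww_zero_simple[OF Z_props(1)[OF True] Z_props(4)[OF True], where v = "\<lambda>w. s w * ((\<Prod>a\<in>Z - {z}. w - a) * v w)"])
      show "isCont (\<lambda>w. s w * ((\<Prod>a\<in>Z - {z}. w - a) * v w)) z"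
        by (intro continuous_intros pw_isCont[OF Bs] pw_isCont[OF v(1)] Z_props True)
      fix w :: complex assume w: "norm w < 1"
      have "(\<Prod>a\<in>Z. w - a) = (w - z) * (\<Prod>a\<in>Z - {z}. w - a)"
        by (rule prod.remove[OF finite_Z True])
      then show "ww q w = (w - z) * (s w * ((\<Prod>a\<in>Z - {z}. w - a) * v w))"
        using ww_eq[of w] v(2)[of w] w by simp
    qed
    then show ?thesis by auto
  qed
  from pw_inverse[OF v(1) nz] v nz show ?thesis by blast
qed

lemma inverse_v0_wa: "\<exists>B. cw.wa 0 (\<lambda>z. inverse (v0 z)) B"
proof -
  obtain v B C where v: "pw.wa 0 (\<lambda>z. inverse (v z)) C" "\<And>z. z \<in> cball 0 1 \<Longrightarrow> v0 z = (\<Prod>a\<in>Z. z - a) * v z"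
    using v_ex by blast
  have "\<exists>D. cw.wa 0 (\<lambda>z. \<Prod>a\<in>Y. inverse (z - a)) D" if "finite Y" "Y \<subseteq> Z" for Y
    using that
  proof (induction Y rule: finite_induct)
    case empty show ?case using cw.wa_const[of 0 1] by auto
  next
    case (insert b Y)
    then obtain D where D: "cw.wa 0 (\<lambda>z. \<Prod>a\<in>Y. inverse (z - a)) D" by auto
    have "norm b < 1" using insert Z_props by auto
    from cw.wa_mult[OF cw_inverse_linear[OF this] D] insert show ?case by auto
  qed
  from this[OF finite_Z] obtain D where "cw.wa 0 (\<lambda>z. \<Prod>a\<in>Z. inverse (z - a)) D" by blast
  from cw.wa_mult[OF this pw_imp_cw(1)[OF v(1)]]
  have "cw.wa 0 (\<lambda>z. inverse (v0 z)) (D * C)"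
    by (rule cw.wa_cong) (simp add: v(2) prod_inversef[symmetric, unfolded o_def])
  then show ?thesis by blast
qed

text \<open>The transmission coefficient up to sign: away from the zeros of \<open>ww\<close> it is
  (1 - z^2)/ww, and in the present form the resonant factor is already cancelled.\<close>

definition tau :: "complex \<Rightarrow> complex" where "tau z = s' z * inverse (v0 z)"

lemma tau_wa: "\<exists>B. cw.wa 0 tau B"
  unfolding tau_def[abs_def] using inverse_v0_wa s'_wa pw_imp_cw(1) cw.wa_mult by meson

lemma tau_ww: "norm z = 1 \<Longrightarrow> tau z * ww q z = 1 - z\<^sup>2"
proof -
  assume z: "norm z = 1"
  then have "tau z * ww q z = s z * s' z * (inverse (v0 z) * v0 z)"
    by (simp add: tau_def ww_eq mult_ac)
  then show ?thesis using v0_nonzero[OF z] ss'[of z] by simp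
qed

text \<open>On the circle, away from resonances, this is z - 1/z times the resolvent kernel R(z). In
  a mean against a function even under z -> 1/z only the even part (z - 1/z)(R(z) - R(1/z))/2
  counts, which is the jump of the resolvent in Stone's formula. The nonnegative power of z keeps
  the formula usable inside the disc.\<close>

definition FF :: "int \<Rightarrow> int \<Rightarrow> complex \<Rightarrow> complex" where
  "FF n m z = z powi \<bar>n - m\<bar> * (tau z * (mplus q (max n m) z * mminus q (min n m) z))"

lemma FF_green: "norm z = 1 \<Longrightarrow> FF n m z = tau z * green z m n"
proof -
  assume "norm z = 1"
  then have "z \<noteq> 0" by auto
  moreover have "\<bar>n - m\<bar> = max n m + - min n m" by auto
  ultimately have "z powi \<bar>n - m\<bar> = z powi (max n m) * z powi (- min n m)"
    by (metis power_int_add)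
  then show ?thesis by (simp add: FF_def green_def fp_def fm_eq)
qed

lemma FF_commute: "FF n m z = FF m n z"
  by (simp add: FF_def max.commute min.commute abs_minus_commute)

text \<open>The scattering relation; \<open>N / v0\<close> is the reflection coefficient.\<close>
lemma tau_mminus:
  assumes z: "norm z = 1"
  shows "tau z * mminus q r z = - mplus q r (inverse z) + z powi (2 * r) * (mplus q r z * (N z * inverse (v0 z)))"
proof (rule sphere_eq_by_density[OF _ _ _ z])
  obtain B where B: "cw.wa 0 (\<lambda>z. inverse (v0 z)) B" using inverse_v0_wa by blast
  obtain B1 where B1: "cw.wa 0 tau B1" using tau_wa by blast
  obtain B2 where B2: "pw.wa 0 (mplus q r) B2" using mplus_wa_ex[of r] by blast
  obtain B3 where B3: "pw.wa 0 (mminus q r) B3" using mminus_wa_ex[of r] by blast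
  obtain B4 where B4: "cw.wa 0 N B4" using N_wa by blast
  show "continuous_on (sphere 0 1) (\<lambda>z. tau z * mminus q r z)"
    by (rule cw.wa_continuous[OF cw.wa_mult[OF B1 pw_imp_cw(1)[OF B3]]])
  show "continuous_on (sphere 0 1) (\<lambda>z. - mplus q r (inverse z) + z powi (2 * r) * (mplus q r z * (N z * inverse (v0 z))))"
    by (intro continuous_intros cw.wa_continuous[OF pw_imp_cw(2)[OF B2]] cw.wa_continuous[OF pw_imp_cw(1)[OF B2]]
        cw.wa_continuous[OF B4] cw.wa_continuous[OF B]) auto
  fix z :: complex assume z: "norm z = 1" and z2: "z\<^sup>2 \<noteq> 1"
  have z0: "z \<noteq> 0" "norm z \<le> 1" "inverse z \<noteq> 0" "norm (inverse z) \<le> 1" using z by (auto simp: norm_inverse)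
  \<comment> \<open>The factor \<open>s\<close> divides 1 - z^2, hence is nonzero off 1 and -1;
    these two points are recovered by continuity.\<close>
  have s0: "s z \<noteq> 0" using ss'[of z] z2 by auto
  define f g h where "f = fp q z" "g = fp q (inverse z)" "h = fm q z"
  have sol: "is_sol q z f" "is_sol q z g" "is_sol q z h"
    using fp_sol[OF z0(1,2)] fp_sol[OF z0(3,4)] fm_sol[OF z0(1,2)]
    by (auto simp: is_sol_inverse f_g_h_def)
  have 1: "wronskian f g r = z - inverse z" using fp_wronskian[OF z] by (simp add: f_g_h_def)
  have 2: "z * wronskian f h r = ww q z" "z * wronskian g h r = nn q z"
    using wronskian_const[OF sol(1,3), of r] wronskian_const[OF sol(2,3), of r]
    by (simp_all add: ww_wronskian[OF z0(1)] nn_wronskian[OF z0(1)] f_g_h_def)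
  \<comment> \<open>Three solutions of a second-order equation are linearly dependent; this is the
    relation, with Wronskians as coefficients.\<close>
  have "h r * wronskian f g r = g r * wronskian f h r - f r * wronskian g h r"
    by (simp add: wronskian_def algebra_simps)
  then have "z * (h r * (z - inverse z)) = z * (g r * wronskian f h r - f r * wronskian g h r)"
    unfolding 1 by (rule arg_cong)
  then have "h r * (z * (z - inverse z)) = g r * ww q z - f r * nn q z"
    unfolding 2[symmetric] by (simp only: right_diff_distrib mult.left_commute)
  moreover have "z * (z - inverse z) = - (s z * s' z)" using z0 by (simp add: ss' power2_eq_square algebra_simps)
  ultimately have "h r * - (s z * s' z) = g r * (s z * v0 z) - f r * (s z * N z)"
    by (simp only: ww_eq[OF z0(2)] nn_eq[OF z])
  then have "s z * (- (h r * s' z)) = s z * (g r * v0 z - f r * N z)"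
    by (simp add: algebra_simps)
  then have "h r * s' z = f r * N z - g r * v0 z"
    using s0 by (metis minus_diff_eq minus_equation_iff mult_left_cancel)
  then have "tau z * h r = - g r + f r * (N z * inverse (v0 z))"
    using v0_nonzero[OF z] unfolding tau_def by (simp add: field_simps)
  then have "z powi r * (tau z * h r) = z powi r * (- g r + f r * (N z * inverse (v0 z)))"
    by (rule arg_cong)
  then have T: "tau z * (z powi r * h r) = - (z powi r * g r) + (z powi r * f r) * (N z * inverse (v0 z))"
    by (simp only: distrib_left mult_minus_right mult_minus_left mult_ac)
  have p: "z powi r \<noteq> 0" using z0 by simp
  have "z powi (2 * r) = z powi r * z powi r" using z0 by (metis mult_2 power_int_add)
  then have "z powi r * h r = mminus q r z" "z powi r * g r = mplus q r (inverse z)" "z powi r * f r = z powi (2 * r) * mplus q r z"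
    unfolding f_g_h_def fm_eq fp_def power_int_minus power_int_inverse using p by simp_all
  with T show "tau z * mminus q r z = - mplus q r (inverse z) + z powi (2 * r) * (mplus q r z * (N z * inverse (v0 z)))"
    by (simp only: mult.assoc)
qed

text \<open>With both sites on the right m_- is not controlled uniformly, but
  \<open>tau_mminus\<close> replaces its product with \<open>tau\<close> by values of m_+. The
  remaining powers of z are characters of norm 1, so the bound does not see the sites.\<close>

lemma FF_wa_nonneg: "\<exists>B. \<forall>n m. 0 \<le> m \<longrightarrow> m \<le> n \<longrightarrow> cw.wa 0 (FF n m) B"
proof -
  obtain B where B: "cw.wa 0 (\<lambda>z. inverse (v0 z)) B" using inverse_v0_wa by blast
  obtain C where C: "\<And>n. 0 \<le> n \<Longrightarrow> pw.wa 0 (mplus q n) C" using mplus_wa_ex[of 0] by blast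
  obtain D where D: "cw.wa 0 N D" using N_wa by blast
  have "cw.wa 0 (FF n m) (C * (C + C * (D * B)))" if nm: "0 \<le> m" "m \<le> n" for n m
  proof -
    have "0 \<le> n" using nm by simp
    have 1: "cw.wa 0 (\<lambda>z. 1 * z powi (2 * m) * (mplus q m z * (N z * inverse (v0 z)))) (C * (D * B))"
      using cw.wa_char_mult[OF cw.wa_mult[OF pw_imp_cw(1)[OF C[OF nm(1)]] cw.wa_mult[OF D B]], of 1 "2 * m"]
      by (simp add: cw_wt_def)
    have 2: "cw.wa 0 (\<lambda>z. - mplus q m (inverse z)) C"
      by (rule cw.wa_uminus[OF pw_imp_cw(2)[OF C[OF nm(1)]]])
    have "cw.wa 0 (\<lambda>z. 1 * z powi (n - m) * (mplus q n z * (- mplus q m (inverse z) + 1 * z powi (2 * m) * (mplus q m z * (N z * inverse (v0 z)))))) (C * (C + C * (D * B)))"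
      using cw.wa_char_mult[OF cw.wa_mult[OF pw_imp_cw(1)[OF C[OF \<open>0 \<le> n\<close>]] cw.wa_add[OF 2 1]], of 1 "n - m"]
      by (simp add: cw_wt_def)
    then show ?thesis
    proof (rule cw.wa_cong)
      fix z :: complex assume "z \<in> sphere 0 1"
      then show "1 * z powi (n - m) * (mplus q n z * (- mplus q m (inverse z) + 1 * z powi (2 * m) * (mplus q m z * (N z * inverse (v0 z))))) = FF n m z"
        using tau_mminus[of z m] nm by (simp add: FF_def max_def min_def)
    qed
  qed
  then show ?thesis by blast
qed

lemma FF_reflect: "jost_fac.FF (\<lambda>n. q (- n)) s' v0 n m z = FF (- n) (- m) z"
proof -
  interpret r: jost_fac "\<lambda>n. q (- n)" s s' v0 N' N by (rule jost_fac_reflect)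
  have "max (-n) (-m) = - min n m" "min (-n) (-m) = - max n m" "\<bar>- n - - m\<bar> = \<bar>n - m\<bar>" by auto
  then show ?thesis
    by (simp add: FF_def r.FF_def r.tau_def tau_def mminus_def mult_ac)
qed

text \<open>The pair of sites lies on the right, on the left, which is the first case reflected, or
  on both sides of 0; in the last case m_+ and m_- are each taken on the half line where they are
  bounded.\<close>

lemma FF_wa: "\<exists>B. \<forall>n m. cw.wa 0 (FF n m) B"
proof -
  interpret r: jost_fac "\<lambda>n. q (- n)" s s' v0 N' N by (rule jost_fac_reflect)
  obtain B1 where B1: "\<And>n m. 0 \<le> m \<Longrightarrow> m \<le> n \<Longrightarrow> cw.wa 0 (FF n m) B1" using FF_wa_nonneg by blast
  obtain B2 where B2: "\<And>n m. 0 \<le> m \<Longrightarrow> m \<le> n \<Longrightarrow> cw.wa 0 (r.FF n m) B2" using r.FF_wa_nonneg by blast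
  obtain B where B: "cw.wa 0 tau B" using tau_wa by blast
  obtain C where C: "\<And>n. 0 \<le> n \<Longrightarrow> pw.wa 0 (mplus q n) C" using mplus_wa_ex[of 0] by blast
  obtain D where D: "\<And>n. n \<le> 0 \<Longrightarrow> pw.wa 0 (mminus q n) D" using mminus_wa_ex[of 0] by blast
  have "cw.wa 0 (FF n m) (max B1 (max B2 (B * (C * D))))" if nm: "m \<le> n" for n m
  proof -
    consider "0 \<le> m" | "n \<le> 0" | "m \<le> 0" "0 \<le> n" by linarith
    then show ?thesis
    proof cases
      case 1 then show ?thesis using B1[OF 1 nm] by (rule_tac cw.wa_mono) auto
    next
      case 2
      have "cw.wa 0 (r.FF (- m) (- n)) B2" using B2[of "- n" "- m"] 2 nm by simp
      then have "cw.wa 0 (FF n m) B2"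
        by (rule cw.wa_cong) (simp add: FF_reflect FF_commute[of m n])
      then show ?thesis by (rule cw.wa_mono) auto
    next
      case 3
      have "cw.wa 0 (\<lambda>z. 1 * z powi \<bar>n - m\<bar> * (tau z * (mplus q n z * mminus q m z))) (B * (C * D))"
        using cw.wa_char_mult[OF cw.wa_mult[OF B cw.wa_mult[OF pw_imp_cw(1)[OF C[OF 3(2)]] pw_imp_cw(1)[OF D[OF 3(1)]]]], of 1 "\<bar>n - m\<bar>"]
        by (simp add: cw_wt_def)
      then have "cw.wa 0 (FF n m) (B * (C * D))"
        by (rule cw.wa_cong) (use nm in \<open>simp add: FF_def max_def min_def\<close>)
      then show ?thesis by (rule cw.wa_mono) auto
    qed
  qed
  then have "cw.wa 0 (FF n m) (max B1 (max B2 (B * (C * D))))" for n m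
  proof (cases "m \<le> n")
    case False
    then have "cw.wa 0 (FF m n) (max B1 (max B2 (B * (C * D))))"
      using \<open>\<And>n m. m \<le> n \<Longrightarrow> cw.wa 0 (FF n m) (max B1 (max B2 (B * (C * D))))\<close>[of n m] by simp
    then show ?thesis by (rule cw.wa_cong) (rule FF_commute)
  qed
  then show ?thesis by blast
qed

text \<open>The contribution of z = 0 is -1 on the diagonal because \<open>ww q 0 = - 1\<close> and
  \<open>s 0 * s' 0 = 1\<close>, and off the diagonal the power of z makes it vanish. At a zero
  \<open>a\<close> the two Jost solutions are proportional, so the residue is a product of
  eigenfunctions.\<close>

lemma cmean_FF: "\<exists>\<beta>. \<forall>n m. cmean (FF n m) = (if n = m then - 1 else 0) + (\<Sum>a\<in>Z. \<beta> a * (fp q a n * fp q a m))"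
proof -
  obtain v B C where v: "pw.wa 0 v B" "pw.wa 0 (\<lambda>z. inverse (v z)) C" "\<And>z. z \<in> cball 0 1 \<Longrightarrow> v z \<noteq> 0"
     "\<And>z. z \<in> cball 0 1 \<Longrightarrow> v0 z = (\<Prod>a\<in>Z. z - a) * v z"
    using v_ex by blast
  obtain B' where B': "pw.wa 0 s' B'" using s'_wa by blast
  have Z: "0 \<notin> Z" "Z \<subseteq> ball 0 1" using Z_props by auto
  obtain \<alpha> where \<alpha>: "\<And>h B. pw.wa 0 h B \<Longrightarrow> cmean (\<lambda>z. inverse (\<Prod>a\<in>Z. z - a) * h z) =
     inverse (\<Prod>a\<in>Z. - a) * h 0 + (\<Sum>a\<in>Z. \<alpha> a * h a)"
    using cmean_residues[OF finite_Z Z] by blast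
  have "\<forall>a\<in>Z. \<exists>c. fm q a = (\<lambda>n. c * fp q a n)"
    using ww_zero_multiple Z_props by (meson less_imp_le)
  then obtain c where c: "\<And>a. a \<in> Z \<Longrightarrow> fm q a = (\<lambda>n. c a * fp q a n)" by metis
  define \<beta> where "\<beta> a = \<alpha> a * (s' a * inverse (v a) * c a)" for a
  have "cmean (FF n m) = (if n = m then - 1 else 0) + (\<Sum>a\<in>Z. \<beta> a * (fp q a n * fp q a m))" for n m
  proof -
    define h where "h z = z ^ nat \<bar>n - m\<bar> * (s' z * inverse (v z) * (mplus q (max n m) z * mminus q (min n m) z))" for z
    obtain B1 B2 where B12: "pw.wa 0 (mplus q (max n m)) B1" "pw.wa 0 (mminus q (min n m)) B2"
      using mplus_wa_ex mminus_wa_ex by blast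
    obtain B3 where h: "pw.wa 0 h B3"
      using pw.wa_char_mult[OF pw.wa_mult[OF pw.wa_mult[OF B' v(2)] pw.wa_mult[OF B12]], of 1 "nat \<bar>n - m\<bar>"]
      unfolding h_def[abs_def] by auto
    have "cmean (FF n m) = cmean (\<lambda>z. inverse (\<Prod>a\<in>Z. z - a) * h z)"
    proof (rule cmean_cong)
      fix z :: complex assume "norm z = 1"
      then show "FF n m z = inverse (\<Prod>a\<in>Z. z - a) * h z"
        using v(4)[of z] by (simp add: FF_def h_def tau_def power_int_def mult_ac)
    qed
    also have "\<dots> = inverse (\<Prod>a\<in>Z. - a) * h 0 + (\<Sum>a\<in>Z. \<alpha> a * h a)" by (rule \<alpha>[OF h])
    also have "inverse (\<Prod>a\<in>Z. - a) * h 0 = (if n = m then - 1 else 0)"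
    proof (cases "n = m")
      case True
      have "s 0 * ((\<Prod>a\<in>Z. - a) * v 0) = - 1" using ww_eq[of 0] v(4)[of 0] ww_0[of q] by simp
      moreover have "s 0 * s' 0 = 1" using ss'[of 0] by simp
      ultimately have "s 0 * ((\<Prod>a\<in>Z. - a) * v 0) = - (s 0 * s' 0)" by simp
      then have "(\<Prod>a\<in>Z. - a) * v 0 = - s' 0" using s_nonzero[of 0] by (metis mult_left_cancel mult_minus_right norm_zero zero_less_one)
      moreover have "h 0 = s' 0 * inverse (v 0)" using True by (simp add: h_def mplus_0 mminus_def)
      moreover have nz: "v 0 \<noteq> 0" "(\<Prod>a\<in>Z. - a) \<noteq> 0" using v(3)[of 0] Z finite_Z by auto
      ultimately have "h 0 = - (\<Prod>a\<in>Z. - a)"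
        by (metis minus_minus mult.assoc mult_1_right mult_minus_left right_inverse)
      then show ?thesis using True nz by simp
    qed (simp add: h_def)
    also have "(\<Sum>a\<in>Z. \<alpha> a * h a) = (\<Sum>a\<in>Z. \<beta> a * (fp q a n * fp q a m))"
    proof (rule sum.cong)
      fix a assume a: "a \<in> Z"
      have "a \<noteq> 0" using Z_props a by blast
      moreover have "\<bar>n - m\<bar> = max n m + - min n m" by auto
      ultimately have p: "a powi \<bar>n - m\<bar> = a powi (max n m) * a powi (- min n m)"
        by (metis power_int_add)
      have "h a = s' a * inverse (v a) * (fp q a (max n m) * fm q a (min n m))"
        using p by (simp add: h_def fp_def fm_eq power_int_def[of a "\<bar>n - m\<bar>"])
      also have "\<dots> = s' a * inverse (v a) * c a * (fp q a (max n m) * fp q a (min n m))"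
        by (simp add: c[OF a])
      also have "fp q a (max n m) * fp q a (min n m) = fp q a n * fp q a m"
        by (cases "n \<le> m") (auto simp: max_def min_def)
      finally show "\<alpha> a * h a = \<beta> a * (fp q a n * fp q a m)" by (simp add: \<beta>_def)
    qed simp
    finally show ?thesis .
  qed
  then show ?thesis by blast
qed

text \<open>The Wronskian cancels against \<open>tau\<close>, so the diagonal term is independent of
  \<open>q\<close> and odd under z -> 1/z.\<close>

lemma Hop_FF:
  assumes z: "norm z = 1"
  shows "Hop q (\<lambda>n. FF n m z) n = (2 - z - inverse z) * FF n m z - (if n = m then inverse z - z else 0)"
proof -
  have z0: "z \<noteq> 0" "norm z \<le> 1" using z by auto
  have "Hop q (\<lambda>n. FF n m z) n = tau z * Hop q (green z m) n"
    by (simp add: FF_green[OF z] Hop_def algebra_simps)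
  also have "\<dots> = (2 - z - inverse z) * FF n m z - (if n = m then tau z * ww q z / z else 0)"
    unfolding Hop_green[OF z0] FF_green[OF z] by (simp add: algebra_simps)
  also have "tau z * ww q z / z = inverse z - z"
    using z0 tau_ww[OF z] by (simp add: field_simps power2_eq_square)
  finally show ?thesis .
qed

lemma FF_bounded: "\<exists>B. \<forall>n m z. norm z = 1 \<longrightarrow> norm (FF n m z) \<le> B"
proof -
  obtain B where B: "\<And>n m. cw.wa 0 (FF n m) B" using FF_wa by blast
  then show ?thesis using cw.wa_norm by (intro exI[of _ B]) force
qed

lemma FF_continuous: "continuous_on (sphere 0 1) (FF n m)"
  using FF_wa cw.wa_continuous by blast

text \<open>With G(z) the pairing before the mean is taken, symmetry of H gives (a + 1/a - z - 1/z)
  G(z) = (1/z - z) f_+(m). The factor on the left is even under z -> 1/z and nonzero because |a| <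
  1, while the right-hand side is odd; so \<open>G\<close> is odd.\<close>

lemma eigen_orthogonal:
  assumes a: "a \<in> Z"
  shows "((\<lambda>n. fp q a n * cmean (FF n m)) has_sum 0) UNIV"
proof -
  note Za = Z_props[OF a]
  have us: "(\<lambda>n. norm (fp q a n)) summable_on UNIV" by (rule fp_summable[OF Za(2,1,4)])
  obtain B where B: "\<And>n m z. norm z = 1 \<Longrightarrow> norm (FF n m z) \<le> B" using FF_bounded by blast
  obtain Q where Q: "\<And>n. \<bar>q n\<bar> \<le> Q" using q_bounded by blast
  define G where "G z = (\<Sum>\<^sub>\<infinity>n. FF n m z * fp q a n)" for z
  have gs: "(\<lambda>n. FF n m z * fp q a n) summable_on UNIV" if "norm z = 1" for z
    by (rule Hop_symmetric(3)[OF us B[OF that] Q])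
  have "((\<lambda>n. cmean (\<lambda>z. fp q a n * FF n m z)) has_sum cmean G) UNIV"
  proof (rule cmean_has_sum(1))
    show "continuous_on (sphere 0 1) (\<lambda>z. fp q a n * FF n m z)" for n
      by (intro continuous_intros FF_continuous)
    show "(\<lambda>n. norm (fp q a n) * B) summable_on UNIV" by (rule summable_on_cmult_left[OF us])
    fix z :: complex assume z: "norm z = 1"
    show "norm (fp q a n * FF n m z) \<le> norm (fp q a n) * B" for n
      unfolding norm_mult by (intro mult_left_mono B z) auto
    show "((\<lambda>n. fp q a n * FF n m z) has_sum G z) UNIV"
      using gs[OF z] unfolding G_def by (simp add: mult.commute)
  qed
  moreover have "cmean G = 0"
  proof (rule cmean_odd)
    have eq: "(a + inverse a - z - inverse z) * G z = (inverse z - z) * fp q a m" if z: "norm z = 1" for z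
    proof -
      have Ha: "Hop q (fp q a) n = (2 - a - inverse a) * fp q a n" for n
        using fp_sol[of a] Za unfolding is_sol_Hop by simp
      have "(2 - a - inverse a) * G z = (\<Sum>\<^sub>\<infinity>n. FF n m z * Hop q (fp q a) n)"
        unfolding G_def Ha by (subst infsum_cmult_right'[symmetric]) (simp add: mult_ac)
      also have "\<dots> = (\<Sum>\<^sub>\<infinity>n. Hop q (\<lambda>n. FF n m z) n * fp q a n)"
        by (rule Hop_symmetric(1)[OF us B[OF z] Q])
      also have "\<dots> = (\<Sum>\<^sub>\<infinity>n. (2 - z - inverse z) * (FF n m z * fp q a n) + (if n = m then - ((inverse z - z) * fp q a m) else 0))"
        by (intro infsum_cong) (simp add: Hop_FF[OF z] left_diff_distrib)
      also have "\<dots> = (2 - z - inverse z) * G z + - ((inverse z - z) * fp q a m)"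
      proof (intro infsumI has_sum_add)
        show "((\<lambda>n. (2 - z - inverse z) * (FF n m z * fp q a n)) has_sum (2 - z - inverse z) * G z) UNIV"
          unfolding G_def by (intro has_sum_cmult_right has_sum_infsum gs z)
        show "((\<lambda>n. if n = m then - ((inverse z - z) * fp q a m) else 0) has_sum - ((inverse z - z) * fp q a m)) UNIV"
          by (rule has_sum_finite_neutralI[of "{m}"]) auto
      qed
      finally show ?thesis by (simp add: algebra_simps)
    qed
    fix z :: complex assume z: "norm z = 1"
    have z': "norm (inverse z) = 1" using z by (simp add: norm_inverse)
    have z0: "z \<noteq> 0" using z by auto
    have ne: "a + inverse a - z - inverse z \<noteq> 0"
    proof
      assume 0: "a + inverse a - z - inverse z = 0"
      have "(z - a) * (1 - a * z) = a * z * (a + inverse a - z - inverse z)"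
        using z0 Za(2) by (simp add: field_simps)
      then have "z = a \<or> a * z = 1" unfolding 0 by auto
      then show False
      proof
        assume "a * z = 1"
        then have "norm a * norm z = 1" by (metis norm_mult norm_one)
        then show False using z Za(1) by simp
      qed (use z Za(1) in auto)
    qed
    have X: "a + inverse a - inverse z - inverse (inverse z) = a + inverse a - z - inverse z"
      and Y: "inverse (inverse z) - inverse z = - (inverse z - z)" by simp_all
    have "(a + inverse a - z - inverse z) * G (inverse z) = (a + inverse a - z - inverse z) * (- G z)"
      using eq[OF z'] by (simp only: X Y mult_minus_left mult_minus_right eq[OF z])
    then show "G (inverse z) = - G z" using ne by (metis mult_left_cancel)
  qed
  ultimately show ?thesis by (simp add: cmean_cmult)
qed

end

section \<open>The projection onto the discrete spectrum, and resonances\<close>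

lemma l2_scale: "l2 f \<Longrightarrow> l2 (\<lambda>n. c * f n)"
  unfolding l2_def norm_mult power_mult_distrib by (rule summable_on_cmult_right)

lemma l2_add: assumes "l2 f" "l2 g" shows "l2 (\<lambda>n. f n + g n)"
  unfolding l2_def
proof (rule summable_on_comparison_test)
  show "(\<lambda>n. 2 * (cmod (f n))\<^sup>2 + 2 * (cmod (g n))\<^sup>2) summable_on UNIV"
    using assms unfolding l2_def by (intro summable_on_add summable_on_cmult_right)
  fix n
  have "(cmod (f n + g n))\<^sup>2 \<le> (cmod (f n) + cmod (g n))\<^sup>2"
    by (intro power_mono norm_triangle_ineq) simp
  also have "\<dots> \<le> 2 * (cmod (f n))\<^sup>2 + 2 * (cmod (g n))\<^sup>2"
    using zero_le_power2[of "cmod (f n) - cmod (g n)"] by (simp add: power2_eq_square algebra_simps)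
  finally show "(cmod (f n + g n))\<^sup>2 \<le> 2 * (cmod (f n))\<^sup>2 + 2 * (cmod (g n))\<^sup>2" .
qed simp

lemma l2_diff: "l2 f \<Longrightarrow> l2 g \<Longrightarrow> l2 (\<lambda>n. f n - g n)"
  using l2_add[of f "\<lambda>n. - 1 * g n"] l2_scale[of g "-1"] by simp

lemma l2_0: "l2 (\<lambda>n. 0)"
  by (simp add: l2_def)

lemma l2_sum: "finite I \<Longrightarrow> (\<And>i. i \<in> I \<Longrightarrow> l2 (f i)) \<Longrightarrow> l2 (\<lambda>n. \<Sum>i\<in>I. f i n)"
  by (induction I rule: finite_induct) (auto intro: l2_add l2_0)

lemma l1_imp_l2: assumes "l1 f" shows "l2 f"
  unfolding l2_def
proof (rule summable_on_comparison_test)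
  have s: "(\<lambda>n. cmod (f n)) summable_on UNIV" using assms by (simp add: l1_def)
  then show "(\<lambda>n. cmod (f n) * l1norm f) summable_on UNIV" by (rule summable_on_cmult_left)
  fix n
  have "cmod (f n) \<le> l1norm f"
    using finite_sum_le_infsum[OF s, of "{n}"] by (simp add: l1norm_def)
  then show "(cmod (f n))\<^sup>2 \<le> cmod (f n) * l1norm f"
    unfolding power2_eq_square by (rule mult_left_mono) simp
qed simp

text \<open>The elementary inequality xy \<le> \<delta> x^2 + y^2/\<delta> yields summability and an
  estimate at once; the free \<delta> plays the part of Cauchy-Schwarz in the approximation
  argument.\<close>

lemma l2inner_bound:
  assumes f: "l2 f" and g: "l2 g" and \<delta>: "\<delta> > 0"
  shows "(\<lambda>n. f n * cnj (g n)) summable_on UNIV"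
    "cmod (l2inner f g) \<le> \<delta> * (l2norm f)\<^sup>2 + (l2norm g)\<^sup>2 / \<delta>"
proof -
  have s: "(\<lambda>n. \<delta> * (cmod (f n))\<^sup>2 + (cmod (g n))\<^sup>2 / \<delta>) summable_on UNIV"
    using f g unfolding l2_def divide_inverse
    by (intro summable_on_add summable_on_cmult_right summable_on_cmult_left)
  have le: "cmod (f n * cnj (g n)) \<le> \<delta> * (cmod (f n))\<^sup>2 + (cmod (g n))\<^sup>2 / \<delta>" for n
  proof -
    define x y where "x = cmod (f n)" "y = cmod (g n)"
    have "0 \<le> (\<delta> * x - y)\<^sup>2" by simp
    moreover have "0 \<le> \<delta> * (x * y)" using \<delta> by (simp add: x_y_def)
    ultimately have "\<delta> * (x * y) \<le> \<delta> * (\<delta> * x\<^sup>2) + y\<^sup>2"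
      by (simp add: power2_eq_square algebra_simps)
    then have "x * y \<le> \<delta> * x\<^sup>2 + y\<^sup>2 / \<delta>" using \<delta> by (simp add: field_simps)
    then show ?thesis by (simp add: x_y_def norm_mult)
  qed
  show "(\<lambda>n. f n * cnj (g n)) summable_on UNIV"
    by (rule infsum_dominated(1)[OF s le])
  have "cmod (l2inner f g) \<le> (\<Sum>\<^sub>\<infinity>n. \<delta> * (cmod (f n))\<^sup>2 + (cmod (g n))\<^sup>2 / \<delta>)"
    unfolding l2inner_def by (rule infsum_dominated(2)[OF s le])
  also have "\<dots> = \<delta> * (\<Sum>\<^sub>\<infinity>n. (cmod (f n))\<^sup>2) + (\<Sum>\<^sub>\<infinity>n. (cmod (g n))\<^sup>2) / \<delta>"
    using f g unfolding l2_def divide_inverse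
    by (subst infsum_add) (auto intro!: summable_on_cmult_right summable_on_cmult_left simp: infsum_cmult_right' infsum_cmult_left')
  also have "\<dots> = \<delta> * (l2norm f)\<^sup>2 + (l2norm g)\<^sup>2 / \<delta>"
    by (simp add: l2norm_def infsum_nonneg)
  finally show "cmod (l2inner f g) \<le> \<delta> * (l2norm f)\<^sup>2 + (l2norm g)\<^sup>2 / \<delta>" .
qed

lemmas l2inner_summable = l2inner_bound(1)[OF _ _ zero_less_one]

lemma l2inner_diff_left:
  assumes "l2 f" "l2 g" "l2 h"
  shows "l2inner (\<lambda>n. f n - g n) h = l2inner f h - l2inner g h"
proof -
  have "((\<lambda>n. f n * cnj (h n) + - (g n * cnj (h n))) has_sum l2inner f h + - l2inner g h) UNIV"
    unfolding l2inner_def by (intro has_sum_add has_sum_uminusI has_sum_infsum l2inner_summable assms)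
  then show ?thesis unfolding l2inner_def[of "\<lambda>n. f n - g n"]
    by (intro infsumI) (simp add: left_diff_distrib)
qed

lemma l2inner_diff_right:
  assumes "l2 f" "l2 g" "l2 h"
  shows "l2inner f (\<lambda>n. g n - h n) = l2inner f g - l2inner f h"
proof -
  have "((\<lambda>n. f n * cnj (g n) + - (f n * cnj (h n))) has_sum l2inner f g + - l2inner f h) UNIV"
    unfolding l2inner_def by (intro has_sum_add has_sum_uminusI has_sum_infsum l2inner_summable assms)
  then show ?thesis unfolding l2inner_def[of f "\<lambda>n. g n - h n"]
    by (intro infsumI) (simp add: right_diff_distrib)
qed

lemma l2inner_sum_right:
  assumes f: "l2 f" and "finite I" "\<And>i. i \<in> I \<Longrightarrow> l2 (g i)"
  shows "l2inner f (\<lambda>n. \<Sum>i\<in>I. g i n) = (\<Sum>i\<in>I. l2inner f (g i))"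
  using assms(2,3)
proof (induction I rule: finite_induct)
  case (insert j I)
  have "l2inner f (\<lambda>n. \<Sum>i\<in>insert j I. g i n) = (\<Sum>\<^sub>\<infinity>n. f n * cnj (g j n) + f n * cnj (\<Sum>i\<in>I. g i n))"
    using insert by (simp add: l2inner_def distrib_left)
  also have "\<dots> = l2inner f (g j) + l2inner f (\<lambda>n. \<Sum>i\<in>I. g i n)"
    unfolding l2inner_def
    by (rule infsum_add; rule l2inner_summable[OF f]; use insert in \<open>auto intro!: l2_sum\<close>)
  finally show ?case using insert by simp
qed (simp add: l2inner_def)

lemma l2inner_scale_right: "l2inner f (\<lambda>n. c * g n) = cnj c * l2inner f g"
  by (simp add: l2inner_def mult.left_commute infsum_cmult_right')

lemma lin_comb_l2: "g \<in> lin_comb (eigvecs q) \<Longrightarrow> l2 g"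
  unfolding lin_comb_def eigvecs_def by (auto intro!: l2_sum l2_scale)

lemma lin_comb_diff:
  assumes "f \<in> lin_comb S" "g \<in> lin_comb S" shows "(\<lambda>n. f n - g n) \<in> lin_comb S"
proof -
  obtain k :: nat and c v where f: "f = (\<lambda>n. \<Sum>i<k. c i * v i n)" "\<forall>i<k. v i \<in> S"
    using assms(1) unfolding lin_comb_def mem_Collect_eq by (elim exE conjE) (rule that, assumption+)
  obtain l :: nat and d w where g: "g = (\<lambda>n. \<Sum>i<l. d i * w i n)" "\<forall>i<l. w i \<in> S"
    using assms(2) unfolding lin_comb_def mem_Collect_eq by (elim exE conjE) (rule that, assumption+)
  define e where "e i = (if i < k then c i else - d (i - k))" for i :: nat
  define x where "x i = (if i < k then v i else w (i - k))" for i :: nat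
  have "f n - g n = (\<Sum>i<k + l. e i * x i n)" for n
  proof -
    have "(\<Sum>i<k + m. e i * x i n) = (\<Sum>i<k. e i * x i n) + (\<Sum>i<m. e (k + i) * x (k + i) n)" for m
      by (induction m) auto
    then show ?thesis by (simp add: f g e_def x_def sum_negf)
  qed
  then show ?thesis using f(2) g(2) unfolding lin_comb_def x_def
    by (intro CollectI exI[of _ "k + l"] exI[of _ e] exI[of _ x]) (auto simp: x_def)
qed

lemma l2_eq_0: assumes "l2 f" "l2inner f f = 0" shows "f n = 0"
proof -
  have "((\<lambda>n. f n * cnj (f n)) has_sum 0) UNIV"
    using assms l2inner_summable by (simp add: l2inner_def has_sum_iff)
  moreover have "Re (f n * cnj (f n)) = (cmod (f n))\<^sup>2" for n
    by (metis Re_complex_of_real complex_norm_square)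
  ultimately have "((\<lambda>n. (cmod (f n))\<^sup>2) has_sum 0) UNIV"
    using has_sum_Re by fastforce
  then have "(cmod (f n))\<^sup>2 = 0"
    using nonneg_has_sum_le_0D[of "\<lambda>n. (cmod (f n))\<^sup>2" UNIV 0 n] by simp
  then show ?thesis by simp
qed

text \<open>\<open>disc_space\<close> is a closure, but orthogonality to the eigenvectors extends to
  it by approximation. For uniqueness, another candidate differs from \<open>v\<close> by an element
  of \<open>disc_space\<close> that is orthogonal to itself.\<close>

lemma Pd_eqI:
  assumes u: "l2 u" and v: "v \<in> lin_comb (eigvecs q)"
    and orth: "\<And>\<phi>. \<phi> \<in> eigvecs q \<Longrightarrow> l2inner (\<lambda>n. u n - v n) \<phi> = 0"
  shows "Pd q u = v"
  unfolding Pd_def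
proof (rule the_equality)
  have vl: "l2 v" by (rule lin_comb_l2[OF v])
  define w where "w n = u n - v n" for n
  have w: "l2 w" unfolding w_def[abs_def] by (rule l2_diff[OF u vl])
  have wl: "l2inner w g = 0" if g: "g \<in> lin_comb (eigvecs q)" for g
  proof -
    obtain k :: nat and c x where gx: "g = (\<lambda>n. \<Sum>i<k. c i * x i n)" "\<forall>i<k. x i \<in> eigvecs q"
      using g unfolding lin_comb_def mem_Collect_eq by (elim exE conjE) (rule that, assumption+)
    have "l2inner w g = (\<Sum>i<k. l2inner w (\<lambda>n. c i * x i n))"
      unfolding gx(1) by (rule l2inner_sum_right[OF w]) (use gx(2) in \<open>auto intro!: l2_scale simp: eigvecs_def\<close>)
    also have "\<dots> = 0" unfolding l2inner_scale_right
      using orth gx(2) by (simp add: w_def[abs_def])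
    finally show ?thesis .
  qed
  have wd: "l2inner w \<phi> = 0" if \<phi>: "\<phi> \<in> disc_space q" for \<phi>
  proof -
    have "cmod (l2inner w \<phi>) \<le> e" if e: "e > 0" for e
    proof -
      \<comment> \<open>Chosen so that \<delta> times the squared norm of \<open>w\<close>, plus
        \<delta>^2/\<delta>, is exactly \<open>e\<close>; the 1 in the denominator also admits w =
        0.\<close>
      define \<delta> where "\<delta> = e / ((l2norm w)\<^sup>2 + 1)"
      have nw: "0 < (l2norm w)\<^sup>2 + 1" by (simp add: add_nonneg_pos)
      have \<delta>: "\<delta> > 0" using e nw by (simp add: \<delta>_def)
      obtain g where g: "g \<in> lin_comb (eigvecs q)" "l2norm (\<lambda>n. \<phi> n - g n) < \<delta>"
        using \<phi> \<delta> unfolding disc_space_def by blast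
      have l: "l2 \<phi>" "l2 g" using \<phi> lin_comb_l2[OF g(1)] by (auto simp: disc_space_def)
      have "l2inner w \<phi> = l2inner w (\<lambda>n. \<phi> n - g n)"
        using l2inner_diff_right[OF w l] wl[OF g(1)] by simp
      then have "cmod (l2inner w \<phi>) \<le> \<delta> * (l2norm w)\<^sup>2 + (l2norm (\<lambda>n. \<phi> n - g n))\<^sup>2 / \<delta>"
        using l2inner_bound(2)[OF w l2_diff[OF l] \<delta>] by simp
      also have "(l2norm (\<lambda>n. \<phi> n - g n))\<^sup>2 / \<delta> \<le> \<delta>\<^sup>2 / \<delta>"
        using g(2) \<delta> by (intro divide_right_mono power_mono) (auto simp: l2norm_def infsum_nonneg)
      also have "\<delta> * (l2norm w)\<^sup>2 + \<delta>\<^sup>2 / \<delta> = \<delta> * ((l2norm w)\<^sup>2 + 1)"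
        using \<delta> by (simp add: power2_eq_square distrib_left)
      also have "\<dots> = e" using nw by (simp add: \<delta>_def)
      finally show ?thesis by simp
    qed
    from this[of "cmod (l2inner w \<phi>) / 2"] show ?thesis by (cases "l2inner w \<phi> = 0") auto
  qed
  have l2norm0: "l2norm (\<lambda>n. 0) = 0" by (simp add: l2norm_def)
  have vd: "v \<in> disc_space q"
    unfolding disc_space_def using vl v l2norm0 by (auto intro!: bexI[of _ v])
  with wd show "v \<in> disc_space q \<and> (\<forall>\<phi>\<in>disc_space q. l2inner (\<lambda>n. u n - v n) \<phi> = 0)"
    unfolding w_def[abs_def] by blast
  fix v' assume v': "v' \<in> disc_space q \<and> (\<forall>\<phi>\<in>disc_space q. l2inner (\<lambda>n. u n - v' n) \<phi> = 0)"
  then have v'l: "l2 v'" by (simp add: disc_space_def)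
  define d where "d n = v' n - v n" for n
  have dl: "l2 d" unfolding d_def[abs_def] by (rule l2_diff[OF v'l vl])
  have dd: "d \<in> disc_space q"
    unfolding disc_space_def
  proof (intro CollectI conjI dl allI impI)
    fix e :: real assume "e > 0"
    then obtain g where g: "g \<in> lin_comb (eigvecs q)" "l2norm (\<lambda>n. v' n - g n) < e"
      using v' unfolding disc_space_def by blast
    then show "\<exists>g\<in>lin_comb (eigvecs q). l2norm (\<lambda>n. d n - g n) < e"
      by (intro bexI[of _ "\<lambda>n. g n - v n"] lin_comb_diff v) (simp_all add: d_def)
  qed
  have "d = (\<lambda>n. (u n - v n) - (u n - v' n))" by (auto simp: d_def)
  then have "l2inner d d = l2inner (\<lambda>n. u n - v n) d - l2inner (\<lambda>n. u n - v' n) d"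
    using l2inner_diff_left[OF l2_diff[OF u vl] l2_diff[OF u v'l] dl] by simp
  also have "\<dots> = 0" using wd[OF dd] v' dd by (simp add: w_def[abs_def])
  finally have "d n = 0" for n using l2_eq_0[OF dl] by blast
  then show "v' = v" by (auto simp: d_def)
qed

lemma pw_quadratic: "\<exists>B. pw.wa 0 (\<lambda>z. a + b * z + c * z\<^sup>2) B"
proof -
  have "pw.wa 0 (\<lambda>z. a + b * z ^ 1 + c * z\<^sup>2) (norm a + pw_wt 0 1 * norm b + pw_wt 0 2 * norm c)"
    by (intro pw.wa_add pw.wa_const pw.wa_char)
  then show ?thesis by (simp only: power_one_right) blast
qed

section \<open>Splitting off the resonances, and the Jost solutions of the definition\<close>

context jost
begin

lemma ww_wa_ex: "\<exists>B. pw.wa \<sigma> (ww q) B"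
proof -
  obtain A B C D where *: "pw.wa \<sigma> (mplus q 1) A" "pw.wa \<sigma> (mplus q 0) B" "pw.wa \<sigma> (mminus q 0) C" "pw.wa \<sigma> (mminus q 1) D"
    using mplus_wa_ex mminus_wa_ex by (meson order_refl)
  have "pw.wa \<sigma> (\<lambda>z. 1 * z\<^sup>2 * (mplus q 1 z * mminus q 0 z) - mplus q 0 z * mminus q 1 z)
     (pw_wt \<sigma> 2 * norm (1::complex) * (A * C) + B * D)"
    by (intro pw.wa_diff pw.wa_char_mult pw.wa_mult *)
  then have "pw.wa \<sigma> (ww q) (pw_wt \<sigma> 2 * norm (1::complex) * (A * C) + B * D)"
    by (rule pw.wa_cong) (simp add: ww_def)
  then show ?thesis by blast
qed

lemma nn_wa_ex: "\<exists>B. cw.wa \<sigma> (nn q) B"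
proof -
  obtain A B C D where *: "pw.wa \<sigma> (mplus q 1) A" "pw.wa \<sigma> (mplus q 0) B" "pw.wa \<sigma> (mminus q 0) C" "pw.wa \<sigma> (mminus q 1) D"
    using mplus_wa_ex mminus_wa_ex by (meson order_refl)
  show ?thesis unfolding nn_def[abs_def]
    using cw.wa_diff[OF cw.wa_mult[OF pw_imp_cw(2)[OF *(1)] pw_imp_cw(1)[OF *(3)]]
      cw.wa_mult[OF pw_imp_cw(2)[OF *(2)] pw_imp_cw(1)[OF *(4)]]] by blast
qed

lemma norm_ww_ge: assumes "norm z = 1" shows "norm (1 - z\<^sup>2) \<le> norm (ww q z)"
  by (rule power2_le_imp_le) (simp_all add: ww_nn_identity[OF assms])

lemma nn_eq_0: "norm z = 1 \<Longrightarrow> ww q z = 0 \<Longrightarrow> nn q z = 0"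
  using ww_nn_identity[of z] by (simp add: add_nonneg_eq_0_iff)

text \<open>After division by \<open>s\<close>, the inequality |1 - z^2| \<le> |ww| becomes |s'|
  \<le> |v0|, which extends to 1 and -1 by continuity. A zero of \<open>v0\<close> on the circle
  would be one of \<open>ww\<close>, and there s' is nonzero by assumption.\<close>

lemma jost_facI:
  assumes "\<And>z. s z * s' z = 1 - z\<^sup>2" "\<And>z. norm z < 1 \<Longrightarrow> s z \<noteq> 0"
    and s: "\<exists>B. pw.wa 0 s B" and s': "\<exists>B. pw.wa 0 s' B"
    and v0: "pw.wa 0 v0 B" "\<And>z. z \<in> cball 0 1 \<Longrightarrow> ww q z = s z * v0 z"
    and N: "cw.wa 0 N C" "\<And>z. z \<in> sphere 0 1 \<Longrightarrow> nn q z = s z * N z"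
    and N': "cw.wa 0 N' C'" "\<And>z. z \<in> sphere 0 1 \<Longrightarrow> nn (\<lambda>n. q (- n)) z = s z * N' z"
    and s0: "\<And>z. norm z = 1 \<Longrightarrow> ww q z = 0 \<Longrightarrow> s' z \<noteq> 0"
  shows "jost_fac q s s' v0 N N'"
proof -
  interpret j0: jost q 0 by (rule jost_0)
  have nz: "v0 z \<noteq> 0" if z: "norm z = 1" for z
  proof
    assume v: "v0 z = 0"
    then have "s' z \<noteq> 0" using s0[OF z] v0(2)[of z] z by simp
    obtain B' where B': "pw.wa 0 s' B'" using s' by blast
    have "norm (s' z) \<le> norm (v0 z)"
    proof (rule sphere_le_by_density[OF _ _ _ z])
      show "continuous_on (sphere 0 1) (\<lambda>z. norm (s' z))" "continuous_on (sphere 0 1) (\<lambda>z. norm (v0 z))"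
        by (intro continuous_on_norm cw.wa_continuous[OF pw_imp_cw(1)[OF B']] cw.wa_continuous[OF pw_imp_cw(1)[OF v0(1)]])+
      fix z :: complex assume z: "norm z = 1" "z\<^sup>2 \<noteq> 1"
      then have "s z \<noteq> 0" using assms(1)[of z] by auto
      moreover have "norm (s z) * norm (s' z) \<le> norm (s z) * norm (v0 z)"
        using norm_ww_ge[OF z(1)] v0(2)[of z] z unfolding assms(1)[symmetric] by (simp add: norm_mult)
      ultimately show "norm (s' z) \<le> norm (v0 z)" by simp
    qed
    then show False using v \<open>s' z \<noteq> 0\<close> by simp
  qed
  show ?thesis
    by unfold_locales (use assms nz in auto)
qed

lemma jost_fac_nonresonant:
  assumes "ww q 1 \<noteq> 0" "ww q (- 1) \<noteq> 0"
  shows "\<exists>s s' v0 N N'. jost_fac q s s' v0 N N'"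
proof -
  obtain B where B: "pw.wa 0 (ww q) B" using jost.ww_wa_ex[OF jost_0] by blast
  obtain C where C: "cw.wa 0 (nn q) C" using jost.nn_wa_ex[OF jost_0] by blast
  obtain C' where C': "cw.wa 0 (nn (\<lambda>n. q (- n))) C'"
    using jost.nn_wa_ex[OF jost.jost_reflect[OF jost_0]] by blast
  have "jost_fac q (\<lambda>z. 1) (\<lambda>z. 1 - z\<^sup>2) (ww q) (nn q) (nn (\<lambda>n. q (- n)))"
  proof (rule jost_facI[OF _ _ _ _ B _ C _ C'])
    show "\<exists>B. pw.wa 0 (\<lambda>z. 1) B" using pw.wa_const by blast
    show "\<exists>B. pw.wa 0 (\<lambda>z. 1 - z\<^sup>2) B" using pw_quadratic[of 1 0 "-1"] by simp
    show "1 - z\<^sup>2 \<noteq> 0" if "norm z = 1" "ww q z = 0" for z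
      using assms that by (auto simp: power2_eq_1_iff)
  qed auto
  then show ?thesis by blast
qed

text \<open>The weight 1 pays for a single division on the circle. If \<open>ww\<close> vanishes at
  both 1 and -1, the divisions are done at each point separately and the quotients are
  combined.\<close>

lemma jost_fac_resonant:
  assumes \<sigma>: "\<sigma> = 1"
  shows "\<exists>s s' v0 N N'. jost_fac q s s' v0 N N'"
proof -
  obtain B where B: "pw.wa 1 (ww q) B" using ww_wa_ex \<sigma> by blast
  obtain C where C: "cw.wa 1 (nn q) C" using nn_wa_ex \<sigma> by blast
  obtain C' where C': "cw.wa 1 (nn (\<lambda>n. q (- n))) C'"
    using jost.nn_wa_ex[OF jost_reflect] \<sigma> by blast
  interpret r: jost "\<lambda>n. q (- n)" \<sigma> by (rule jost_reflect)
  have nr: "nn (\<lambda>n. q (- n)) z = 0" if "norm z = 1" "ww q z = 0" for z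
    using r.nn_eq_0[of z] that ww_reflect[OF jost_axioms, of z] by simp
  have one: "\<exists>V N N'. pw.wa 0 V B \<and> cw.wa 0 N C \<and> cw.wa 0 N' C' \<and>
      (\<forall>z\<in>cball 0 1. ww q z = (z - a) * V z) \<and> (\<forall>z\<in>sphere 0 1. nn q z = (z - a) * N z) \<and>
      (\<forall>z\<in>sphere 0 1. nn (\<lambda>n. q (- n)) z = (z - a) * N' z)" if a: "norm a = 1" "ww q a = 0" for a
    using pw_divide_boundary[OF B a] cw_divide_boundary[OF C a(1) nn_eq_0[OF a]]
      cw_divide_boundary[OF C' a(1) nr[OF a]] by blast
  consider "ww q 1 \<noteq> 0" "ww q (- 1) \<noteq> 0" | "ww q 1 = 0" "ww q (- 1) \<noteq> 0"
    | "ww q 1 \<noteq> 0" "ww q (- 1) = 0" | "ww q 1 = 0" "ww q (- 1) = 0" by blast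
  then show ?thesis
  proof cases
    case 1 then show ?thesis by (rule jost_fac_nonresonant)
  next
    case 2
    obtain V N N' where V: "pw.wa 0 V B" "cw.wa 0 N C" "cw.wa 0 N' C'"
      "\<And>z. z\<in>cball 0 1 \<Longrightarrow> ww q z = (z - 1) * V z" "\<And>z. z\<in>sphere 0 1 \<Longrightarrow> nn q z = (z - 1) * N z"
      "\<And>z. z\<in>sphere 0 1 \<Longrightarrow> nn (\<lambda>n. q (- n)) z = (z - 1) * N' z" using one[of 1] 2 by auto
    have "jost_fac q (\<lambda>z. z - 1) (\<lambda>z. - (z + 1)) V N N'"
    proof (rule jost_facI[OF _ _ _ _ V(1,4,2,5,3,6)])
      show "\<exists>B. pw.wa 0 (\<lambda>z. z - 1) B" using pw_quadratic[of "-1" 1 0] by simp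
      show "\<exists>B. pw.wa 0 (\<lambda>z. - (z + 1)) B" using pw_quadratic[of "-1" "-1" 0] by (simp add: algebra_simps)
      show "- (z + 1) \<noteq> 0" if "norm z = 1" "ww q z = 0" for z
      proof
        assume "- (z + 1) = 0"
        then have "z + 1 = 0" by (metis neg_equal_0_iff_equal)
        then have "z = - 1" unfolding eq_neg_iff_add_eq_0 .
        then show False using 2 that by simp
      qed
    qed (auto simp: power2_eq_square algebra_simps)
    then show ?thesis by blast
  next
    case 3
    obtain V N N' where V: "pw.wa 0 V B" "cw.wa 0 N C" "cw.wa 0 N' C'"
      "\<And>z. z\<in>cball 0 1 \<Longrightarrow> ww q z = (z - - 1) * V z" "\<And>z. z\<in>sphere 0 1 \<Longrightarrow> nn q z = (z - - 1) * N z"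
      "\<And>z. z\<in>sphere 0 1 \<Longrightarrow> nn (\<lambda>n. q (- n)) z = (z - - 1) * N' z" using one[of "-1"] 3 by auto
    have "jost_fac q (\<lambda>z. z - - 1) (\<lambda>z. 1 - z) V N N'"
    proof (rule jost_facI[OF _ _ _ _ V(1,4,2,5,3,6)])
      show "\<exists>B. pw.wa 0 (\<lambda>z. z - - 1) B" using pw_quadratic[of 1 1 0] by (simp add: add.commute)
      show "\<exists>B. pw.wa 0 (\<lambda>z. 1 - z) B" using pw_quadratic[of 1 "-1" 0] by simp
      show "1 - z \<noteq> 0" if "norm z = 1" "ww q z = 0" for z using 3 that by auto
    qed (auto simp: power2_eq_square algebra_simps add_eq_0_iff2)
    then show ?thesis by blast
  next
    case 4
    obtain V N N' where V: "pw.wa 0 V B" "cw.wa 0 N C" "cw.wa 0 N' C'"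
      "\<And>z. z\<in>cball 0 1 \<Longrightarrow> ww q z = (z - 1) * V z" "\<And>z. z\<in>sphere 0 1 \<Longrightarrow> nn q z = (z - 1) * N z"
      "\<And>z. z\<in>sphere 0 1 \<Longrightarrow> nn (\<lambda>n. q (- n)) z = (z - 1) * N' z" using one[of 1] 4 by auto
    obtain V2 N2 N2' where V2: "pw.wa 0 V2 B" "cw.wa 0 N2 C" "cw.wa 0 N2' C'"
      "\<And>z. z\<in>cball 0 1 \<Longrightarrow> ww q z = (z - - 1) * V2 z" "\<And>z. z\<in>sphere 0 1 \<Longrightarrow> nn q z = (z - - 1) * N2 z"
      "\<And>z. z\<in>sphere 0 1 \<Longrightarrow> nn (\<lambda>n. q (- n)) z = (z - - 1) * N2' z" using one[of "-1"] 4 by auto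
    \<comment> \<open>The partial fraction 1/(z^2 - 1) = (1/(z - 1) - 1/(z + 1))/2, with both
      quotients taken from the original function; a second division after the first would find no
      weight left.\<close>
    have alg: "W = (z\<^sup>2 - 1) * (1/2 * (x - y))" if "W = (z - 1) * x" "W = (z - - 1) * y" for W x y z :: complex
    proof -
      have "(z\<^sup>2 - 1) * (1/2 * (x - y)) = 1/2 * ((z + 1) * ((z - 1) * x) - (z - 1) * ((z - - 1) * y))"
        by (simp add: power2_eq_square field_simps)
      also have "\<dots> = W" unfolding that[symmetric] by (simp add: field_simps)
      finally show ?thesis by simp
    qed
    have "jost_fac q (\<lambda>z. z\<^sup>2 - 1) (\<lambda>z. - 1) (\<lambda>z. 1/2 * (V z - V2 z)) (\<lambda>z. 1/2 * (N z - N2 z)) (\<lambda>z. 1/2 * (N' z - N2' z))"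
    proof (rule jost_facI[OF _ _ _ _ pw.wa_cmult[OF pw.wa_diff[OF V(1) V2(1)]] alg[OF V(4) V2(4)]
        cw.wa_cmult[OF cw.wa_diff[OF V(2) V2(2)]] alg[OF V(5) V2(5)] cw.wa_cmult[OF cw.wa_diff[OF V(3) V2(3)]] alg[OF V(6) V2(6)]])
      show "\<exists>B. pw.wa 0 (\<lambda>z. z\<^sup>2 - 1) B" using pw_quadratic[of "-1" 0 1] by simp
      show "\<exists>B. pw.wa 0 (\<lambda>z. - 1) B" using pw.wa_const by blast
      fix z :: complex assume "norm z < 1"
      then show "z\<^sup>2 - 1 \<noteq> 0" by (auto simp: power2_eq_1_iff)
    qed auto
    then show ?thesis by blast
  qed
qed

text \<open>On the circle a second solution need not grow, so uniqueness comes from the Wronskian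
  with \<open>fp\<close>: up to a phase it is the difference of two products that both tend to 1.
  This makes the definite description of the Jost solution legitimate, also at 1 and -1.\<close>

lemma jost_plus_unique:
  assumes z: "norm z = 1" and f: "is_sol q z f" and lim: "(\<lambda>j. z powi (- int j) * f (int j)) \<longlonglongrightarrow> 1"
  shows "f = fp q z"
proof -
  have z0: "z \<noteq> 0" "norm z \<le> 1" using z by auto
  note s = fp_sol[OF z0]
  let ?a = "\<lambda>j. z powi (- int j) * f (int j)" and ?m = "\<lambda>j. mplus q (int j) z"
  have "(\<lambda>j. ?m (Suc j) * ?a j - ?m j * ?a (Suc j)) \<longlonglongrightarrow> 1 * 1 - 1 * 1"
    by (intro tendsto_intros LIMSEQ_Suc[OF lim] LIMSEQ_Suc[OF mplus_tendsto[OF z0(2)]] lim mplus_tendsto z0)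
  then have "(\<lambda>j. norm (?m (Suc j) * ?a j - ?m j * ?a (Suc j))) \<longlonglongrightarrow> 0"
    using tendsto_norm_zero by fastforce
  moreover have "norm (?m (Suc j) * ?a j - ?m j * ?a (Suc j)) = norm (wronskian (fp q z) f 0)" for j
  proof -
    have "wronskian (fp q z) f (int j) = z powi (2 * int j + 1) * (?m (Suc j) * ?a j - ?m j * ?a (Suc j))"
    proof -
      have "2 * int j + 1 = (int j + 1) + int j" "- int (Suc j) = - (int j + 1)" by simp_all
      then have p: "z powi (2 * int j + 1) = z powi (int j + 1) * z powi (int j)" "z powi (- int (Suc j)) = inverse (z powi (int j + 1))"
        "z powi (- int j) = inverse (z powi int j)"
        using z0(1) by (simp_all only: power_int_minus power_int_add simp_thms)
      show ?thesis unfolding p wronskian_def fp_def using z0(1)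
        by (simp add: field_simps add.commute)
    qed
    then show ?thesis using wronskian_const[OF s f, of "int j"] z by (simp add: norm_mult norm_power_int)
  qed
  ultimately have "wronskian (fp q z) f 0 = 0" by (simp add: LIMSEQ_const_iff)
  then obtain c where c: "f = (\<lambda>n. c * fp q z n)"
    using wronskian_0_multiple[OF s f] fp_nonzero[OF z0] by blast
  have "?a j = c * ?m j" for j
    using z0(1) by (simp add: c fp_def power_int_minus)
  then have "(\<lambda>j. c * ?m j) \<longlonglongrightarrow> 1" using lim by simp
  moreover have "(\<lambda>j. c * ?m j) \<longlonglongrightarrow> c * 1" by (intro tendsto_intros mplus_tendsto z0)
  ultimately have "c = 1" using LIMSEQ_unique by fastforce
  then show ?thesis by (simp add: c)
qed

end

lemma Hop_energy: "(\<forall>n. Hop q f n = 2 * (1 - cos \<theta>) * f n) \<longleftrightarrow> is_sol q (exp (- \<i> * \<theta>)) f"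
proof -
  have eq: "2 * (1 - cos \<theta>) = 2 - exp (- \<i> * \<theta>) - inverse (exp (- \<i> * \<theta>))"
    by (simp add: cos_exp_eq exp_minus add_divide_distrib)
  show ?thesis unfolding is_sol_Hop eq ..
qed

lemma exp_phase: "exp (\<i> * of_int n * \<theta>) = exp (- \<i> * \<theta>) powi (- n)"
  by (simp add: exp_power_int mult_ac)

lemma int_at_top_nat: "((\<lambda>n::int. f n) \<longlongrightarrow> l) at_top \<longleftrightarrow> (\<lambda>j. f (int j)) \<longlonglongrightarrow> l"
proof
  assume "((\<lambda>n::int. f n) \<longlongrightarrow> l) at_top"
  then show "(\<lambda>j. f (int j)) \<longlonglongrightarrow> l"
    by (rule filterlim_compose) (rule filterlim_int_sequentially)
next
  assume *: "(\<lambda>j. f (int j)) \<longlonglongrightarrow> l"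
  have "((\<lambda>n. f (int (nat n))) \<longlongrightarrow> l) at_top"
    by (rule filterlim_compose[OF *]) (rule filterlim_nat_sequentially)
  then show "((\<lambda>n. f n) \<longlongrightarrow> l) at_top"
    by (rule Lim_transform_eventually) (auto intro!: eventually_at_top_linorderI[of 0])
qed

lemma jost_plus_eq:
  assumes "jost q \<sigma>" and z: "norm (exp (- \<i> * \<theta>)) = 1"
  shows "jost_plus q \<theta> = fp q (exp (- \<i> * \<theta>))"
  unfolding jost_plus_def Hop_energy exp_phase int_at_top_nat
proof (rule the_equality)
  interpret jost q \<sigma> by fact
  let ?z = "exp (- \<i> * \<theta>)"
  have z0: "?z \<noteq> 0" "norm ?z \<le> 1" using z by auto
  have "?z powi (- int j) * fp q ?z (int j) = mplus q (int j) ?z" for j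
    unfolding fp_def power_int_minus using z0(1) by (simp del: exp_not_eq_zero)
  then have "(\<lambda>j. ?z powi (- int j) * fp q ?z (int j)) \<longlonglongrightarrow> 1" using mplus_tendsto[OF z0(2)] by (simp only:)
  then show "is_sol q ?z (fp q ?z) \<and> (\<lambda>j. ?z powi (- int j) * fp q ?z (int j)) \<longlonglongrightarrow> 1"
    using fp_sol[OF z0] by blast
  show "f = fp q ?z" if "is_sol q ?z f \<and> (\<lambda>j. ?z powi (- int j) * f (int j)) \<longlonglongrightarrow> 1" for f
    using jost_plus_unique[OF z, of f] that by blast
qed

lemma jost_minus_eq:
  assumes "jost q \<sigma>" and z: "norm (exp (- \<i> * \<theta>)) = 1"
  shows "jost_minus q \<theta> = fm q (exp (- \<i> * \<theta>))"
proof -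
  interpret jost q \<sigma> by fact
  interpret r: jost "\<lambda>n. q (- n)" \<sigma> by (rule jost_reflect)
  let ?z = "exp (- \<i> * \<theta>)"
  have z0: "?z \<noteq> 0" "norm ?z \<le> 1" using z by auto
  have ph: "exp (- \<i> * of_int n * \<theta>) = ?z powi n" for n
    using exp_phase[of "- n" \<theta>] by simp
  have bot: "((\<lambda>n::int. ?z powi n * f n) \<longlongrightarrow> 1) at_bot \<longleftrightarrow> (\<lambda>j. ?z powi (- int j) * f (- int j)) \<longlonglongrightarrow> 1" for f
    unfolding at_bot_mirror filterlim_filtermap by (rule int_at_top_nat)
  show ?thesis unfolding jost_minus_def Hop_energy ph bot
  proof (rule the_equality)
    have "?z powi (- int j) * fm q ?z (- int j) = mminus q (- int j) ?z" for j
      unfolding fm_eq power_int_minus using z0(1) by (simp del: exp_not_eq_zero)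
    then have "(\<lambda>j. ?z powi (- int j) * fm q ?z (- int j)) \<longlonglongrightarrow> 1" using mminus_tendsto[OF z0(2)] by (simp only:)
    then show "is_sol q ?z (fm q ?z) \<and> (\<lambda>j. ?z powi (- int j) * fm q ?z (- int j)) \<longlonglongrightarrow> 1"
      using fm_sol[OF z0] by blast
    fix f assume f: "is_sol q ?z f \<and> (\<lambda>j. ?z powi (- int j) * f (- int j)) \<longlonglongrightarrow> 1"
    have "(\<lambda>n. f (- n)) = fp (\<lambda>n. q (- n)) ?z"
      by (rule r.jost_plus_unique[OF z]) (use f is_sol_reflect in auto)
    then have "f (- n) = fp (\<lambda>n. q (- n)) ?z n" for n by (rule fun_cong)
    from this[of "- n" for n] show "f = fm q ?z"
      unfolding fm_def[abs_def] by (intro ext) (simp only: minus_minus)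
  qed
qed

lemma generic_iff:
  assumes "jost q \<sigma>" shows "generic q \<longleftrightarrow> ww q 1 \<noteq> 0 \<and> ww q (- 1) \<noteq> 0"
proof -
  have e: "exp (- (\<i> * complex_of_real pi)) = - 1" "exp (\<i> * complex_of_real pi) = - 1"
    by (simp_all add: exp_minus flip: cis_conv_exp)
  show ?thesis
    using jost_plus_eq[OF assms, of 0] jost_minus_eq[OF assms, of 0]
      jost_plus_eq[OF assms, of "complex_of_real pi"] jost_minus_eq[OF assms, of "complex_of_real pi"]
      jost_plus_eq[OF assms, of "- complex_of_real pi"] jost_minus_eq[OF assms, of "- complex_of_real pi"]
    by (auto simp: generic_def Wr_def e ww_wronskian)
qed

lemma l1w_imp_jost:
  assumes "l1w (real k) q" "k = Suc \<sigma>" shows "jost q \<sigma>"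
proof
  have j: "1 + real_of_int \<bar>n\<bar> \<le> 2 * jbr (real_of_int n)" for n
  proof -
    have "1 \<le> jbr (real_of_int n)" "\<bar>real_of_int n\<bar> \<le> jbr (real_of_int n)"
      unfolding jbr_def by (auto intro: real_le_rsqrt)
    then show ?thesis by simp
  qed
  have s: "(\<lambda>n. 2 ^ k * (jbr (real_of_int n) powr real k * \<bar>q n\<bar>)) summable_on UNIV"
    using assms(1) unfolding l1w_def by (rule summable_on_cmult_right)
  show "(\<lambda>n. (1 + real_of_int \<bar>n\<bar>) ^ (\<sigma> + 1) * \<bar>q n\<bar>) summable_on UNIV"
  proof (rule summable_on_comparison_test[OF s])
    fix n
    have p: "0 < jbr (real_of_int n)" using j[of n] by linarith
    have "(1 + real_of_int \<bar>n\<bar>) ^ k \<le> (2 * jbr (real_of_int n)) ^ k"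
      by (rule power_mono[OF j]) simp
    also have "\<dots> = 2 ^ k * jbr (real_of_int n) powr real k"
      using p by (simp add: power_mult_distrib powr_realpow)
    finally have "(1 + real_of_int \<bar>n\<bar>) ^ k * \<bar>q n\<bar> \<le> 2 ^ k * jbr (real_of_int n) powr real k * \<bar>q n\<bar>"
      by (rule mult_right_mono) simp
    then show "(1 + real_of_int \<bar>n\<bar>) ^ (\<sigma> + 1) * \<bar>q n\<bar> \<le> 2 ^ k * (jbr (real_of_int n) powr real k * \<bar>q n\<bar>)"
      using assms(2) by (simp add: mult.assoc)
  qed simp
qed

section \<open>The dispersive estimate\<close>

text \<open>The two roots of z + 1/z = 2 - E have product 1, so one of them lies in the closed disc.
  Energies are complex here because \<open>eigvecs\<close> does not restrict E to be real.\<close>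

lemma quadratic_root: "\<exists>z. z \<noteq> 0 \<and> norm z \<le> 1 \<and> E = 2 - z - inverse (z :: complex)"
proof -
  define b where "b = (2 - E) / 2"
  define d where "d = csqrt (b\<^sup>2 - 1)"
  have d2: "d\<^sup>2 = b\<^sup>2 - 1" by (simp add: d_def)
  have p: "(b + d) * (b - d) = 1" using d2 by (simp add: power2_eq_square algebra_simps)
  then have inv: "inverse (b + d) = b - d" "inverse (b - d) = b + d"
    by (metis inverse_unique) (metis p inverse_unique mult.commute)
  have s: "(b + d) + (b - d) = 2 - E" by (simp add: b_def)
  have nz: "b + d \<noteq> 0" "b - d \<noteq> 0" using p by auto
  show ?thesis
  proof (cases "norm (b + d) \<le> 1")
    case True
    have "E = 2 - (b + d) - inverse (b + d)" unfolding inv using s by (simp add: algebra_simps)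
    then show ?thesis using True nz by blast
  next
    case False
    have "norm (b + d) * norm (b - d) = 1" by (metis p norm_mult norm_one)
    then have "norm (b - d) \<le> 1" using False
      by (smt (verit, best) mult_le_cancel_right1 norm_ge_zero)
    moreover have "E = 2 - (b - d) - inverse (b - d)" unfolding inv using s by (simp add: algebra_simps)
    ultimately show ?thesis using nz by blast
  qed
qed

lemma summable_on_int_LIMSEQ:
  fixes f :: "int \<Rightarrow> real"
  assumes "f summable_on UNIV"
  shows "(\<lambda>j. f (int j)) \<longlonglongrightarrow> 0" "(\<lambda>j. f (- int j)) \<longlonglongrightarrow> 0"
proof -
  have "f summable_on range int" "f summable_on range (\<lambda>j. - int j)"
    by (rule summable_on_subset_banach[OF assms]; simp)+
  then have "(\<lambda>j. f (int j)) summable_on UNIV" "(\<lambda>j. f (- int j)) summable_on UNIV"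
    using summable_on_reindex[of int UNIV f] summable_on_reindex[of "\<lambda>j. - int j" UNIV f]
    by (auto simp: o_def inj_def)
  then show "(\<lambda>j. f (int j)) \<longlonglongrightarrow> 0" "(\<lambda>j. f (- int j)) \<longlonglongrightarrow> 0"
    using summable_on_imp_summable summable_LIMSEQ_zero by blast+
qed

lemma l2_tendsto_0:
  assumes "l2 \<phi>" shows "(\<lambda>j. \<phi> (int j)) \<longlonglongrightarrow> 0" "(\<lambda>j. \<phi> (- int j)) \<longlonglongrightarrow> 0"
proof -
  note s = summable_on_int_LIMSEQ[OF assms[unfolded l2_def]]
  have r: "(\<lambda>j. g j) \<longlonglongrightarrow> 0" if "(\<lambda>j. (cmod (g j))\<^sup>2) \<longlonglongrightarrow> 0" for g
  proof -
    have "(\<lambda>j. sqrt ((cmod (g j))\<^sup>2)) \<longlonglongrightarrow> sqrt 0" by (intro tendsto_intros that)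
    then show ?thesis by (simp add: tendsto_norm_zero_iff)
  qed
  show "(\<lambda>j. \<phi> (int j)) \<longlonglongrightarrow> 0" by (rule r[OF s(1)])
  show "(\<lambda>j. \<phi> (- int j)) \<longlonglongrightarrow> 0" by (rule r[OF s(2)])
qed

context jost
begin

lemma fp_bounded: assumes "z \<noteq> 0" "norm z \<le> 1" shows "\<exists>A. \<forall>j. norm (fp q z (int j)) \<le> A"
proof -
  obtain A where A: "\<And>j. norm (fp q z (0 + int j)) \<le> A * norm z ^ j" using fp_decay[OF assms] by metis
  have "0 \<le> A" using order_trans[OF norm_ge_zero A[of 0]] by simp
  then have le: "A * norm z ^ j \<le> A" for j using mult_left_mono[OF power_le_one[of "norm z" j], of A] assms by simp
  have "norm (fp q z (int j)) \<le> A" for j using order_trans[OF A[of j] le[of j]] by simp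
  then show ?thesis by blast
qed

text \<open>The Wronskian with the bounded solution \<open>fp\<close> is constant, and it tends to 0
  along the decaying solution.\<close>

lemma decaying_multiple_fp:
  assumes z: "z \<noteq> 0" "norm z \<le> 1" and \<phi>: "is_sol q z \<phi>" and lim: "(\<lambda>j. \<phi> (int j)) \<longlonglongrightarrow> 0"
  shows "\<exists>c. \<phi> = (\<lambda>n. c * fp q z n)"
proof -
  note s = fp_sol[OF z]
  obtain A where A: "\<And>j. norm (fp q z (int j)) \<le> A" using fp_bounded[OF z] by blast
  have "(\<lambda>j. A * norm (\<phi> (int j)) + A * norm (\<phi> (int (Suc j)))) \<longlonglongrightarrow> A * norm (0::complex) + A * norm (0::complex)"
    by (intro tendsto_intros lim LIMSEQ_Suc[OF lim])
  then have 0: "(\<lambda>j. A * norm (\<phi> (int j)) + A * norm (\<phi> (int (Suc j)))) \<longlonglongrightarrow> 0" by simp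
  have "norm (wronskian (fp q z) \<phi> 0) \<le> A * norm (\<phi> (int j)) + A * norm (\<phi> (int (Suc j)))" for j
  proof -
    have "wronskian (fp q z) \<phi> 0 = fp q z (int (Suc j)) * \<phi> (int j) - fp q z (int j) * \<phi> (int (Suc j))"
      using wronskian_const[OF s \<phi>, of "int j"] by (simp add: wronskian_def add.commute)
    then have "norm (wronskian (fp q z) \<phi> 0) \<le> norm (fp q z (int (Suc j)) * \<phi> (int j)) + norm (fp q z (int j) * \<phi> (int (Suc j)))"
      by (simp only: norm_triangle_ineq4)
    also have "\<dots> \<le> A * norm (\<phi> (int j)) + A * norm (\<phi> (int (Suc j)))"
      unfolding norm_mult by (intro add_mono mult_right_mono A) auto
    finally show ?thesis .
  qed
  then have "norm (wronskian (fp q z) \<phi> 0) \<le> 0"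
    by (intro LIMSEQ_le_const[OF 0]) auto
  then show ?thesis using wronskian_0_multiple[OF s \<phi>] fp_nonzero[OF z] by auto
qed

end

section \<open>The projection onto the continuous spectrum and the evolution\<close>

context jost_fac
begin

text \<open>Decay at both ends makes an eigenvector a multiple of both Jost solutions, so
  \<open>ww\<close> vanishes. An energy in the band, |z| = 1, is excluded because there the modulus
  |c| |m_+| tends to |c| instead of 0.\<close>

lemma eigvecs_fp: assumes "\<phi> \<in> eigvecs q" shows "\<exists>a\<in>Z. \<exists>c. \<phi> = (\<lambda>n. c * fp q a n)"
proof -
  obtain E where \<phi>: "l2 \<phi>" "\<phi> \<noteq> (\<lambda>n. 0)" "\<And>n. Hop q \<phi> n = E * \<phi> n"
    using assms unfolding eigvecs_def by blast
  obtain z where z: "z \<noteq> 0" "norm z \<le> 1" "E = 2 - z - inverse z" using quadratic_root by blast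
  have s: "is_sol q z \<phi>" using \<phi>(3) z(3) by (simp add: is_sol_Hop)
  obtain c where c: "\<phi> = (\<lambda>n. c * fp q z n)"
    using decaying_multiple_fp[OF z(1,2) s l2_tendsto_0(1)[OF \<phi>(1)]] by blast
  have c0: "c \<noteq> 0" using c \<phi>(2) by auto
  obtain d where d: "(\<lambda>n. \<phi> (- n)) = (\<lambda>n. d * fp (\<lambda>n. q (- n)) z n)"
    using jost.decaying_multiple_fp[OF jost_reflect z(1,2) is_sol_reflect[OF s]] l2_tendsto_0(2)[OF \<phi>(1)] by blast
  have d': "\<phi> n = d * fm q z n" for n using fun_cong[OF d, of "- n"] by (simp add: fm_def)
  then have d0: "d \<noteq> 0" using \<phi>(2) by auto
  have "norm z \<noteq> 1"
  proof
    assume nz: "norm z = 1"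
    have "(\<lambda>j. norm (\<phi> (int j))) \<longlonglongrightarrow> norm (0::complex)" by (intro tendsto_intros l2_tendsto_0 \<phi>)
    moreover have "norm (\<phi> (int j)) = norm c * norm (mplus q (int j) z)" for j
      using nz by (simp add: c fp_def norm_mult norm_power)
    moreover have "(\<lambda>j. norm c * norm (mplus q (int j) z)) \<longlonglongrightarrow> norm c * norm (1::complex)"
      by (intro tendsto_intros mplus_tendsto z)
    ultimately have "norm c * norm (1::complex) = norm (0::complex)" using LIMSEQ_unique by (metis (no_types, lifting) LIMSEQ_unique ext)
    then show False using c0 by simp
  qed
  then have n1: "norm z < 1" using z by simp
  have "d * fm q z n = c * fp q z n" for n using d' c by metis
  then have "fm q z n = c / d * fp q z n" for n using d0 by (simp add: field_simps)
  then have "wronskian (fp q z) (fm q z) 0 = 0" by (simp add: wronskian_def)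
  then have "z \<in> Z" using n1 z by (simp add: Z_def ww_wronskian)
  then show ?thesis using c by blast
qed

lemma fp_l1: "a \<in> Z \<Longrightarrow> l1 (fp q a)"
  unfolding l1_def by (rule fp_summable) (use Z_props in auto)

lemma fp_eigvec: assumes "a \<in> Z" shows "fp q a \<in> eigvecs q"
proof -
  note Za = Z_props[OF assms]
  have "is_sol q a (fp q a)" by (rule fp_sol) (use Za in auto)
  moreover have "fp q a \<noteq> (\<lambda>n. 0)" using fp_nonzero[of a] Za by auto
  ultimately show ?thesis
    unfolding eigvecs_def is_sol_Hop using l1_imp_l2[OF fp_l1[OF assms]] by blast
qed

lemma fp_real: "a \<in> Z \<Longrightarrow> cnj (fp q a n) = fp q a n"
  using fp_cnj[of q a n] Z_props(3)[of a] by (metis complex_cnj complex_surj complex_cnj_complex_of_real neg_equal_zero minus_zero)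

lemma kernel_bound: "\<exists>B\<ge>0. \<forall>n m. norm (cmean (FF n m)) \<le> B"
proof -
  obtain B where B: "\<And>n m z. norm z = 1 \<Longrightarrow> norm (FF n m z) \<le> B" using FF_bounded by blast
  have "norm (cmean (FF n m)) \<le> B" for n m by (rule norm_cmean_le[OF FF_continuous B])
  then show ?thesis by (meson norm_ge_zero order_trans)
qed

text \<open>By \<open>cmean_FF\<close> the right-hand side is \<open>w\<close> minus a combination
  \<open>v\<close> of finitely many eigenfunctions; by \<open>eigen_orthogonal\<close> it is
  orthogonal to all eigenvectors. Together these facts characterize the projection.\<close>

lemma Pc_eq:
  assumes w: "l1 w"
  shows "Pc q w n = - (\<Sum>\<^sub>\<infinity>m. cmean (FF n m) * w m)"
proof -
  obtain \<beta> where \<beta>: "\<And>n m. cmean (FF n m) = (if n = m then - 1 else 0) + (\<Sum>a\<in>Z. \<beta> a * (fp q a n * fp q a m))"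
    using cmean_FF by blast
  obtain B where B: "0 \<le> B" "\<And>n m. norm (cmean (FF n m)) \<le> B" using kernel_bound by blast
  have ws: "(\<lambda>m. norm (w m)) summable_on UNIV" using w by (simp add: l1_def)
  have aw: "(\<lambda>m. fp q a m * w m) summable_on UNIV" if "a \<in> Z" for a
  proof -
    have s: "(\<lambda>n. norm (fp q a n)) summable_on UNIV" using fp_l1[OF that] by (simp add: l1_def)
    have le: "norm (fp q a m) \<le> (\<Sum>\<^sub>\<infinity>n. norm (fp q a n))" for m
      using finite_sum_le_infsum[OF s, of "{m}"] by simp
    show ?thesis
      by (rule infsum_dominated(1)[OF summable_on_cmult_right[OF ws]])
        (unfold norm_mult, rule mult_right_mono[OF le], simp)
  qed
  define v where "v n = (\<Sum>a\<in>Z. (\<beta> a * (\<Sum>\<^sub>\<infinity>m. fp q a m * w m)) * fp q a n)" for n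
  have wv: "w n - v n = - (\<Sum>\<^sub>\<infinity>m. cmean (FF n m) * w m)" for n
  proof -
    have "((\<lambda>m. (if m = n then - w n else 0) + (\<Sum>a\<in>Z. \<beta> a * fp q a n * (fp q a m * w m))) has_sum
      - w n + (\<Sum>a\<in>Z. \<beta> a * fp q a n * (\<Sum>\<^sub>\<infinity>m. fp q a m * w m))) UNIV"
    proof (intro has_sum_add)
      show "((\<lambda>m. if m = n then - w n else 0) has_sum - w n) UNIV"
        by (rule has_sum_finite_neutralI[of "{n}"]) auto
      have "((\<lambda>m. \<Sum>a\<in>Y. \<beta> a * fp q a n * (fp q a m * w m)) has_sum
        (\<Sum>a\<in>Y. \<beta> a * fp q a n * (\<Sum>\<^sub>\<infinity>m. fp q a m * w m))) UNIV" if "finite Y" "Y \<subseteq> Z" for Y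
        using that
        by (induction Y rule: finite_induct) (auto intro!: has_sum_add has_sum_cmult_right has_sum_infsum aw)
      then show "((\<lambda>m. \<Sum>a\<in>Z. \<beta> a * fp q a n * (fp q a m * w m)) has_sum
        (\<Sum>a\<in>Z. \<beta> a * fp q a n * (\<Sum>\<^sub>\<infinity>m. fp q a m * w m))) UNIV" using finite_Z by blast
    qed
    moreover have "(if m = n then - w n else 0) + (\<Sum>a\<in>Z. \<beta> a * fp q a n * (fp q a m * w m)) = cmean (FF n m) * w m" for m
      unfolding \<beta> by (auto simp: distrib_right sum_distrib_left right_diff_distrib mult_ac)
    ultimately have "(\<Sum>\<^sub>\<infinity>m. cmean (FF n m) * w m) = - w n + (\<Sum>a\<in>Z. \<beta> a * fp q a n * (\<Sum>\<^sub>\<infinity>m. fp q a m * w m))"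
      by (simp add: has_sum_iff)
    then show ?thesis by (simp add: v_def mult_ac)
  qed
  have "Pd q w = v"
  proof (rule Pd_eqI[OF l1_imp_l2[OF w]])
    obtain h where h: "bij_betw h {0..<card Z} Z" using ex_bij_betw_nat_finite[OF finite_Z] by blast
    have "v = (\<lambda>n. \<Sum>i<card Z. (\<beta> (h i) * (\<Sum>\<^sub>\<infinity>m. fp q (h i) m * w m)) * fp q (h i) n)"
      unfolding v_def[abs_def] lessThan_atLeast0
      by (rule ext) (rule sum.reindex_bij_betw[OF h, symmetric])
    moreover have "\<forall>i<card Z. fp q (h i) \<in> eigvecs q"
      using bij_betwE[OF h] fp_eigvec by simp
    ultimately show "v \<in> lin_comb (eigvecs q)"
      unfolding lin_comb_def mem_Collect_eq
      by (intro exI[of _ "card Z"] exI[of _ "\<lambda>i. \<beta> (h i) * (\<Sum>\<^sub>\<infinity>m. fp q (h i) m * w m)"]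
          exI[of _ "\<lambda>i. fp q (h i)"] conjI)
    fix \<phi> assume "\<phi> \<in> eigvecs q"
    then obtain a c where a: "a \<in> Z" "\<phi> = (\<lambda>n. c * fp q a n)" using eigvecs_fp by blast
    have as: "(\<lambda>n. norm (fp q a n)) summable_on UNIV" using fp_l1[OF a(1)] by (simp add: l1_def)
    have "l2inner (\<lambda>n. w n - v n) (fp q a) = (\<Sum>\<^sub>\<infinity>n. - (\<Sum>\<^sub>\<infinity>m. fp q a n * (cmean (FF n m) * w m)))"
      unfolding l2inner_def fp_real[OF a(1)] wv
      by (rule infsum_cong, simp only: infsum_cmult_right', simp add: mult.commute)
    also have "\<dots> = - (\<Sum>\<^sub>\<infinity>n. \<Sum>\<^sub>\<infinity>m. fp q a n * (cmean (FF n m) * w m))"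
      by (rule infsum_uminus)
    also have "(\<Sum>\<^sub>\<infinity>n. \<Sum>\<^sub>\<infinity>m. fp q a n * (cmean (FF n m) * w m)) = (\<Sum>\<^sub>\<infinity>m. \<Sum>\<^sub>\<infinity>n. fp q a n * (cmean (FF n m) * w m))"
    proof (rule infsum_swap_dominated)
      show "(\<lambda>n. norm (fp q a n) * (B * l1norm w)) summable_on UNIV" by (rule summable_on_cmult_left[OF as])
      show "(\<lambda>m. norm (fp q a n) * (B * norm (w m))) summable_on UNIV" for n
        by (intro summable_on_cmult_right ws)
      show "(\<Sum>\<^sub>\<infinity>m. norm (fp q a n) * (B * norm (w m))) \<le> norm (fp q a n) * (B * l1norm w)" for n
        by (simp add: infsum_cmult_right' l1norm_def)
      show "norm (fp q a n * (cmean (FF n m) * w m)) \<le> norm (fp q a n) * (B * norm (w m))" for n m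
        unfolding norm_mult by (intro mult_left_mono mult_right_mono B) auto
    qed
    also have "\<dots> = (\<Sum>\<^sub>\<infinity>m. (\<Sum>\<^sub>\<infinity>n. fp q a n * cmean (FF n m)) * w m)"
      by (rule infsum_cong, simp only: mult.assoc[symmetric] infsum_cmult_left')
    also have "\<dots> = 0" using eigen_orthogonal[OF a(1)] by (simp add: has_sum_iff)
    finally have "l2inner (\<lambda>n. w n - v n) (fp q a) = 0" by simp
    then show "l2inner (\<lambda>n. w n - v n) \<phi> = 0" unfolding a(2) l2inner_scale_right by simp
  qed
  then show ?thesis using wv by (simp add: Pc_def)
qed

definition lam :: "complex \<Rightarrow> complex" where "lam z = 2 - z - inverse z"

lemma norm_lam: "norm z = 1 \<Longrightarrow> norm (lam z) \<le> 4"
  using norm_triangle_ineq4[of "2 - z" "inverse z"] norm_triangle_ineq4[of 2 z]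
  by (simp add: lam_def norm_inverse)

lemma lam_continuous: "continuous_on (sphere 0 1) lam"
  unfolding lam_def by (intro continuous_intros) auto

text \<open>The kernel of - P_c H^k: under the mean, H acts as multiplication by
  \<open>lam\<close>.\<close>

definition Kp :: "nat \<Rightarrow> int \<Rightarrow> int \<Rightarrow> complex" where
  "Kp k n m = cmean (\<lambda>z. lam z ^ k * FF n m z)"

lemma Kp_bound: "\<exists>B\<ge>0. \<forall>k n m. norm (Kp k n m) \<le> 4 ^ k * B"
proof -
  obtain B where B: "\<And>n m z. norm z = 1 \<Longrightarrow> norm (FF n m z) \<le> B" using FF_bounded by blast
  have B0: "0 \<le> B" using order_trans[OF norm_ge_zero B[of 1 0 0]] by simp
  have "norm (Kp k n m) \<le> 4 ^ k * B" for k n m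
    unfolding Kp_def
  proof (rule norm_cmean_le)
    show "continuous_on (sphere 0 1) (\<lambda>z. lam z ^ k * FF n m z)"
      by (intro continuous_intros lam_continuous FF_continuous)
    fix z :: complex assume "norm z = 1"
    then show "norm (lam z ^ k * FF n m z) \<le> 4 ^ k * B"
      unfolding norm_mult norm_power by (intro mult_mono power_mono norm_lam B) auto
  qed
  then show ?thesis using B0 by blast
qed

lemma cmean_linear3:
  assumes "continuous_on (sphere 0 1) f" "continuous_on (sphere 0 1) g" "continuous_on (sphere 0 1) h"
  shows "cmean (\<lambda>z. a * f z + (b * g z + c * h z)) = a * cmean f + (b * cmean g + c * cmean h)"
proof -
  have m: "continuous_on (sphere 0 1) (\<lambda>z. d * k z)" if "continuous_on (sphere 0 1) k" for d and k :: "complex \<Rightarrow> complex"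
    by (intro continuous_intros that)
  show ?thesis
    using cmean_add[OF m[OF assms(1), of a] continuous_on_add[OF m[OF assms(2), of b] m[OF assms(3), of c]]]
      cmean_add[OF m[OF assms(2), of b] m[OF assms(3), of c]] by (simp only: cmean_cmult)
qed

text \<open>H acts in the second site, in which the kernel is symmetric with the first. The diagonal
  term produced is the mean of \<open>lam z ^ k * (inverse z - z)\<close>, odd under z -> 1/z and
  therefore zero.\<close>

lemma Hop_Kp: "Hop q (\<lambda>m. Kp k n m) m = Kp (Suc k) n m"
proof -
  have c: "continuous_on (sphere 0 1) (\<lambda>z. lam z ^ k * FF n m z)" for m k
    by (intro continuous_intros lam_continuous FF_continuous)
  have c2: "continuous_on (sphere 0 1) (\<lambda>z. lam z ^ k * (inverse z - z))"
    by (intro continuous_intros lam_continuous) auto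
  let ?d = "if n = m then - 1 else 0 :: complex"
  have "Hop q (\<lambda>m. Kp k n m) m = cmean (\<lambda>z. (2 + complex_of_real (q m)) * (lam z ^ k * FF n m z) +
     (- 1 * (lam z ^ k * FF n (m + 1) z) + - 1 * (lam z ^ k * FF n (m - 1) z)))"
    unfolding cmean_linear3[OF c c c] by (simp add: Hop_def Kp_def algebra_simps)
  also have "\<dots> = cmean (\<lambda>z. lam z ^ Suc k * FF n m z + ?d * (lam z ^ k * (inverse z - z)))"
  proof (rule cmean_cong)
    fix z :: complex assume z: "norm z = 1"
    have "(2 + complex_of_real (q m)) * (lam z ^ k * FF n m z) +
     (- 1 * (lam z ^ k * FF n (m + 1) z) + - 1 * (lam z ^ k * FF n (m - 1) z)) = lam z ^ k * Hop q (\<lambda>m. FF m n z) m"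
      by (simp add: Hop_def FF_commute[of n] algebra_simps)
    also have "\<dots> = lam z ^ k * (lam z * FF n m z + ?d * (inverse z - z))"
      unfolding Hop_FF[OF z] by (simp add: lam_def FF_commute[of n])
    finally show "(2 + complex_of_real (q m)) * (lam z ^ k * FF n m z) +
     (- 1 * (lam z ^ k * FF n (m + 1) z) + - 1 * (lam z ^ k * FF n (m - 1) z)) = lam z ^ Suc k * FF n m z + ?d * (lam z ^ k * (inverse z - z))"
      by (simp add: algebra_simps)
  qed
  also have "\<dots> = Kp (Suc k) n m + ?d * cmean (\<lambda>z. lam z ^ k * (inverse z - z))"
    using cmean_add[OF c[of "Suc k" m] continuous_on_mult[OF continuous_on_const c2, of ?d]]
    by (simp only: cmean_cmult Kp_def)
  also have "cmean (\<lambda>z. lam z ^ k * (inverse z - z)) = 0"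
    by (rule cmean_odd) (simp add: lam_def algebra_simps)
  finally show ?thesis by simp
qed

lemma Hop_l1:
  assumes u: "l1 u" and Q: "\<And>n. \<bar>q n\<bar> \<le> Q"
  shows "l1 (Hop q u)" "l1norm (Hop q u) \<le> (4 + Q) * l1norm u"
proof -
  have us: "(\<lambda>n. cmod (u n)) summable_on UNIV" using u by (simp add: l1_def)
  have bij: "bij (\<lambda>n::int. n + k)" for k by (rule bij_betwI[of _ _ _ "\<lambda>n. n - k"]) auto
  have "((\<lambda>n. cmod (u (n + k))) has_sum l1norm u) UNIV" for k
    using has_sum_reindex_bij_betw[OF bij, of "\<lambda>n. cmod (u n)" k] us by (simp add: l1norm_def)
  from this[of 1] this[of "-1"] this[of 0]
  have h: "((\<lambda>n. cmod (u (n + 1)) + (cmod (u (n - 1)) + (2 + Q) * cmod (u n))) has_sum l1norm u + (l1norm u + (2 + Q) * l1norm u)) UNIV"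
    by (intro has_sum_add has_sum_cmult_right) simp_all
  have le: "cmod (Hop q u n) \<le> cmod (u (n + 1)) + (cmod (u (n - 1)) + (2 + Q) * cmod (u n))" for n
  proof -
    have "Hop q u n = - u (n + 1) + (- u (n - 1) + (2 + complex_of_real (q n)) * u n)"
      by (simp add: Hop_def algebra_simps)
    then have "cmod (Hop q u n) \<le> cmod (u (n + 1)) + (cmod (u (n - 1)) + cmod ((2 + complex_of_real (q n)) * u n))"
      using norm_triangle_ineq[of "- u (n + 1)" "- u (n - 1) + (2 + complex_of_real (q n)) * u n"]
        norm_triangle_ineq[of "- u (n - 1)" "(2 + complex_of_real (q n)) * u n"] by simp
    also have "cmod ((2 + complex_of_real (q n)) * u n) \<le> (2 + Q) * cmod (u n)"
      unfolding norm_mult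
      by (intro mult_right_mono order_trans[OF norm_triangle_ineq]) (use Q[of n] in auto)
    finally show ?thesis by simp
  qed
  show "l1 (Hop q u)" unfolding l1_def
    by (rule infsum_dominated(3)[OF has_sum_imp_summable[OF h] le])
  have "l1norm (Hop q u) \<le> infsum (\<lambda>n. cmod (u (n + 1)) + (cmod (u (n - 1)) + (2 + Q) * cmod (u n))) UNIV"
    unfolding l1norm_def
    by (rule infsum_mono[OF infsum_dominated(3)[OF has_sum_imp_summable[OF h] le] has_sum_imp_summable[OF h] le])
  also have "\<dots> = (4 + Q) * l1norm u" using h by (simp add: has_sum_iff algebra_simps)
  finally show "l1norm (Hop q u) \<le> (4 + Q) * l1norm u" .
qed

lemma Hop_power_l1:
  assumes u: "l1 u" and Q: "\<And>n. \<bar>q n\<bar> \<le> Q"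
  shows "l1 ((Hop q ^^ k) u) \<and> l1norm ((Hop q ^^ k) u) \<le> (4 + Q) ^ k * l1norm u"
proof (induction k)
  case (Suc k)
  have "0 \<le> 4 + Q" using Q[of 0] by linarith
  with Suc Hop_l1[OF _ Q, of "(Hop q ^^ k) u"] show ?case
    using mult_left_mono[of "l1norm ((Hop q ^^ k) u)" "(4 + Q) ^ k * l1norm u" "4 + Q"] by auto
qed (use u in auto)

text \<open>H is shifted from the iterates of \<open>u\<close>, which stay in l^1, onto the bounded
  kernel, one power at a time.\<close>

lemma Kp_Hop_power:
  assumes u: "l1 u"
  shows "(\<Sum>\<^sub>\<infinity>m. Kp j n m * (Hop q ^^ k) u m) = (\<Sum>\<^sub>\<infinity>m. Kp (j + k) n m * u m)"
proof (induction k arbitrary: j)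
  case (Suc k)
  obtain Q where Q: "\<And>n. \<bar>q n\<bar> \<le> Q" using q_bounded by blast
  obtain B where B: "\<And>k n m. norm (Kp k n m) \<le> 4 ^ k * B" using Kp_bound by blast
  have s: "(\<lambda>m. norm ((Hop q ^^ k) u m)) summable_on UNIV"
    using Hop_power_l1[OF u Q, of k] by (simp add: l1_def)
  have "(\<Sum>\<^sub>\<infinity>m. Kp j n m * Hop q ((Hop q ^^ k) u) m) = (\<Sum>\<^sub>\<infinity>m. Hop q (\<lambda>m. Kp j n m) m * (Hop q ^^ k) u m)"
    by (rule Hop_symmetric(1)[OF s B Q])
  then show ?case using Suc[of "Suc j"] by (simp add: Hop_Kp)
qed simp

lemma exp_has_sum: "((\<lambda>k. x ^ k / fact k) has_sum exp (x :: complex)) UNIV"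
proof (rule norm_summable_imp_has_sum)
  show "summable (\<lambda>k. norm (x ^ k / fact k))"
    using summable_norm_exp[of x] by (simp add: scaleR_conv_of_real divide_inverse mult.commute)
  show "(\<lambda>k. x ^ k / fact k) sums exp x"
    using exp_converges[of x] by (simp add: scaleR_conv_of_real divide_inverse mult.commute)
qed

lemma exp_has_sum_real: "((\<lambda>k. x ^ k / fact k) has_sum exp (x :: real)) UNIV"
proof (rule norm_summable_imp_has_sum)
  show "summable (\<lambda>k. norm (x ^ k / fact k))"
    using summable_norm_exp[of x] by (simp add: divide_inverse mult.commute)
  show "(\<lambda>k. x ^ k / fact k) sums exp x"
    using exp_converges[of x] by (simp add: divide_inverse mult.commute)
qed

text \<open>Term by term in the exponential series the powers of H move onto the kernel and become
  powers of \<open>lam\<close>, and the series then resums to \<open>osc\<close>. The exchanges of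
  summation rest on geometric growth in k: (4 + Q)^k for the iterates of \<open>u\<close> in l^1 and
  4^k for the kernels.\<close>

lemma Pc_expH:
  assumes u: "l1 u"
  shows "Pc q (expH q t u) n = - (\<Sum>\<^sub>\<infinity>m. cmean (\<lambda>z. osc t z * FF n m z) * u m)"
proof -
  obtain Q where Q: "\<And>n. \<bar>q n\<bar> \<le> Q" using q_bounded by blast
  obtain B where B: "0 \<le> B" "\<And>k n m. norm (Kp k n m) \<le> 4 ^ k * B" using Kp_bound by blast
  have us: "(\<lambda>m. cmod (u m)) summable_on UNIV" using u by (simp add: l1_def)
  define c where "c k = (\<i> * complex_of_real t) ^ k / fact k" for k
  have nc: "norm (c k) = \<bar>t\<bar> ^ k / fact k" for k
    by (simp add: c_def norm_divide norm_mult norm_power)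
  let ?H = "\<lambda>k. (Hop q ^^ k) u"
  have Hs: "(\<lambda>m. cmod (?H k m)) summable_on UNIV" and Hn: "(\<Sum>\<^sub>\<infinity>m. cmod (?H k m)) \<le> (4 + Q) ^ k * l1norm u" for k
    using Hop_power_l1[OF u Q, of k] by (auto simp: l1_def l1norm_def)
  have cs: "(\<lambda>k. norm (c k) * (x ^ k * y)) summable_on UNIV" if "0 \<le> x" for x y
  proof -
    have "(\<lambda>k. (\<bar>t\<bar> * x) ^ k / fact k * y) summable_on UNIV"
      using exp_has_sum_real by (intro summable_on_cmult_left) (auto simp: has_sum_iff)
    then show ?thesis by (simp add: nc power_mult_distrib mult_ac)
  qed
  have Q4: "0 \<le> 4 + Q" using Q[of 0] by linarith
  have gs: "(\<lambda>m. norm (c k) * cmod (?H k m)) summable_on UNIV" for k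
    by (rule summable_on_cmult_right[OF Hs])
  have gb: "(\<Sum>\<^sub>\<infinity>m. norm (c k) * cmod (?H k m)) \<le> norm (c k) * ((4 + Q) ^ k * l1norm u)" for k
    unfolding infsum_cmult_right' by (intro mult_left_mono Hn) simp
  have gn: "norm (c k * ?H k m) \<le> norm (c k) * cmod (?H k m)" for k m by (simp add: norm_mult)
  \<comment> \<open>Joint absolute summability over powers and sites puts the evolved state in l^1,
    so that \<open>Pc_eq\<close> applies to it.\<close>
  note sp = summable_on_product_dominated[OF cs[OF Q4] gs gb gn]
  have sw: "(\<lambda>(m,k). norm (c k) * cmod (?H k m)) summable_on (UNIV \<times> UNIV)"
    using sp(1) summable_on_swap[of "\<lambda>(k,m). norm (c k) * cmod (?H k m)" UNIV UNIV] by simp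
  have col: "(\<lambda>k. norm (c k) * cmod (?H k m)) summable_on UNIV" for m
    using summable_on_SigmaD1[OF sw, of m] by simp
  have tot: "(\<lambda>m. \<Sum>\<^sub>\<infinity>k. norm (c k) * cmod (?H k m)) summable_on UNIV"
    using summable_on_Sigma_banach[OF sw] by simp
  have ex: "expH q t u m = (\<Sum>\<^sub>\<infinity>k. c k * ?H k m)" for m
  proof -
    have "(\<lambda>k. c k * ?H k m) summable_on UNIV"
      by (rule infsum_dominated(1)[OF col gn])
    then have "(\<lambda>k. c k * ?H k m) sums (\<Sum>\<^sub>\<infinity>k. c k * ?H k m)"
      by (intro has_sum_imp_sums has_sum_infsum)
    then show ?thesis by (simp add: expH_def c_def sums_iff)
  qed
  have "l1 (expH q t u)"
    unfolding l1_def
    by (rule infsum_dominated(3)[OF tot]) (unfold ex, rule infsum_dominated(2)[OF col gn])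
  from Pc_eq[OF this]
  have "Pc q (expH q t u) n = - (\<Sum>\<^sub>\<infinity>m. cmean (FF n m) * expH q t u m)" .
  also have "(\<Sum>\<^sub>\<infinity>m. cmean (FF n m) * expH q t u m) = (\<Sum>\<^sub>\<infinity>m. \<Sum>\<^sub>\<infinity>k. Kp 0 n m * (c k * ?H k m))"
    unfolding ex by (simp add: Kp_def infsum_cmult_right')
  also have "\<dots> = (\<Sum>\<^sub>\<infinity>k. \<Sum>\<^sub>\<infinity>m. Kp 0 n m * (c k * ?H k m))"
  proof (rule infsum_swap_dominated[symmetric])
    show "(\<lambda>k. B * (norm (c k) * ((4 + Q) ^ k * l1norm u))) summable_on UNIV"
      by (rule summable_on_cmult_right[OF cs[OF Q4]])
    show "(\<lambda>m. B * (norm (c k) * cmod (?H k m))) summable_on UNIV" for k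
      by (rule summable_on_cmult_right[OF gs])
    show "(\<Sum>\<^sub>\<infinity>m. B * (norm (c k) * cmod (?H k m))) \<le> B * (norm (c k) * ((4 + Q) ^ k * l1norm u))" for k
      unfolding infsum_cmult_right'[of B] by (rule mult_left_mono[OF gb B(1)])
    show "norm (Kp 0 n m * (c k * ?H k m)) \<le> B * (norm (c k) * cmod (?H k m))" for k m
      unfolding norm_mult using B(2)[of 0 n m] by (intro mult_right_mono) auto
  qed
  also have "\<dots> = (\<Sum>\<^sub>\<infinity>k. c k * (\<Sum>\<^sub>\<infinity>m. Kp k n m * u m))"
  proof (rule infsum_cong)
    fix k
    have "(\<Sum>\<^sub>\<infinity>m. Kp 0 n m * (c k * ?H k m)) = c k * (\<Sum>\<^sub>\<infinity>m. Kp 0 n m * ?H k m)"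
      by (simp add: infsum_cmult_right'[symmetric] mult_ac)
    then show "(\<Sum>\<^sub>\<infinity>m. Kp 0 n m * (c k * ?H k m)) = c k * (\<Sum>\<^sub>\<infinity>m. Kp k n m * u m)"
      using Kp_Hop_power[OF u, of 0 n k] by simp
  qed
  also have "\<dots> = (\<Sum>\<^sub>\<infinity>k. \<Sum>\<^sub>\<infinity>m. c k * (Kp k n m * u m))"
    by (simp add: infsum_cmult_right')
  also have "\<dots> = (\<Sum>\<^sub>\<infinity>m. \<Sum>\<^sub>\<infinity>k. c k * (Kp k n m * u m))"
  proof (rule infsum_swap_dominated)
    show "(\<lambda>k. norm (c k) * (4 ^ k * (B * l1norm u))) summable_on UNIV" by (rule cs) simp
    show "(\<lambda>m. norm (c k) * (4 ^ k * (B * cmod (u m)))) summable_on UNIV" for k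
      by (intro summable_on_cmult_right us)
    show "(\<Sum>\<^sub>\<infinity>m. norm (c k) * (4 ^ k * (B * cmod (u m)))) \<le> norm (c k) * (4 ^ k * (B * l1norm u))" for k
      by (simp add: infsum_cmult_right' l1norm_def)
    show "norm (c k * (Kp k n m * u m)) \<le> norm (c k) * (4 ^ k * (B * cmod (u m)))" for k m
      using mult_right_mono[OF B(2)[of k n m], of "cmod (u m)"]
      by (simp add: norm_mult mult_left_mono mult.assoc)
  qed
  also have "\<dots> = (\<Sum>\<^sub>\<infinity>m. cmean (\<lambda>z. osc t z * FF n m z) * u m)"
  proof (rule infsum_cong)
    fix m
    obtain B' where B': "\<And>n m z. norm z = 1 \<Longrightarrow> norm (FF n m z) \<le> B'" using FF_bounded by blast
    have "((\<lambda>k. cmean (\<lambda>z. c k * (lam z ^ k * FF n m z))) has_sum cmean (\<lambda>z. osc t z * FF n m z)) UNIV"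
    proof (rule cmean_has_sum(1))
      show "continuous_on (sphere 0 1) (\<lambda>z. c k * (lam z ^ k * FF n m z))" for k
        by (intro continuous_intros lam_continuous FF_continuous)
      show "(\<lambda>k. norm (c k) * (4 ^ k * B')) summable_on UNIV" by (rule cs) simp
      fix z :: complex assume z: "norm z = 1"
      show "norm (c k * (lam z ^ k * FF n m z)) \<le> norm (c k) * (4 ^ k * B')" for k
        unfolding norm_mult norm_power by (intro mult_left_mono mult_mono power_mono norm_lam B' z) auto
      have "((\<lambda>k. (\<i> * complex_of_real t * lam z) ^ k / fact k * FF n m z) has_sum exp (\<i> * complex_of_real t * lam z) * FF n m z) UNIV"
        by (rule has_sum_cmult_left[OF exp_has_sum])
      then show "((\<lambda>k. c k * (lam z ^ k * FF n m z)) has_sum osc t z * FF n m z) UNIV"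
        by (simp add: osc_def c_def lam_def power_mult_distrib mult_ac)
    qed
    then have "(\<Sum>\<^sub>\<infinity>k. c k * Kp k n m) = cmean (\<lambda>z. osc t z * FF n m z)"
      by (simp add: cmean_cmult Kp_def has_sum_iff)
    then show "(\<Sum>\<^sub>\<infinity>k. c k * (Kp k n m * u m)) = cmean (\<lambda>z. osc t z * FF n m z) * u m"
      by (simp add: mult.assoc[symmetric] infsum_cmult_left')
  qed
  finally show ?thesis .
qed

lemma dispersive_estimate:
  "\<exists>C>0. \<forall>t::real. \<forall>u. l1 u \<longrightarrow>
           (\<forall>n. cmod (Pc q (expH q t u) n) \<le> C * jbr t powr (-1/3) * l1norm u)"
proof -
  obtain B where B: "\<And>n m. cw.wa 0 (FF n m) B" using FF_wa by blast
  have B0: "0 \<le> B" using cw.wa_ge_0[OF B] .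
  \<comment> \<open>The summand 1 keeps the constant positive also when B = 0.\<close>
  have "cmod (Pc q (expH q t u) n) \<le> (16 * B + 1) * jbr t powr (-1/3) * l1norm u" if u: "l1 u" for t u n
  proof -
    have us: "(\<lambda>m. cmod (u m)) summable_on UNIV" using u by (simp add: l1_def)
    let ?C = "16 * B * jbr t powr (-1/3)"
    have "cmod (Pc q (expH q t u) n) = cmod (\<Sum>\<^sub>\<infinity>m. cmean (\<lambda>z. osc t z * FF n m z) * u m)"
      by (simp add: Pc_expH[OF u])
    also have "\<dots> \<le> (\<Sum>\<^sub>\<infinity>m. ?C * cmod (u m))"
    proof (rule infsum_dominated(2)[OF summable_on_cmult_right[OF us]])
      fix m
      show "cmod (cmean (\<lambda>z. osc t z * FF n m z) * u m) \<le> ?C * cmod (u m)"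
        unfolding norm_mult by (rule mult_right_mono[OF osc_cmean_wa[OF B]]) simp
    qed
    also have "\<dots> = ?C * l1norm u" by (simp add: infsum_cmult_right' l1norm_def)
    also have "\<dots> \<le> (16 * B + 1) * jbr t powr (-1/3) * l1norm u"
      by (intro mult_right_mono) (auto simp: l1norm_def infsum_nonneg)
    finally show ?thesis .
  qed
  then show ?thesis using B0 by (intro exI[of _ "16 * B + 1"]) auto
qed

end

theorem theorem1p3:
  fixes q :: "int \<Rightarrow> real"
  assumes "generic q \<Longrightarrow> l1w 1 q"
    and "\<not> generic q \<Longrightarrow> l1w 2 q"
  shows "\<exists>C>0. \<forall>t::real. \<forall>u. l1 u \<longrightarrow>
           (\<forall>n. cmod (Pc q (expH q t u) n) \<le> C * jbr t powr (-1/3) * l1norm u)"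
proof -
  have "\<exists>s s' v0 N N'. jost_fac q s s' v0 N N'"
  proof (cases "generic q")
    case True
    have "l1w (real 1) q" using assms(1)[OF True] by (simp only: of_nat_1)
    then have J: "jost q 0" by (rule l1w_imp_jost) simp
    from jost.jost_fac_nonresonant[OF J] True show ?thesis by (simp add: generic_iff[OF J])
  next
    case False
    have "l1w (real 2) q" using assms(2)[OF False] by (simp only: of_nat_numeral)
    then have J: "jost q 1" by (rule l1w_imp_jost) simp
    from jost.jost_fac_resonant[OF J] show ?thesis by simp
  qed
  then obtain s s' v0 N N' where "jost_fac q s s' v0 N N'" by blast
  then show ?thesis by (rule jost_fac.dispersive_estimate)
qed

end
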